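(* Let $\hat\alpha\in\{-2,-3,\dots\}$ and let $\mathcal F=(F_1,F_2)$ be a pair of finite sets of positive integers satisfying $\{0,1,\dots,-\hat\alpha-1\}\subset F_1\cup(-\hat\alpha-1-F_2)$. The following are equivalent: (1) $\hat\alpha+1$ and $\mathcal F$ are admissible, i.e. $\prod_{h\in\mathcal H}(x-h)\ge0$ for all $x\in\mathbb N\setminus F_1$, where $\mathcal H$ is computed with $\hat c=\hat\alpha+1$; (2) $\Omega^{\hat\alpha}_{\mathcal F}(x)\ne0$ for all $x\in[0,+\infty)$.
   Context: $\mathbb N=\{0,1,\dots\}$; $t-F=\{t-f:f\in F\}$; $k_i=|F_i|$, $k=k_1+k_2$. $\mathcal H=[(F_1\cup(-\hat c-F_2))\setminus\{0,\dots,-\hat c\}]\cup[F_1\cap(-\hat c-F_2)]$. Laguerre: $L_n^\alpha(x)=\sum_{j=0}^n\frac{(-x)^j}{j!}\binom{n+\alpha}{n-j}$. $\Omega^{\hat\alpha}_{\mathcal F}(x)$ is the $k\times k$ determinant with rows $\big((L_f^{\hat\alpha})^{(j-1)}(x)\big)_{j=1}^k$, $f\in F_1$ (increasing), followed by rows $\big(L_f^{\hat\alpha+j-1}(-x)\big)_{j=1}^k$, $f\in F_2$; $^{(j-1)}$ denotes the $(j-1)$-th derivative. *)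

theory Defs
  imports "HOL-Computational_Algebra.Polynomial" "Jordan_Normal_Form.Determinant"
begin

definition laguerre_poly :: "nat \<Rightarrow> real \<Rightarrow> real poly" where
  "laguerre_poly n a =
     (\<Sum>j\<le>n. monom ((-1) ^ j / fact j * ((real n + a) gchoose (n - j))) j)"

definition laguerre :: "nat \<Rightarrow> real \<Rightarrow> real \<Rightarrow> real" where
  "laguerre n a x = poly (laguerre_poly n a) x"

definition Omega :: "real \<Rightarrow> nat set \<Rightarrow> nat set \<Rightarrow> real \<Rightarrow> real" where
  "Omega a F1 F2 x =
     (let k1 = card F1; k = card F1 + card F2;
          l1 = sorted_list_of_set F1; l2 = sorted_list_of_set F2
      in det (mat k k (\<lambda>(i, j).
           if i < k1 then poly ((pderiv ^^ j) (laguerre_poly (l1 ! i) a)) x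
           else laguerre (l2 ! (i - k1)) (a + real j) (- x))))"

definition Hset :: "int \<Rightarrow> nat set \<Rightarrow> nat set \<Rightarrow> int set" where
  "Hset c F1 F2 =
     ((int ` F1 \<union> (\<lambda>f. - c - int f) ` F2) - {0..-c})
     \<union> (int ` F1 \<inter> (\<lambda>f. - c - int f) ` F2)"

definition admissible :: "int \<Rightarrow> nat set \<Rightarrow> nat set \<Rightarrow> bool" where
  "admissible c F1 F2 \<longleftrightarrow>
     (\<forall>x::nat. x \<notin> F1 \<longrightarrow> (\<Prod>h\<in>Hset c F1 F2. (int x - h)) \<ge> 0)"

end

theory Submission
  imports Defs "HOL-Probability.Distributions"
begin

text \<open>Write $a=-m$, $D=x\partial^2+(1-m-x)\partial$. Up to a power of $e^x$, $\Omega$ is the Wronskian of the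
  eigenfunctions $\varphi_f=L_f^{-m}(x)$ ($f\in F_1$, $D\varphi_f=-f\varphi_f$) and
  $\psi_f=e^xL_f^{-m}(-x)$ ($f\in F_2$, $D\psi_f=-(m-1-f)\psi_f$). Let $P$ be the monic polynomial
  whose roots are these eigenvalues; under the covering hypothesis
  $P(x)=\prod_{h\in\mathcal H}(x-h)\prod_{n<m}(x-n)$, so admissibility says that $P(n)\ge0$ for
  $n\ge m$, $n\notin F_1$, and $(-1)^{m-1-n}P'(n)\ge0$ for $n<m$, $n\notin F_1$. The size $k$ of the
  Wronskian may be taken even.

  Necessity: let $y=\varphi_n$ and let $u_t$ be the element of the span of the seeds with the same
  jet of order $<k$ as $y$ at $t$. The concomitant of $P(-D)$ evaluated on $(u_t,y)$ at $t$ has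
  derivative $x^{k-m}e^{-x}Y^2-P(n)x^{-m}e^{-x}y^2$ and vanishes at infinity; comparing with its value
  at $0$ gives the sign conditions.

  Sufficiency: if $\Omega(x_0)=0$, some $u\neq0$ in the span has a zero of order $k$ at $x_0$. Write
  $u=u_L-u_R$ with $u_L=O(x^m)$ at $0$ and $u_R$ a polynomial, and glue $u_L$, $u_R$ at $x_0$ to a
  function $U$. Splitting $P=P_1P_2$ with equal degrees, Parseval gives
  $\sum_n P(n)U_n^2/h_n=\langle P_1U,P_2U\rangle$, whose right side is a local expression of sign
  opposite to the left side; hence $U$ is a combination of the $\varphi_f$ and $u=0$.\<close>

section \<open>Laguerre polynomials, eigenfunction jets and divided differences\<close>

text \<open>The weight x^(-m) e^(-x) that makes D symmetric is not integrable at 0, so the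
  polynomials L_n^(-m) with n < m lie outside the Hilbert space; only those with n >= m form the
  orthogonal basis. The low eigenvalues therefore act through boundary terms: n < m belongs to both
  L_n^(-m) and e^x L_(m-1-n)^(-m)(-x), whose weighted Wronskian is a nonzero constant of sign
  (-1)^(n+1), and this constant is what couples to P'(n). If both functions are seeds, n is a double
  root and P'(n) = 0. The equal split of P is dictated by the order of vanishing: a polynomial of
  degree k/2 - 1 in the second-order operator D, followed by one derivative, uses derivatives up to
  order k - 1, exactly those known to vanish. At x = 0 the equation is singular and nothing can be
  glued; there an indicial argument takes over, in which each application of D costs only one
  derivative.\<close>

lemma coeff_laguerre_poly:
  "coeff (laguerre_poly n a) j =
     (if j \<le> n then (-1) ^ j / fact j * ((real n + a) gchoose (n - j)) else 0)"
  unfolding laguerre_poly_def by (simp add: coeff_sum)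

lemma degree_laguerre_poly [simp]: "degree (laguerre_poly n a) = n"
  by (rule antisym, rule degree_le, simp add: coeff_laguerre_poly,
      rule le_degree, simp add: coeff_laguerre_poly)

lemma laguerre_poly_nonzero [simp]: "laguerre_poly n a \<noteq> 0"
proof -
  have "coeff (laguerre_poly n a) n \<noteq> 0" by (simp add: coeff_laguerre_poly)
  then show ?thesis by auto
qed

lemma gchoose_Suc_right: "of_nat (Suc r) * ((N::real) gchoose Suc r) = (N - of_nat r) * (N gchoose r)"
  using gbinomial_mult_1[of N r] by (simp add: algebra_simps)

text \<open>Coefficientwise this is Pascal's rule. It gives (e^x L_n^a(-x))' = e^x L_n^(a+1)(-x),
  which is why the rows of \<open>Omega\<close> for \<open>F2\<close> raise the parameter instead of
  differentiating.\<close>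

lemma laguerre_poly_Suc_param:
  "laguerre_poly n (a + 1) = laguerre_poly n a - pderiv (laguerre_poly n a)"
proof (rule poly_eqI)
  fix j
  show "coeff (laguerre_poly n (a + 1)) j = coeff (laguerre_poly n a - pderiv (laguerre_poly n a)) j"
  proof (cases "j < n")
    case True
    then obtain r where r: "n - j = Suc r" "n - Suc j = r" by (metis Suc_diff_Suc)
    have p: "((real n + (a + 1)) gchoose Suc r) = ((real n + a) gchoose Suc r) + ((real n + a) gchoose r)"
      using gbinomial_Suc_Suc[of "real n + a" r] by (simp add: algebra_simps)
    have "real (Suc j) * ((-1) ^ Suc j / fact (Suc j)) = - ((-1) ^ j / fact j :: real)"
      by (simp add: field_simps del: of_nat_Suc)
    then have q: "real (Suc j) * ((-1) ^ Suc j / fact (Suc j) * X) = - ((-1) ^ j / fact j * X)" for X :: real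
      by (metis mult.assoc mult_minus_left)
    show ?thesis using True r
      by (simp only: coeff_diff coeff_pderiv coeff_laguerre_poly p if_True less_imp_le Suc_leI q)
         (simp add: algebra_simps)
  next
    case False
    then show ?thesis by (auto simp: coeff_pderiv coeff_laguerre_poly)
  qed
qed

text \<open>Comparing coefficients reduces the equation to the two-term recurrence
  \<open>key\<close>, which for \<open>j < n\<close> is the absorption identity for generalized
  binomials; it holds for every real parameter, negative integers included.\<close>

lemma laguerre_poly_ode:
  "[:0, 1:] * pderiv (pderiv (laguerre_poly n a)) + [:a + 1, -1:] * pderiv (laguerre_poly n a)
     + smult (real n) (laguerre_poly n a) = 0"
proof (rule poly_eqI)
  fix j
  let ?c = "coeff (laguerre_poly n a)"
  have key: "real (Suc j) * (real j + a + 1) * ?c (Suc j) = (real j - real n) * ?c j"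
  proof (cases "j < n")
    case True
    then obtain r where r: "n - j = Suc r" "n - Suc j = r" by (metis Suc_diff_Suc)
    have n: "real n = real j + real (Suc r)" using True r by simp
    have e: "real (Suc r) * ((real n + a) gchoose Suc r) = (real j + 1 + a) * ((real n + a) gchoose r)"
      using gchoose_Suc_right[of r "real n + a"] n by simp
    have q: "real (Suc j) * ((-1) ^ Suc j / fact (Suc j)) = - ((-1) ^ j / fact j :: real)"
      by (simp add: field_simps del: of_nat_Suc)
    have c: "?c (Suc j) = (-1) ^ Suc j / fact (Suc j) * ((real n + a) gchoose r)"
      using True r by (simp only: coeff_laguerre_poly Suc_leI if_True)
    have "x * (y + a + 1) * (E * C) = (x * E) * ((y + 1 + a) * C)" for x y E C :: real
      by (simp add: algebra_simps)
    then have "real (Suc j) * (real j + a + 1) * ?c (Suc j) =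
       (real (Suc j) * ((-1) ^ Suc j / fact (Suc j))) * ((real j + 1 + a) * ((real n + a) gchoose r))"
      unfolding c by blast
    also have "\<dots> = - ((-1) ^ j / fact j) * (real (Suc r) * ((real n + a) gchoose Suc r))"
      by (simp only: q e)
    also have "\<dots> = (real j - real n) * ?c j"
      using True r n by (simp add: coeff_laguerre_poly algebra_simps del: of_nat_Suc)
    finally show ?thesis .
  next
    case False
    then show ?thesis by (auto simp: coeff_laguerre_poly)
  qed
  show "coeff ([:0, 1:] * pderiv (pderiv (laguerre_poly n a)) + [:a + 1, -1:] * pderiv (laguerre_poly n a)
     + smult (real n) (laguerre_poly n a)) j = coeff 0 j"
    using key by (cases j) (auto simp: coeff_pderiv coeff_pCons algebra_simps)
qed

text \<open>A smooth function is represented by the sequence of its derivatives; the second conjunct is the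
  $j$-th derivative of $xf''+(1-m-x)f'=-lf$.\<close>

definition eigjet :: "nat \<Rightarrow> real \<Rightarrow> (nat \<Rightarrow> real \<Rightarrow> real) \<Rightarrow> bool" where
  "eigjet m l f \<longleftrightarrow>
     (\<forall>j x. (f j has_real_derivative f (Suc j) x) (at x)) \<and>
     (\<forall>j x. x * f (Suc (Suc j)) x + (real j + 1 - real m - x) * f (Suc j) x - real j * f j x = - l * f j x)"

lemma eigjet_deriv: "eigjet m l f \<Longrightarrow> (f j has_real_derivative f (Suc j) x) (at x)"
  by (simp add: eigjet_def)

lemma eigjet_ode: "eigjet m l f \<Longrightarrow>
    l * f j x = - (x * f (Suc (Suc j)) x + (real j + 1 - real m - x) * f (Suc j) x - real j * f j x)"
  by (simp add: eigjet_def)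

text \<open>Order 0 suffices: differentiating the equation of order j gives the one of order j +
  1.\<close>

lemma eigjetI:
  assumes d: "\<And>j x. (f j has_real_derivative f (Suc j) x) (at x)"
    and e: "\<And>x. x * f 2 x + (1 - real m - x) * f 1 x = - l * f 0 x"
  shows "eigjet m l f"
proof -
  have "\<forall>x. x * f (Suc (Suc j)) x + (real j + 1 - real m - x) * f (Suc j) x - real j * f j x = - l * f j x" for j
  proof (induction j)
    case 0
    then show ?case using e by (simp add: numeral_2_eq_2)
  next
    case (Suc j)
    show ?case
    proof
      fix x
      let ?L = "\<lambda>x. x * f (Suc (Suc j)) x + (real j + 1 - real m - x) * f (Suc j) x - real j * f j x"
      have "(?L has_real_derivative (f (Suc (Suc j)) x + x * f (Suc (Suc (Suc j))) x
           + (- f (Suc j) x + (real j + 1 - real m - x) * f (Suc (Suc j)) x) - real j * f (Suc j) x)) (at x)"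
        by (auto intro!: derivative_eq_intros d)
      moreover have "((\<lambda>x. - l * f j x) has_real_derivative (- l * f (Suc j) x)) (at x)"
        by (auto intro!: derivative_eq_intros d)
      moreover have "?L = (\<lambda>x. - l * f j x)" using Suc by auto
      ultimately have "f (Suc (Suc j)) x + x * f (Suc (Suc (Suc j))) x
           + (- f (Suc j) x + (real j + 1 - real m - x) * f (Suc (Suc j)) x) - real j * f (Suc j) x
           = - l * f (Suc j) x" by (metis DERIV_unique)
      then show "x * f (Suc (Suc (Suc j))) x + (real (Suc j) + 1 - real m - x) * f (Suc (Suc j)) x
          - real (Suc j) * f (Suc j) x = - l * f (Suc j) x"
        by (simp add: algebra_simps)
    qed
  qed
  then show ?thesis using d by (simp add: eigjet_def)
qed

lemma eigjet_lincomb: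
  assumes "eigjet m l f" "eigjet m l g"
  shows "eigjet m l (\<lambda>j x. a * f j x + b * g j x)"
  unfolding eigjet_def
proof (intro conjI allI)
  fix j x
  show "((\<lambda>x. a * f j x + b * g j x) has_real_derivative a * f (Suc j) x + b * g (Suc j) x) (at x)"
    by (intro DERIV_add DERIV_cmult eigjet_deriv[OF assms(1)] eigjet_deriv[OF assms(2)])
  have "x * (a * f (Suc (Suc j)) x + b * g (Suc (Suc j)) x)
      + (real j + 1 - real m - x) * (a * f (Suc j) x + b * g (Suc j) x) - real j * (a * f j x + b * g j x)
     = - a * (l * f j x) - b * (l * g j x)"
    by (simp only: eigjet_ode[OF assms(1)] eigjet_ode[OF assms(2)]) (simp add: algebra_simps)
  then show "x * (a * f (Suc (Suc j)) x + b * g (Suc (Suc j)) x)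
      + (real j + 1 - real m - x) * (a * f (Suc j) x + b * g (Suc j) x) - real j * (a * f j x + b * g j x)
     = - l * (a * f j x + b * g j x)"
    by (simp add: algebra_simps)
qed

lemma eigjet_zero: "eigjet m l (\<lambda>j x. 0)"
  by (simp add: eigjet_def)

lemma eigjet_scale:
  assumes "eigjet m l f"
  shows "eigjet m l (\<lambda>j x. a * f j x)"
  using eigjet_lincomb[OF assms assms, of a 0] by simp

definition polyjet :: "nat \<Rightarrow> nat \<Rightarrow> nat \<Rightarrow> real \<Rightarrow> real" where
  "polyjet m n j x = poly ((pderiv ^^ j) (laguerre_poly n (- real m))) x"

text \<open>The j-th derivative of e^x L_n^(-m)(-x), written in closed form: each derivative raises
  the parameter by one.\<close>

definition expjet :: "nat \<Rightarrow> nat \<Rightarrow> nat \<Rightarrow> real \<Rightarrow> real" where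
  "expjet m n j x = exp x * poly (laguerre_poly n (real j - real m)) (- x)"

lemma eigjet_polyjet: "eigjet m (real n) (polyjet m n)"
proof (rule eigjetI)
  fix j x
  show "(polyjet m n j has_real_derivative polyjet m n (Suc j) x) (at x)"
    unfolding polyjet_def [abs_def] by (simp add: poly_DERIV)
next
  fix x
  have "poly ([:0, 1:] * pderiv (pderiv (laguerre_poly n (- real m))) + [:- real m + 1, -1:] * pderiv (laguerre_poly n (- real m))
     + smult (real n) (laguerre_poly n (- real m))) x = poly 0 x"
    by (simp only: laguerre_poly_ode)
  then show "x * polyjet m n 2 x + (1 - real m - x) * polyjet m n 1 x = - real n * polyjet m n 0 x"
    unfolding polyjet_def by (simp add: numeral_2_eq_2 algebra_simps)
qed

text \<open>The substitution g(x) -> e^x g(-x) maps solutions of the Laguerre equation to solutions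
  and sends the eigenvalue l to m - 1 - l.\<close>

lemma eigjet_expjet: "eigjet m (real m - 1 - real n) (expjet m n)"
proof (rule eigjetI)
  fix j x
  have "laguerre_poly n (real (Suc j) - real m) = laguerre_poly n (real j - real m) - pderiv (laguerre_poly n (real j - real m))"
    using laguerre_poly_Suc_param[of n "real j - real m"] by (simp add: algebra_simps)
  then have e: "expjet m n (Suc j) x = exp x * (poly (laguerre_poly n (real j - real m)) (- x)
     - poly (pderiv (laguerre_poly n (real j - real m))) (- x))"
    unfolding expjet_def by simp
  show "(expjet m n j has_real_derivative expjet m n (Suc j) x) (at x)"
    unfolding e unfolding expjet_def [abs_def]
    by (auto intro!: derivative_eq_intros DERIV_chain2[OF poly_DERIV] simp: algebra_simps)
next
  fix x
  let ?a = "- real m"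
  let ?L = "laguerre_poly n ?a"
  have 1: "laguerre_poly n (1 - real m) = ?L - pderiv ?L"
    using laguerre_poly_Suc_param[of n ?a] by simp
  have 2: "laguerre_poly n (2 - real m) = ?L - pderiv ?L - pderiv (?L - pderiv ?L)"
    using laguerre_poly_Suc_param[of n "1 - real m"] unfolding 1 by simp
  have "poly ([:0, 1:] * pderiv (pderiv ?L) + [:?a + 1, -1:] * pderiv ?L + smult (real n) ?L) (-x) = poly 0 (-x)"
    by (simp only: laguerre_poly_ode)
  then have o: "- x * poly (pderiv (pderiv ?L)) (-x) + (?a + 1 + x) * poly (pderiv ?L) (-x) + real n * poly ?L (-x) = 0"
    by (simp add: algebra_simps)
  have "expjet m n 0 x = exp x * poly ?L (-x)"
    "expjet m n 1 x = exp x * (poly ?L (-x) - poly (pderiv ?L) (-x))"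
    "expjet m n 2 x = exp x * (poly ?L (-x) - 2 * poly (pderiv ?L) (-x) + poly (pderiv (pderiv ?L)) (-x))"
    unfolding expjet_def by (simp_all add: 1 2 algebra_simps pderiv_diff)
  note ex = this
  show "x * expjet m n 2 x + (1 - real m - x) * expjet m n 1 x = - (real m - 1 - real n) * expjet m n 0 x"
    unfolding ex using arg_cong[OF o, of "\<lambda>z. - exp x * z"] by (simp add: algebra_simps)
qed

text \<open>The left side is the j-th derivative of Q(-D)u for u = sum of c_s e_s, since Q(-D)
  multiplies each coefficient by Q(lam_s). As D is of second order with leading coefficient x, this
  involves derivatives of u up to order j + 2d, and only the top one survives when the others
  vanish.\<close>

lemma jets_eigen_poly:
  fixes lam :: "'s \<Rightarrow> real" and e :: "'s \<Rightarrow> nat \<Rightarrow> real \<Rightarrow> real" and c :: "'s \<Rightarrow> real"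
  assumes fin: "finite S" and e: "\<And>s. s \<in> S \<Longrightarrow> eigjet m (lam s) (e s)"
  shows "degree Q \<le> d \<Longrightarrow> (\<And>i. i < j + 2 * d \<Longrightarrow> (\<Sum>s\<in>S. c s * e s i x) = 0) \<Longrightarrow>
    (\<Sum>s\<in>S. c s * poly Q (lam s) * e s j x) = coeff Q d * (- x) ^ d * (\<Sum>s\<in>S. c s * e s (j + 2 * d) x)"
proof (induction d arbitrary: Q j)
  case 0
  then obtain a where "Q = [:a:]" by (metis degree_eq_zeroE le_zero_eq)
  then show ?case by (simp add: sum_distrib_left mult.assoc mult.left_commute)
next
  case (Suc d)
  obtain a Q' where Q: "Q = pCons a Q'" by (cases Q) auto
  have dQ': "degree Q' \<le> d" using Suc.prems(1) Q by (auto simp: degree_pCons_eq_if split: if_splits)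
  have z0: "(\<Sum>s\<in>S. c s * e s j x) = 0" using Suc.prems(2)[of j] by simp
  have i2: "(\<Sum>s\<in>S. c s * poly Q' (lam s) * e s (Suc (Suc j)) x)
      = coeff Q' d * (- x) ^ d * (\<Sum>s\<in>S. c s * e s (Suc (Suc j) + 2 * d) x)"
    by (rule Suc.IH[OF dQ']) (use Suc.prems(2) in auto)
  have i1: "(\<Sum>s\<in>S. c s * poly Q' (lam s) * e s (Suc j) x) = 0"
    by (subst Suc.IH[OF dQ']) (use Suc.prems(2) in auto)
  have i0: "(\<Sum>s\<in>S. c s * poly Q' (lam s) * e s j x) = 0"
    by (subst Suc.IH[OF dQ']) (use Suc.prems(2) in auto)
  have "(\<Sum>s\<in>S. c s * poly Q (lam s) * e s j x) =
     (\<Sum>s\<in>S. a * (c s * e s j x) + c s * poly Q' (lam s) * (lam s * e s j x))"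
    by (rule sum.cong) (auto simp: Q algebra_simps)
  also have "\<dots> = (\<Sum>s\<in>S. a * (c s * e s j x) - x * (c s * poly Q' (lam s) * e s (Suc (Suc j)) x)
      - (real j + 1 - real m - x) * (c s * poly Q' (lam s) * e s (Suc j) x)
      + real j * (c s * poly Q' (lam s) * e s j x))"
    by (rule sum.cong) (auto simp: eigjet_ode[OF e] algebra_simps)
  also have "\<dots> = - x * (\<Sum>s\<in>S. c s * poly Q' (lam s) * e s (Suc (Suc j)) x)"
    using z0 i1 i0
    by (simp add: sum.distrib sum_subtractf sum_distrib_left [symmetric] del: mult_minus_left)
  also have "\<dots> = coeff Q (Suc d) * (- x) ^ (Suc d) * (\<Sum>s\<in>S. c s * e s (j + 2 * Suc d) x)"
    unfolding i2 by (simp add: Q)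
  finally show ?case .
qed

lemma jets_eigen_poly_zero:
  fixes lam :: "'s \<Rightarrow> real" and e :: "'s \<Rightarrow> nat \<Rightarrow> real \<Rightarrow> real" and c :: "'s \<Rightarrow> real"
  assumes "finite S" "\<And>s. s \<in> S \<Longrightarrow> eigjet m (lam s) (e s)" "degree Q \<le> d"
    "\<And>i. i \<le> j + 2 * d \<Longrightarrow> (\<Sum>s\<in>S. c s * e s i x) = 0"
  shows "(\<Sum>s\<in>S. c s * poly Q (lam s) * e s j x) = 0"
  by (subst jets_eigen_poly[OF assms(1,2,3)]) (use assms(4) in auto)

text \<open>At the origin the second-order term of D drops out, so each factor of Q(-D) costs one
  derivative instead of two.\<close>

lemma jets_eigen_poly_at_0:
  fixes lam :: "'s \<Rightarrow> real" and e :: "'s \<Rightarrow> nat \<Rightarrow> real \<Rightarrow> real" and c :: "'s \<Rightarrow> real"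
  assumes fin: "finite S" and e: "\<And>s. s \<in> S \<Longrightarrow> eigjet m (lam s) (e s)"
  shows "degree Q \<le> d \<Longrightarrow> (\<And>i. i \<le> j + d \<Longrightarrow> (\<Sum>s\<in>S. c s * e s i 0) = 0) \<Longrightarrow>
    (\<Sum>s\<in>S. c s * poly Q (lam s) * e s j 0) = 0"
proof (induction d arbitrary: Q j)
  case 0
  then obtain a where "Q = [:a:]" by (metis degree_eq_zeroE le_zero_eq)
  then have "(\<Sum>s\<in>S. c s * poly Q (lam s) * e s j 0) = a * (\<Sum>s\<in>S. c s * e s j 0)"
    by (simp add: sum_distrib_left mult.assoc mult.left_commute)
  then show ?case using 0(2)[of j] by simp
next
  case (Suc d)
  obtain a Q' where Q: "Q = pCons a Q'" by (cases Q) auto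
  have dQ': "degree Q' \<le> d" using Suc.prems(1) Q by (auto simp: degree_pCons_eq_if split: if_splits)
  have z0: "(\<Sum>s\<in>S. c s * e s j 0) = 0" using Suc.prems(2)[of j] by simp
  have i1: "(\<Sum>s\<in>S. c s * poly Q' (lam s) * e s (Suc j) 0) = 0"
    by (rule Suc.IH[OF dQ']) (use Suc.prems(2) in auto)
  have i0: "(\<Sum>s\<in>S. c s * poly Q' (lam s) * e s j 0) = 0"
    by (rule Suc.IH[OF dQ']) (use Suc.prems(2) in auto)
  have "(\<Sum>s\<in>S. c s * poly Q (lam s) * e s j 0) =
     (\<Sum>s\<in>S. a * (c s * e s j 0) + c s * poly Q' (lam s) * (lam s * e s j 0))"
    by (rule sum.cong) (auto simp: Q algebra_simps)
  also have "\<dots> = (\<Sum>s\<in>S. a * (c s * e s j 0)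
      - (real j + 1 - real m) * (c s * poly Q' (lam s) * e s (Suc j) 0)
      + real j * (c s * poly Q' (lam s) * e s j 0))"
    by (rule sum.cong) (auto simp: eigjet_ode[OF e] algebra_simps)
  also have "\<dots> = 0"
    using z0 i1 i0 by (simp add: sum.distrib sum_subtractf sum_distrib_left [symmetric])
  finally show ?case .
qed

text \<open>Synthetic division defines (P(a) - P(b)) / (a - b) on the diagonal as well, where it is
  P'(a). For fixed b it is a polynomial in a, so \<open>jets_eigen_poly\<close> applies to
  it.\<close>

definition divdiff :: "real poly \<Rightarrow> real \<Rightarrow> real \<Rightarrow> real" where
  "divdiff P a b = poly (synthetic_div P b) a"

lemma divdiff: "(a - b) * divdiff P a b = poly P a - poly P b"
proof -
  have "poly ([:- b, 1:] * synthetic_div P b + [:poly P b:]) a = poly P a"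
    by (simp only: synthetic_div_correct')
  then show ?thesis by (simp add: divdiff_def algebra_simps)
qed

lemma divdiff_commute: "divdiff P a b = divdiff P b a"
proof (cases "a = b")
  case False
  have "(a - b) * divdiff P a b = (a - b) * divdiff P b a"
    using divdiff[of a b P] divdiff[of b a P] by (simp add: algebra_simps)
  then show ?thesis using False by simp
qed simp

text \<open>The Leibniz rule for divided differences, verified after multiplication by X -
  b.\<close>

lemma synthetic_div_mult:
  fixes P1 P2 :: "real poly"
  shows "synthetic_div (P1 * P2) b = P1 * synthetic_div P2 b + smult (poly P2 b) (synthetic_div P1 b)"
proof -
  let ?s = "[:- b, 1:]"
  have a1: "P1 = ?s * synthetic_div P1 b + [:poly P1 b:]" by (simp only: synthetic_div_correct')
  have a2: "P2 = ?s * synthetic_div P2 b + [:poly P2 b:]" by (simp only: synthetic_div_correct')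
  have "?s * (P1 * synthetic_div P2 b + smult (poly P2 b) (synthetic_div P1 b)) =
     P1 * (?s * synthetic_div P2 b) + smult (poly P2 b) (?s * synthetic_div P1 b)"
    by (simp only: distrib_left mult_smult_right mult.left_commute)
  also have "\<dots> = P1 * (P2 - [:poly P2 b:]) + smult (poly P2 b) (P1 - [:poly P1 b:])"
    using a1 a2 by (metis add_diff_cancel_right')
  also have "\<dots> = P1 * P2 - [:poly (P1 * P2) b:]"
    by (simp add: algebra_simps smult_diff_right)
  also have "\<dots> = ?s * synthetic_div (P1 * P2) b"
    using synthetic_div_correct'[of b "P1 * P2"] by (metis add_diff_cancel_right')
  finally have "?s * (P1 * synthetic_div P2 b + smult (poly P2 b) (synthetic_div P1 b)) = ?s * synthetic_div (P1 * P2) b" .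
  then show ?thesis by (metis mult_left_cancel pCons_eq_0_iff zero_neq_one)
qed

lemma divdiff_mult: "divdiff (P1 * P2) a b = poly P1 a * divdiff P2 a b + divdiff P1 a b * poly P2 b"
  by (simp add: divdiff_def synthetic_div_mult)

lemma coeff_synthetic_div_top:
  fixes P :: "real poly"
  assumes "0 < degree P"
  shows "coeff (synthetic_div P b) (degree P - 1) = lead_coeff P"
proof -
  obtain d where d: "degree P = Suc d" using assms by (cases "degree P") auto
  have "coeff P (Suc d) = coeff ([:- b, 1:] * synthetic_div P b + [:poly P b:]) (Suc d)"
    by (simp only: synthetic_div_correct')
  also have "\<dots> = coeff (synthetic_div P b) d"
    using d by (simp add: coeff_eq_0 degree_synthetic_div)
  finally show ?thesis using d by simp
qed

text \<open>The product runs over indices, not over values, so an eigenvalue shared by two seeds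
  becomes a double root.\<close>

definition rootpoly :: "('s \<Rightarrow> real) \<Rightarrow> 's set \<Rightarrow> real poly" where
  "rootpoly lam S = (\<Prod>s\<in>S. [:- lam s, 1:])"

lemma poly_rootpoly: "poly (rootpoly lam S) x = (\<Prod>s\<in>S. x - lam s)"
  unfolding rootpoly_def by (simp add: poly_prod)

lemma degree_rootpoly: "finite S \<Longrightarrow> degree (rootpoly lam S) = card S"
  unfolding rootpoly_def by (subst degree_prod_eq_sum_degree) auto

lemma lead_coeff_rootpoly: "lead_coeff (rootpoly lam S) = 1"
  unfolding rootpoly_def by (induction S rule: infinite_finite_induct) (auto simp: lead_coeff_mult simp del: mult_pCons_left)

lemma rootpoly_union: "finite A \<Longrightarrow> finite B \<Longrightarrow> A \<inter> B = {} \<Longrightarrow> rootpoly lam (A \<union> B) = rootpoly lam A * rootpoly lam B"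
  unfolding rootpoly_def by (rule prod.union_disjoint)

lemma rootpoly_root: "finite S \<Longrightarrow> s \<in> S \<Longrightarrow> poly (rootpoly lam S) (lam s) = 0"
  by (auto simp: poly_rootpoly)

text \<open>On the diagonal the divided difference is the derivative, and two distinct indices with
  the same value make a double root.\<close>

lemma divdiff_rootpoly_double:
  assumes "finite S" "s \<in> S" "t \<in> S" "s \<noteq> t" "lam s = lam t"
  shows "divdiff (rootpoly lam S) (lam s) (lam t) = 0"
proof -
  have S: "S = {s, t} \<union> (S - {s, t})" using assms by auto
  have "rootpoly lam S = rootpoly lam {s, t} * rootpoly lam (S - {s, t})"
    by (subst S, rule rootpoly_union) (use assms in auto)
  also have "rootpoly lam {s, t} = rootpoly lam {s} * rootpoly lam {t}"
    using assms(4) by (simp add: rootpoly_def)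
  finally have "rootpoly lam S = rootpoly lam {s} * rootpoly lam {t} * rootpoly lam (S - {s, t})" .
  moreover have "poly (rootpoly lam {s}) (lam s) = 0" "poly (rootpoly lam {t}) (lam s) = 0"
    "poly (rootpoly lam {t}) (lam t) = 0"
    by (simp_all add: poly_rootpoly assms(5))
  ultimately show ?thesis by (simp add: divdiff_mult assms(5))
qed

lemma divdiff_rootpoly_distinct:
  assumes "finite S" "s \<in> S" "t \<in> S" "lam s \<noteq> lam t"
  shows "divdiff (rootpoly lam S) (lam s) (lam t) = 0"
  using divdiff[of "lam s" "lam t" "rootpoly lam S"] assms rootpoly_root[OF assms(1), of _ lam] by auto

text \<open>The factor x^(1-m) e^(-x) is the Sturm-Liouville coefficient p for which D f = (p f')' /
  w with w = x^(-m) e^(-x).\<close>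

definition wr :: "nat \<Rightarrow> (nat \<Rightarrow> real \<Rightarrow> real) \<Rightarrow> (nat \<Rightarrow> real \<Rightarrow> real) \<Rightarrow> real \<Rightarrow> real" where
  "wr m f g x = x powr (1 - real m) * exp (- x) * (f 0 x * g 1 x - f 1 x * g 0 x)"

lemma wr_refl [simp]: "wr m f f x = 0" by (simp add: wr_def)

text \<open>Lagrange's identity for the self-adjoint form of D. In particular two eigenfunctions
  with the same eigenvalue have constant weighted Wronskian.\<close>

lemma wr_deriv:
  assumes "eigjet m l f" "eigjet m k g" "x > 0"
  shows "(wr m f g has_real_derivative (l - k) * (x powr (- real m) * exp (- x)) * f 0 x * g 0 x) (at x)"
proof -
  have o1: "l * f 0 x = - (x * f 2 x + (1 - real m - x) * f 1 x)"
    using eigjet_ode[OF assms(1), of 0 x] by (simp add: numeral_2_eq_2)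
  have o2: "k * g 0 x = - (x * g 2 x + (1 - real m - x) * g 1 x)"
    using eigjet_ode[OF assms(2), of 0 x] by (simp add: numeral_2_eq_2)
  have d: "(f 0 has_real_derivative f 1 x) (at x)" "(f 1 has_real_derivative f 2 x) (at x)"
    "(g 0 has_real_derivative g 1 x) (at x)" "(g 1 has_real_derivative g 2 x) (at x)"
    using eigjet_deriv[OF assms(1)] eigjet_deriv[OF assms(2)] by (metis One_nat_def Suc_1)+
  have p: "x powr (1 - real m) = x * x powr (- real m)"
    using assms(3) by (simp add: powr_diff powr_minus field_simps)
  have p2: "x powr (1 - real m - 1) = x powr (- real m)" by simp
  have "(wr m f g has_real_derivative
      ((1 - real m) * x powr (1 - real m - 1) * exp (- x) - x powr (1 - real m) * exp (- x)) * (f 0 x * g 1 x - f 1 x * g 0 x)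
     + x powr (1 - real m) * exp (- x) * (f 0 x * g 2 x - f 2 x * g 0 x)) (at x)"
    unfolding wr_def [abs_def]
    by (rule derivative_eq_intros refl d | use assms(3) in \<open>simp add: algebra_simps\<close>)+
  also have "((1 - real m) * x powr (1 - real m - 1) * exp (- x) - x powr (1 - real m) * exp (- x)) * (f 0 x * g 1 x - f 1 x * g 0 x)
     + x powr (1 - real m) * exp (- x) * (f 0 x * g 2 x - f 2 x * g 0 x)
    = (x powr (- real m) * exp (- x)) * (f 0 x * (x * g 2 x + (1 - real m - x) * g 1 x) - g 0 x * (x * f 2 x + (1 - real m - x) * f 1 x))"
    unfolding p2 p by (simp add: algebra_simps)
  also have "\<dots> = (x powr (- real m) * exp (- x)) * (g 0 x * (l * f 0 x) - f 0 x * (k * g 0 x))"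
    unfolding o1 o2 by (simp add: algebra_simps)
  also have "\<dots> = (l - k) * (x powr (- real m) * exp (- x)) * f 0 x * g 0 x"
    by (simp add: algebra_simps)
  finally show ?thesis .
qed

section \<open>Seed functions and the determinant\<close>

lemma poly_eq_on_infinite:
  fixes p q :: "real poly"
  assumes "infinite A" "\<And>x. x \<in> A \<Longrightarrow> poly p x = poly q x"
  shows "p = q"
proof (rule ccontr)
  assume "p \<noteq> q"
  then have "finite {x. poly (p - q) x = 0}" by (intro poly_roots_finite) simp
  moreover have "A \<subseteq> {x. poly (p - q) x = 0}" using assms(2) by auto
  ultimately show False using assms(1) finite_subset by blast
qed

definition ev :: "nat \<Rightarrow> nat + nat \<Rightarrow> real" where
  "ev m s = (case s of Inl f \<Rightarrow> real f | Inr f \<Rightarrow> real m - 1 - real f)"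

definition seed :: "nat \<Rightarrow> nat + nat \<Rightarrow> nat \<Rightarrow> real \<Rightarrow> real" where
  "seed m s = (case s of Inl f \<Rightarrow> polyjet m f | Inr f \<Rightarrow> expjet m f)"

definition expf :: "nat + nat \<Rightarrow> real \<Rightarrow> real" where
  "expf s x = (case s of Inl f \<Rightarrow> 1 | Inr f \<Rightarrow> exp x)"

text \<open>The polynomial left after removing the exponential factor of a seed. These are the
  entries of the matrix in \<open>Omega\<close>; keeping them as polynomials in x makes the
  determinant and the adjugate polynomial too.\<close>

definition core :: "nat \<Rightarrow> nat + nat \<Rightarrow> nat \<Rightarrow> real poly" where
  "core m s j = (case s of Inl f \<Rightarrow> (pderiv ^^ j) (laguerre_poly f (- real m))
     | Inr f \<Rightarrow> pcompose (laguerre_poly f (real j - real m)) [:0, -1:])"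

lemma ev_simps [simp]: "ev m (Inl f) = real f" "ev m (Inr f) = real m - 1 - real f"
  by (simp_all add: ev_def)

lemma seed_simps [simp]: "seed m (Inl f) = polyjet m f" "seed m (Inr f) = expjet m f"
  by (simp_all add: seed_def)

lemma expf_nz [simp]: "expf s x \<noteq> 0"
  by (cases s) (auto simp: expf_def)

lemma seed_core: "seed m s j x = expf s x * poly (core m s j) x"
  by (cases s) (auto simp: expf_def core_def polyjet_def expjet_def poly_pcompose)

lemma eigjet_seed: "eigjet m (ev m s) (seed m s)"
  by (cases s) (auto simp: eigjet_polyjet eigjet_expjet)

definition seedlist :: "nat set \<Rightarrow> nat set \<Rightarrow> (nat + nat) list" where
  "seedlist F1 F2 = map Inl (sorted_list_of_set F1) @ map Inr (sorted_list_of_set F2)"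

definition coremat :: "nat \<Rightarrow> nat set \<Rightarrow> nat set \<Rightarrow> real poly mat" where
  "coremat m F1 F2 = Matrix.mat (card F1 + card F2) (card F1 + card F2) (\<lambda>(i, j). core m (seedlist F1 F2 ! i) j)"

lemma bij_seedlist:
  assumes "finite F1" "finite F2"
  shows "bij_betw (nth (seedlist F1 F2)) {..<card F1 + card F2} (F1 <+> F2)"
proof (rule bij_betw_nth)
  show "distinct (seedlist F1 F2)"
    by (auto simp: seedlist_def distinct_map)
  show "{..<card F1 + card F2} = {..<length (seedlist F1 F2)}" using assms by (simp add: seedlist_def)
  show "F1 <+> F2 = set (seedlist F1 F2)" using assms by (auto simp: seedlist_def)
qed

lemma poly_comm_ring_hom: "comm_ring_hom (\<lambda>p :: real poly. poly p x)"
  by unfold_locales auto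

lemma Omega_det:
  assumes "finite F1" "finite F2"
  shows "Omega (- real m) F1 F2 x = poly (Determinant.det (coremat m F1 F2)) x"
proof -
  interpret h: comm_ring_hom "\<lambda>p :: real poly. poly p x" by (rule poly_comm_ring_hom)
  show ?thesis
    unfolding Omega_def Let_def h.hom_det [symmetric]
    by (rule arg_cong[of _ _ Determinant.det], rule eq_matI)
       (use assms in \<open>auto simp: coremat_def core_def seedlist_def nth_append laguerre_def poly_pcompose\<close>)
qed

text \<open>A singular matrix has dependent rows, and dividing the coefficients by the nonzero
  exponentials turns its rows into jets of seeds. So \<open>Omega\<close> vanishes at x exactly when
  a nontrivial combination of seeds has a zero of order k there.\<close>

lemma Omega_eq_0_iff:
  assumes fin: "finite F1" "finite F2"
  shows "Omega (- real m) F1 F2 x = 0 \<longleftrightarrow>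
    (\<exists>c. (\<exists>s\<in>F1 <+> F2. c s \<noteq> 0) \<and> (\<forall>j<card F1 + card F2. (\<Sum>s\<in>F1 <+> F2. c s * seed m s j x) = 0))"
proof -
  interpret h: comm_ring_hom "\<lambda>p :: real poly. poly p x" by (rule poly_comm_ring_hom)
  let ?k = "card F1 + card F2" and ?S = "F1 <+> F2"
  let ?N = "map_mat (\<lambda>p. poly p x) (coremat m F1 F2)"
  let ?T = "transpose_mat ?N"
  let ?sl = "nth (seedlist F1 F2)"
  have bij: "bij_betw ?sl {..<?k} ?S" by (rule bij_seedlist[OF fin])
  have N: "?N \<in> carrier_mat ?k ?k" by (simp add: coremat_def)
  have T: "?T \<in> carrier_mat ?k ?k" using N by simp
  have "Omega (- real m) F1 F2 x = Determinant.det ?T"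
    unfolding Omega_det[OF fin] h.hom_det [symmetric] by (rule Determinant.det_transpose[OF N, symmetric])
  then have eq: "Omega (- real m) F1 F2 x = 0 \<longleftrightarrow> (\<exists>v. v \<in> carrier_vec ?k \<and> v \<noteq> 0\<^sub>v ?k \<and> ?T *\<^sub>v v = 0\<^sub>v ?k)"
    using det_0_iff_vec_prod_zero[OF T] by simp
  have mv: "(?T *\<^sub>v v) $ j = (\<Sum>s\<in>?S. c s * seed m s j x)"
    if v: "v \<in> carrier_vec ?k" "\<And>i. i < ?k \<Longrightarrow> v $ i = c (?sl i) * expf (?sl i) x" and j: "j < ?k" for v c j
  proof -
    have "(?T *\<^sub>v v) $ j = (\<Sum>i<?k. poly (core m (?sl i) j) x * v $ i)"
      using v j by (simp add: scalar_prod_def coremat_def lessThan_atLeast0)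
    also have "\<dots> = (\<Sum>i<?k. c (?sl i) * seed m (?sl i) j x)"
      by (rule sum.cong) (auto simp: v(2) seed_core)
    also have "\<dots> = (\<Sum>s\<in>?S. c s * seed m s j x)"
      by (rule sum.reindex_bij_betw[OF bij])
    finally show ?thesis .
  qed
  show ?thesis
  proof
    assume "Omega (- real m) F1 F2 x = 0"
    then obtain v where v: "v \<in> carrier_vec ?k" "v \<noteq> 0\<^sub>v ?k" "?T *\<^sub>v v = 0\<^sub>v ?k" using eq by blast
    define c where "c s = v $ (the_inv_into {..<?k} ?sl s) / expf s x" for s
    have inj: "inj_on ?sl {..<?k}" using bij by (simp add: bij_betw_def)
    have c: "v $ i = c (?sl i) * expf (?sl i) x" if "i < ?k" for i
      using that by (simp add: c_def the_inv_into_f_f[OF inj])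
    obtain i where i: "i < ?k" "v $ i \<noteq> 0" using v(1,2) by (metis carrier_vecD dim_vec eq_vecI index_zero_vec(1) index_zero_vec(2))
    have "?sl i \<in> ?S" using bij i(1) by (auto simp: bij_betw_def)
    moreover have "c (?sl i) \<noteq> 0" using c[OF i(1)] i(2) by auto
    ultimately have "\<exists>s\<in>?S. c s \<noteq> 0" by (rule bexI[rotated])
    moreover have "\<forall>j<?k. (\<Sum>s\<in>?S. c s * seed m s j x) = 0"
      using mv[OF v(1) c] v(3) by simp
    ultimately show "\<exists>c. (\<exists>s\<in>?S. c s \<noteq> 0) \<and> (\<forall>j<?k. (\<Sum>s\<in>?S. c s * seed m s j x) = 0)"
      by (intro exI[of _ c] conjI)
  next
    assume "\<exists>c. (\<exists>s\<in>?S. c s \<noteq> 0) \<and> (\<forall>j<?k. (\<Sum>s\<in>?S. c s * seed m s j x) = 0)"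
    then obtain c s where s: "s \<in> ?S" "c s \<noteq> 0" and z: "\<And>j. j < ?k \<Longrightarrow> (\<Sum>s\<in>?S. c s * seed m s j x) = 0"
      by blast
    define v where "v = Matrix.vec ?k (\<lambda>i. c (?sl i) * expf (?sl i) x)"
    have v: "v \<in> carrier_vec ?k" "\<And>i. i < ?k \<Longrightarrow> v $ i = c (?sl i) * expf (?sl i) x" by (auto simp: v_def)
    have "s \<in> ?sl ` {..<?k}" using bij s(1) by (simp add: bij_betw_def)
    then obtain i where i: "i < ?k" "?sl i = s" by auto
    have "v \<noteq> 0\<^sub>v ?k" using v(2)[OF i(1)] i s(2) by auto
    moreover have "?T *\<^sub>v v = 0\<^sub>v ?k"
      by (rule eq_vecI) (use mv[OF v] z in \<open>auto simp: coremat_def\<close>)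
    ultimately show "Omega (- real m) F1 F2 x = 0" using eq v(1) by blast
  qed
qed

text \<open>Cramer's rule with the denominator cleared: the adjugate yields interpolation
  coefficients that are polynomials in x, so their smoothness and growth are visible after dividing
  by the determinant.\<close>

lemma core_interpolation:
  fixes Y :: "nat \<Rightarrow> real poly"
  assumes fin: "finite F1" "finite F2"
  obtains C where "\<And>j. j < card F1 + card F2 \<Longrightarrow>
    (\<Sum>s\<in>F1 <+> F2. C s * core m s j) = Determinant.det (coremat m F1 F2) * Y j"
proof -
  let ?k = "card F1 + card F2" and ?S = "F1 <+> F2"
  let ?M = "coremat m F1 F2" and ?A = "adj_mat (coremat m F1 F2)"
  let ?sl = "nth (seedlist F1 F2)"
  have bij: "bij_betw ?sl {..<?k} ?S" by (rule bij_seedlist[OF fin])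
  have inj: "inj_on ?sl {..<?k}" using bij by (simp add: bij_betw_def)
  have M: "?M \<in> carrier_mat ?k ?k" by (simp add: coremat_def)
  note adj = adj_mat[OF M]
  define C where "C s = (\<Sum>l<?k. Y l * ?A $$ (l, the_inv_into {..<?k} ?sl s))" for s
  have "(\<Sum>s\<in>?S. C s * core m s j) = Determinant.det ?M * Y j" if j: "j < ?k" for j
  proof -
    have "(\<Sum>s\<in>?S. C s * core m s j) = (\<Sum>i<?k. C (?sl i) * core m (?sl i) j)"
      by (rule sum.reindex_bij_betw[OF bij, symmetric])
    also have "\<dots> = (\<Sum>i<?k. \<Sum>l<?k. Y l * (?A $$ (l, i) * ?M $$ (i, j)))"
      by (rule sum.cong) (use j in \<open>auto simp: C_def the_inv_into_f_f[OF inj] sum_distrib_right mult.assoc coremat_def\<close>)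
    also have "\<dots> = (\<Sum>l<?k. Y l * (\<Sum>i<?k. ?A $$ (l, i) * ?M $$ (i, j)))"
      by (subst sum.swap) (simp add: sum_distrib_left)
    also have "\<dots> = (\<Sum>l<?k. Y l * (?A * ?M) $$ (l, j))"
      by (rule sum.cong) (use j M adj(1) in \<open>auto simp: scalar_prod_def lessThan_atLeast0\<close>)
    also have "\<dots> = (\<Sum>l<?k. if l = j then Y l * Determinant.det ?M else 0)"
      by (rule sum.cong) (use j in \<open>auto simp: adj(3)\<close>)
    also have "\<dots> = Determinant.det ?M * Y j" using j by simp
    finally show ?thesis .
  qed
  then show ?thesis by (rule that)
qed

section \<open>Behaviour of the seeds at the origin\<close>

lemma gchoose_neg_nat:
  assumes "f < m"
  shows "(real f - real m) gchoose i = (-1) ^ i * real ((m - f - 1 + i) choose i)"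
proof -
  have "(- (real (m - f))) gchoose i = (-1) ^ i * ((real (m - f) + real i - 1) gchoose i)"
    by (rule gbinomial_minus)
  moreover have e1: "real (m - f) + real i - 1 = real (m - f - 1 + i)" using assms by (simp add: of_nat_diff)
  moreover have e2: "- real (m - f) = real f - real m" using assms by (simp add: of_nat_diff)
  ultimately show ?thesis unfolding e1 e2 by (simp only: binomial_gbinomial)
qed

lemma laguerre_poly_at_0: "poly (laguerre_poly f a) 0 = (real f + a) gchoose f"
  by (simp add: poly_0_coeff_0 coeff_laguerre_poly)

lemma laguerre_poly_at_0_sign:
  assumes "f < m" shows "poly (laguerre_poly f (- real m)) 0 * (-1) ^ f > 0"
proof -
  have "poly (laguerre_poly f (- real m)) 0 = (-1) ^ f * real ((m - f - 1 + f) choose f)"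
    unfolding laguerre_poly_at_0 using gchoose_neg_nat[OF assms, of f] by simp
  moreover have "(m - f - 1 + f) choose f > 0" using assms by simp
  ultimately show ?thesis by (cases "even f") auto
qed

lemma polyjet_at_0: "polyjet m f j 0 = fact j * coeff (laguerre_poly f (- real m)) j"
  unfolding polyjet_def by (simp add: poly_0_coeff_0 coeff_higher_pderiv pochhammer_fact)

text \<open>For \<open>m \<le> f\<close> the upper index of the binomial is the natural number
  \<open>f - m\<close>, which is below \<open>f - j\<close>. Hence these eigenfunctions are
  divisible by x^m, which makes them square integrable for x^(-m) e^(-x).\<close>

lemma coeff_laguerre_neg:
  assumes "m \<le> f" "j < m" shows "coeff (laguerre_poly f (- real m)) j = 0"
proof -
  have "(real f + - real m) = real (f - m)" using assms by simp
  then have "((real f + - real m) gchoose (f - j)) = real ((f - m) choose (f - j))" by (simp only: binomial_gbinomial)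
  also have "\<dots> = 0" using assms by (simp add: binomial_eq_0)
  finally show ?thesis using assms by (simp add: coeff_laguerre_poly)
qed

lemma coeff_laguerre_neg_m:
  assumes "m \<le> f" shows "coeff (laguerre_poly f (- real m)) m \<noteq> 0"
proof -
  have "(real f + - real m) = real (f - m)" using assms by simp
  then have "((real f + - real m) gchoose (f - m)) = real ((f - m) choose (f - m))" by (simp only: binomial_gbinomial)
  then show ?thesis using assms by (simp add: coeff_laguerre_poly)
qed

lemma laguerre_neg_factor:
  assumes "m \<le> f"
  obtains q where "laguerre_poly f (- real m) = monom 1 m * q" "degree q = f - m" "poly q 0 \<noteq> 0"
proof -
  let ?p = "laguerre_poly f (- real m)"
  have "monom 1 m dvd ?p" unfolding monom_1_dvd_iff' using coeff_laguerre_neg[OF assms] by simp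
  then obtain q where q: "?p = monom 1 m * q" by (rule dvdE)
  have "degree ?p = m + degree q"
    unfolding q by (subst degree_mult_eq) (use q in \<open>auto simp: degree_monom_eq\<close>)
  then have "degree q = f - m" by simp
  moreover have "poly q 0 \<noteq> 0"
    using coeff_laguerre_neg_m[OF assms] unfolding q by (simp add: coeff_monom_mult poly_0_coeff_0)
  ultimately show ?thesis using q that by blast
qed

lemma polyjet_vanish: "m \<le> f \<Longrightarrow> j < m \<Longrightarrow> polyjet m f j 0 = 0"
  by (simp add: polyjet_at_0 coeff_laguerre_neg)

lemma expjet_at_0: "expjet m f j 0 = (real f + real j - real m) gchoose f"
  by (simp add: expjet_def laguerre_poly_at_0 algebra_simps)

lemma expjet_vanish: "m \<le> f \<Longrightarrow> j < m \<Longrightarrow> expjet m f j 0 = 0"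
proof -
  assume a: "m \<le> f" "j < m"
  then have "real f + real j - real m = real (f + j - m)" by simp
  then have "expjet m f j 0 = real ((f + j - m) choose f)" by (simp only: expjet_at_0 binomial_gbinomial)
  then show ?thesis using a by (simp add: binomial_eq_0)
qed

lemma expjet_at_0_m: "expjet m f m 0 \<noteq> 0"
  by (simp add: expjet_at_0 flip: binomial_gbinomial)

text \<open>The sign of the constant is read off from the leading coefficients of the two polynomials.\<close>

lemma wr_expjet_polyjet:
  assumes "n < m"
  obtains kap where "kap * (-1) ^ n < 0"
    "\<And>x. x > 0 \<Longrightarrow> wr m (expjet m (m - 1 - n)) (polyjet m n) x = kap"
proof -
  let ?f = "m - 1 - n"
  let ?E = "expjet m ?f" and ?p = "polyjet m n"
  have evE: "real m - 1 - real ?f = real n" using assms by (simp add: of_nat_diff)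
  have E: "eigjet m (real n) ?E" using eigjet_expjet[of m ?f] by (simp only: evE)
  have p: "eigjet m (real n) ?p" by (rule eigjet_polyjet)
  define kap where "kap = wr m ?E ?p 1"
  have k: "wr m ?E ?p x = kap" if "x > 0" for x
  proof -
    have d: "(wr m ?E ?p has_real_derivative 0) (at x within {0<..})" if "x \<in> {0<..}" for x
      using has_field_derivative_at_within[OF wr_deriv[OF E p, of x]] that by simp
    have "\<exists>c. \<forall>x\<in>{0<..}. wr m ?E ?p x = c"
      by (rule has_field_derivative_zero_constant[OF _ d]) auto
    then obtain c where c: "\<And>x. x > 0 \<Longrightarrow> wr m ?E ?p x = c" by auto
    show ?thesis unfolding kap_def using c[OF that] c[of 1] by simp
  qed
  define B where "B = pcompose (laguerre_poly ?f (- real m)) [:0, -1:]"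
  define B1 where "B1 = pcompose (pderiv (laguerre_poly ?f (- real m))) [:0, -1:]"
  define L where "L = laguerre_poly n (- real m)"
  have E0: "?E 0 x = exp x * poly B x" for x by (simp add: expjet_def B_def poly_pcompose)
  have E1: "?E 1 x = exp x * (poly B x - poly B1 x)" for x
    using laguerre_poly_Suc_param[of ?f "- real m"] by (simp add: expjet_def B_def B1_def poly_pcompose)
  have pw: "x powr (1 - real m) * x ^ (m - 1) = 1" if "x > 0" for x :: real
  proof -
    have "x powr (1 - real m) * x ^ (m - 1) = x powr (1 - real m) * x powr real (m - 1)"
      using that by (simp add: powr_realpow)
    also have "\<dots> = x powr ((1 - real m) + real (m - 1))" by (rule powr_add[symmetric])
    also have "(1 - real m) + real (m - 1) = 0" using assms by simp
    finally show ?thesis using that by simp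
  qed
  \<comment> \<open>Multiplying the constant Wronskian by x^(m-1) cancels the power and the
    exponentials and leaves polynomials. Among the products only \<open>B * L\<close> reaches degree
    m - 1, so its leading coefficient determines \<open>kap\<close>.\<close>
  have "poly (monom kap (m - 1)) x = poly (B * pderiv L - (B - B1) * L) x" if x: "x > 0" for x
  proof -
    have "poly (monom kap (m - 1)) x = wr m ?E ?p x * x ^ (m - 1)" by (simp only: poly_monom k[OF x])
    also have "\<dots> = (x powr (1 - real m) * x ^ (m - 1)) * (exp (- x) * exp x) *
        (poly B x * poly (pderiv L) x - (poly B x - poly B1 x) * poly L x)"
      unfolding wr_def E0 E1 by (simp add: polyjet_def L_def algebra_simps)
    also have "\<dots> = poly (B * pderiv L - (B - B1) * L) x"
      unfolding pw[OF x] by (simp add: exp_minus)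
    finally show ?thesis .
  qed
  then have eq: "monom kap (m - 1) = B * pderiv L - (B - B1) * L"
    by (intro poly_eq_on_infinite[of "{0<..}"]) (auto simp: infinite_Ioi)
  have dB: "degree B = ?f" by (simp add: B_def degree_pcompose)
  have dL: "degree L = n" by (simp add: L_def)
  have fn: "m - 1 = ?f + n" using assms by simp
  have c1: "coeff (B * pderiv L) (m - 1) = 0"
  proof (cases "n = 0")
    case True
    then have "pderiv L = 0" unfolding pderiv_eq_0_iff dL .
    then show ?thesis by simp
  next
    case False
    have "degree (B * pderiv L) \<le> ?f + (n - 1)" using degree_mult_le[of B "pderiv L"] by (simp add: dB dL degree_pderiv)
    also have "\<dots> < m - 1" using False fn by linarith
    finally show ?thesis by (rule coeff_eq_0)
  qed
  have c2: "coeff (B1 * L) (m - 1) = 0"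
  proof (cases "?f = 0")
    case True
    then have "pderiv (laguerre_poly ?f (- real m)) = 0" unfolding pderiv_eq_0_iff degree_laguerre_poly .
    then show ?thesis by (simp add: B1_def)
  next
    case False
    have "degree B1 \<le> ?f - 1" by (simp add: B1_def degree_pcompose degree_pderiv)
    then have "degree (B1 * L) \<le> (?f - 1) + n" using degree_mult_le[of B1 L] dL by linarith
    also have "\<dots> < m - 1" using False fn by linarith
    finally show ?thesis by (rule coeff_eq_0)
  qed
  have "kap = coeff (monom kap (m - 1)) (m - 1)" by simp
  also have "\<dots> = - coeff (B * L) (m - 1)"
    unfolding eq using c1 c2 by (simp add: algebra_simps)
  also have "coeff (B * L) (m - 1) = lead_coeff B * lead_coeff L"
    using coeff_mult_degree_sum[of B L] unfolding dB dL fn [symmetric] .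
  finally have kk: "kap = - (lead_coeff B * lead_coeff L)" .
  have lB: "lead_coeff B = 1 / fact ?f"
  proof -
    have "lead_coeff B = lead_coeff (laguerre_poly ?f (- real m)) * (-1) ^ ?f"
      unfolding B_def by (subst lead_coeff_comp) auto
    then show ?thesis by (cases "even ?f") (simp_all add: coeff_laguerre_poly)
  qed
  have lL: "lead_coeff L = (-1) ^ n / fact n" by (simp add: L_def coeff_laguerre_poly)
  have "(a :: real) > 0 \<Longrightarrow> b > 0 \<Longrightarrow> - (1 / a * ((-1) ^ n / b)) * (-1) ^ n < 0" for a b
    by (cases "even n") auto
  then have "kap * (-1) ^ n < 0" unfolding kk lB lL by simp
  with k show ?thesis using that by blast
qed

section \<open>The concomitant and necessity of admissibility\<close>

lemma wr_sum_left:
  "(\<Sum>i\<in>A. c i * wr m (e i) g x) = x powr (1 - real m) * exp (- x) *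
     ((\<Sum>i\<in>A. c i * e i 0 x) * g 1 x - (\<Sum>i\<in>A. c i * e i 1 x) * g 0 x)"
  unfolding wr_def sum_distrib_left sum_distrib_right sum_subtractf [symmetric]
  by (rule sum.cong) (auto simp: algebra_simps)

lemma wr_sum_right:
  "(\<Sum>i\<in>A. c i * wr m g (e i) x) = x powr (1 - real m) * exp (- x) *
     (g 0 x * (\<Sum>i\<in>A. c i * e i 1 x) - g 1 x * (\<Sum>i\<in>A. c i * e i 0 x))"
  unfolding wr_def sum_distrib_left sum_distrib_right sum_subtractf [symmetric]
  by (rule sum.cong) (auto simp: algebra_simps)

text \<open>The double sums weighted by divided differences are the bilinear concomitant of the
  differential operator $P(-D)$; it has total order $2\deg P-1$, so only one product of jets
  survives when the lower ones vanish.\<close>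

lemma concomitant_leading:
  fixes lam :: "'a \<Rightarrow> real" and mu :: "'b \<Rightarrow> real"
  assumes A: "finite A" "\<And>i. i \<in> A \<Longrightarrow> eigjet m (lam i) (e i)"
    and B: "finite B" "\<And>j. j \<in> B \<Longrightarrow> eigjet m (mu j) (g j)"
    and P: "degree P1 = h" "lead_coeff P1 = 1" "degree P2 = h" "lead_coeff P2 = 1" "0 < h"
    and cz: "\<And>i. i < 2 * h - 1 \<Longrightarrow> (\<Sum>s\<in>A. c s * e s i x) = 0"
    and dz: "\<And>i. i < 2 * h \<Longrightarrow> (\<Sum>s\<in>B. d s * g s i x) = 0"
  shows "(\<Sum>i\<in>A. \<Sum>j\<in>B. c i * d j * (divdiff (P1 * P2) (lam i) (mu j) * wr m (e i) (g j) x)) =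
     x powr (1 - real m) * exp (- x) * x ^ (2 * h - 1) *
       ((\<Sum>s\<in>A. c s * e s (2 * h - 1) x) * (\<Sum>s\<in>B. d s * g s (2 * h) x))"
proof -
  let ?p = "x powr (1 - real m) * exp (- x)"
  let ?a = "\<Sum>s\<in>A. c s * e s (2 * h - 1) x" and ?b = "\<Sum>s\<in>B. d s * g s (2 * h) x"
  \<comment> \<open>The divided difference has degree h - 1 and the Wronskian adds one derivative:
    orders up to 2h - 1 occur, all of which vanish for the second combination.\<close>
  have t1: "(\<Sum>j\<in>B. d j * divdiff P2 (lam i) (mu j) * wr m (e i) (g j) x) = 0" if "i \<in> A" for i
  proof -
    have z: "(\<Sum>j\<in>B. d j * poly (synthetic_div P2 (lam i)) (mu j) * g j l x) = 0" if "l \<le> 1" for l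
      by (rule jets_eigen_poly_zero[OF B, where d = "h - 1"])
         (use that P dz in \<open>auto simp: degree_synthetic_div\<close>)
    then show ?thesis unfolding divdiff_commute[of _ "lam i"] unfolding divdiff_def wr_sum_right by simp
  qed
  \<comment> \<open>The same count for the first combination reaches order 2h - 1, its first
    derivative not known to vanish; monicity of \<open>P1\<close> makes the factor 1.\<close>
  have t2: "(\<Sum>i\<in>A. c i * divdiff P1 (lam i) (mu j) * wr m (e i) (g j) x) = - ?p * (- x) ^ (h - 1) * ?a * g j 0 x" for j
  proof -
    let ?Q = "synthetic_div P1 (mu j)"
    have z0: "(\<Sum>i\<in>A. c i * poly ?Q (lam i) * e i 0 x) = 0"
      by (rule jets_eigen_poly_zero[OF A, where d = "h - 1"])
         (use P cz in \<open>auto simp: degree_synthetic_div\<close>)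
    have "(\<Sum>i\<in>A. c i * poly ?Q (lam i) * e i 1 x) = coeff ?Q (h - 1) * (- x) ^ (h - 1) * (\<Sum>s\<in>A. c s * e s (1 + 2 * (h - 1)) x)"
      by (rule jets_eigen_poly[OF A]) (use P cz in \<open>auto simp: degree_synthetic_div\<close>)
    moreover have "coeff ?Q (h - 1) = 1" using coeff_synthetic_div_top[of P1 "mu j"] P by simp
    moreover have "1 + 2 * (h - 1) = 2 * h - 1" using P(5) by simp
    ultimately have z1: "(\<Sum>i\<in>A. c i * poly ?Q (lam i) * e i 1 x) = (- x) ^ (h - 1) * ?a" by (simp only: mult_1)
    show ?thesis unfolding divdiff_def wr_sum_left z0 z1 by simp
  qed
  have "(\<Sum>j\<in>B. d j * poly P2 (mu j) * g j 0 x) = coeff P2 h * (- x) ^ h * (\<Sum>s\<in>B. d s * g s (0 + 2 * h) x)"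
    by (rule jets_eigen_poly[OF B]) (use P dz in auto)
  then have t3: "(\<Sum>j\<in>B. d j * poly P2 (mu j) * g j 0 x) = (- x) ^ h * ?b"
    using P by simp
  have "(\<Sum>i\<in>A. \<Sum>j\<in>B. c i * d j * (divdiff (P1 * P2) (lam i) (mu j) * wr m (e i) (g j) x)) =
     (\<Sum>i\<in>A. \<Sum>j\<in>B. c i * poly P1 (lam i) * (d j * divdiff P2 (lam i) (mu j) * wr m (e i) (g j) x)
        + d j * poly P2 (mu j) * (c i * divdiff P1 (lam i) (mu j) * wr m (e i) (g j) x))"
    by (intro sum.cong refl) (simp add: divdiff_mult algebra_simps)
  also have "\<dots> = (\<Sum>i\<in>A. c i * poly P1 (lam i) * (\<Sum>j\<in>B. d j * divdiff P2 (lam i) (mu j) * wr m (e i) (g j) x))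
     + (\<Sum>j\<in>B. d j * poly P2 (mu j) * (\<Sum>i\<in>A. c i * divdiff P1 (lam i) (mu j) * wr m (e i) (g j) x))"
    by (simp add: sum.distrib sum_distrib_left sum.swap[of _ A B])
  also have "(\<Sum>i\<in>A. c i * poly P1 (lam i) * (\<Sum>j\<in>B. d j * divdiff P2 (lam i) (mu j) * wr m (e i) (g j) x)) = 0"
    by (rule sum.neutral) (simp add: t1)
  also have "(\<Sum>j\<in>B. d j * poly P2 (mu j) * (\<Sum>i\<in>A. c i * divdiff P1 (lam i) (mu j) * wr m (e i) (g j) x))
     = - ?p * (- x) ^ (h - 1) * ?a * (\<Sum>j\<in>B. d j * poly P2 (mu j) * g j 0 x)"
    unfolding t2 sum_distrib_left by (intro sum.cong refl) (simp add: algebra_simps)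
  also have "\<dots> = - ?p * ((- x) ^ (h - 1) * (- x) ^ h) * (?a * ?b)"
    unfolding t3 by (simp only: mult_ac)
  also have "(- x) ^ (h - 1) * (- x) ^ h = - (x ^ (2 * h - 1))"
  proof -
    have "(- x) ^ (h - 1) * (- x) ^ h = (- x) ^ (2 * h - 1)"
      using P(5) by (simp add: power_add [symmetric] mult_2)
    also have "\<dots> = - (x ^ (2 * h - 1))" using P(5) by (intro power_minus_odd) simp
    finally show ?thesis .
  qed
  finally show ?thesis by simp
qed

lemma tendsto_poly_exp_0: "((\<lambda>t. poly R t * exp (- t)) \<longlongrightarrow> (0 :: real)) at_top"
proof -
  have "((\<lambda>t. \<Sum>i\<le>degree R. coeff R i * (t ^ i / exp t)) \<longlongrightarrow> (\<Sum>i\<le>degree R. coeff R i * 0)) at_top"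
    by (intro tendsto_sum tendsto_mult tendsto_const tendsto_power_div_exp_0)
  moreover have "(\<lambda>t. \<Sum>i\<le>degree R. coeff R i * (t ^ i / exp t)) = (\<lambda>t. poly R t * exp (- t))"
    by (simp only: poly_altdef sum_distrib_right exp_minus divide_inverse mult.assoc)
  ultimately show ?thesis by simp
qed

lemma tendsto_rational_exp_0:
  fixes R W :: "real poly"
  assumes "W \<noteq> 0"
  shows "((\<lambda>t. poly R t * exp (- t) / poly W t) \<longlongrightarrow> 0) at_top"
proof -
  obtain V d N where V: "d > 0" "\<And>t. t \<ge> N \<Longrightarrow> d \<le> \<bar>poly W t\<bar>"
  proof (cases "lead_coeff W > 0")
    case True
    then obtain N where "\<And>t. t \<ge> N \<Longrightarrow> lead_coeff W \<le> poly W t" using poly_pinfty_gt_lc by blast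
    then show ?thesis using True that[of "lead_coeff W" N] by (meson abs_ge_self order_trans)
  next
    case False
    moreover have "lead_coeff W \<noteq> 0" using assms by simp
    ultimately have 1: "lead_coeff (- W) > 0" unfolding degree_minus coeff_minus by linarith
    then obtain N where "\<And>t. t \<ge> N \<Longrightarrow> lead_coeff (- W) \<le> poly (- W) t" using poly_pinfty_gt_lc by blast
    then show ?thesis using 1 that[of "lead_coeff (- W)" N] by (metis abs_ge_minus_self order_trans poly_minus)
  qed
  have "((\<lambda>t. (1 / d) * \<bar>poly R t * exp (- t)\<bar>) \<longlongrightarrow> (1 / d) * \<bar>0\<bar>) at_top"
    by (intro tendsto_intros tendsto_poly_exp_0)
  then have 0: "((\<lambda>t. (1 / d) * \<bar>poly R t * exp (- t)\<bar>) \<longlongrightarrow> 0) at_top" by simp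
  show ?thesis
  proof (rule Lim_null_comparison[OF _ 0])
    have "\<bar>poly R t * exp (- t) / poly W t\<bar> \<le> (1 / d) * \<bar>poly R t * exp (- t)\<bar>" if "t \<ge> N" for t
    proof -
      have "\<bar>poly R t * exp (- t)\<bar> / \<bar>poly W t\<bar> \<le> \<bar>poly R t * exp (- t)\<bar> / d"
        using V(1) V(2)[OF that] by (intro divide_left_mono) auto
      then show ?thesis by (simp add: abs_divide)
    qed
    then show "\<forall>\<^sub>F t in at_top. norm (poly R t * exp (- t) / poly W t) \<le> (1 / d) * \<bar>poly R t * exp (- t)\<bar>"
      unfolding eventually_at_top_linorder by auto
  qed
qed

lemma nondecreasing_limits:
  fixes g :: "real \<Rightarrow> real"
  assumes d: "\<And>t. t > 0 \<Longrightarrow> (g has_real_derivative g' t) (at t)" "\<And>t. t > 0 \<Longrightarrow> g' t \<ge> 0"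
    and A: "(g \<longlongrightarrow> A) (at_right 0)" and B: "(g \<longlongrightarrow> B) at_top" and t: "t > 0"
  shows "A \<le> g t" "g t \<le> B"
proof -
  have mono: "g x \<le> g y" if "0 < x" "x \<le> y" for x y
    by (rule DERIV_nonneg_imp_nondecreasing[OF that(2)]) (use d that in \<open>meson less_le_trans\<close>)
  have "\<forall>\<^sub>F x in at_right 0. g x \<le> g t"
    unfolding eventually_at_right_field using mono t by (intro exI[of _ t]) auto
  then show "A \<le> g t" by (rule tendsto_upperbound[OF A]) simp
  have "\<forall>\<^sub>F x in at_top. g t \<le> g x"
    unfolding eventually_at_top_linorder using mono t by blast
  then show "g t \<le> B" by (rule tendsto_lowerbound[OF B]) simp
qed

text \<open>Used with c the coefficient at 0 of the only relevant exponential seed, D = P'(n), y and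
  s the values at 0 of the polynomial and of that seed, kp their Wronskian, and e, f the signs
  (-1)^n and (-1)^(m-1-n). Multiplying by s * s eliminates c without a division.\<close>

lemma sign_transfer:
  fixes c D y s kp e f :: real
  assumes e: "e * e = 1" "f * f = 1" and le: "c * D * kp \<le> 0" and eq: "c * D * s = D * y"
    and y: "y * e > 0" and s: "s * f > 0" and kp: "kp * e < 0"
  shows "f * D \<ge> 0"
proof -
  have "(y * e) * (kp * e) < 0" using y kp by (rule mult_pos_neg)
  also have "(y * e) * (kp * e) = y * kp * (e * e)" by simp
  finally have yk: "y * kp < 0" by (simp add: e)
  have "(c * D * kp) * (s * s) \<le> 0" by (rule mult_nonpos_nonneg[OF le]) simp
  also have "(c * D * kp) * (s * s) = (c * D * s) * (kp * s)" by simp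
  also have "\<dots> = (y * kp) * (D * s)" unfolding eq by simp
  finally have "D * s \<ge> 0" using yk by (simp add: mult_le_0_iff)
  then have "(f * D) * (s * f) \<ge> 0" using e(2) by (metis mult.assoc mult.commute mult.right_neutral)
  then show ?thesis using s by (simp add: zero_le_mult_iff)
qed

text \<open>\<open>cover\<close> is the covering hypothesis read in the natural numbers.
  \<open>even_card\<close> makes it possible to factor \<open>P\<close> into two polynomials of
  degree k/2.\<close>

locale laguerre_pair =
  fixes m :: nat and F1 F2 :: "nat set"
  assumes m: "0 < m" and fin: "finite F1" "finite F2"
    and cover: "\<And>n. n < m \<Longrightarrow> n \<in> F1 \<or> m - 1 - n \<in> F2"
    and even_card: "even (card F1 + card F2)"
begin

definition "S = F1 <+> F2"
definition "k = card F1 + card F2"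
definition "P = rootpoly (ev m) S"

lemma finS [simp]: "finite S" using fin by (simp add: S_def)

lemma cardS: "card S = k" using fin by (simp add: S_def k_def card_Plus)

lemma k_ge: "2 \<le> k"
proof -
  have "F1 \<noteq> {} \<or> F2 \<noteq> {}" using cover[of 0] m by auto
  then have "k \<noteq> 0" using fin by (auto simp: k_def)
  moreover have "even k" using even_card by (simp add: k_def)
  ultimately show ?thesis by (cases "k = 1") auto
qed

lemma k_half: "2 * (k div 2) = k" "0 < k div 2"
  using even_card k_ge by (auto simp: k_def)

lemma P_split:
  obtains P1 P2 where "P = P1 * P2" "degree P1 = k div 2" "lead_coeff P1 = 1"
    "degree P2 = k div 2" "lead_coeff P2 = 1"
proof -
  obtain A where A: "A \<subseteq> S" "card A = k div 2"
    using obtain_subset_with_card_n[of "k div 2" S] cardS by auto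
  then have fA: "finite A" using finS finite_subset by blast
  have "P = rootpoly (ev m) (A \<union> (S - A))" using A(1) by (simp add: P_def Un_absorb1)
  also have "\<dots> = rootpoly (ev m) A * rootpoly (ev m) (S - A)"
    by (rule rootpoly_union) (use fA in auto)
  finally have "P = rootpoly (ev m) A * rootpoly (ev m) (S - A)" .
  moreover have "card (S - A) = k div 2" using A k_half cardS by (simp add: card_Diff_subset fA)
  ultimately show ?thesis
    using fA A
    by (intro that[of "rootpoly (ev m) A" "rootpoly (ev m) (S - A)"] lead_coeff_rootpoly)
       (auto simp: degree_rootpoly)
qed

lemma P_root: "s \<in> S \<Longrightarrow> poly P (ev m s) = 0"
  unfolding P_def by (rule rootpoly_root) auto

text \<open>For distinct seeds the divided difference vanishes, for equal ones the Wronskian does: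
  the concomitant is zero on the span of the seeds.\<close>

lemma divdiff_P_wr:
  assumes "s \<in> S" "t \<in> S"
  shows "divdiff P (ev m s) (ev m t) * wr m (seed m s) (seed m t) x = 0"
proof (cases "s = t")
  case False
  then have "divdiff P (ev m s) (ev m t) = 0"
    using assms divdiff_rootpoly_double[OF finS] divdiff_rootpoly_distinct[OF finS]
    unfolding P_def by metis
  then show ?thesis by simp
qed simp

lemma ev_eq_nat: "s \<in> S \<Longrightarrow> ev m s = real n \<Longrightarrow> s = Inl n \<or> (s = Inr (m - 1 - n) \<and> n < m)"
  by (cases s) auto

section \<open>Interpolating an eigenfunction by the seeds\<close>

context
  fixes n :: nat
  assumes nz: "\<And>t. t \<ge> 0 \<Longrightarrow> Omega (- real m) F1 F2 t \<noteq> 0"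
    and n: "n \<notin> F1"
begin

definition "W = Determinant.det (coremat m F1 F2)"

definition "coefp = (SOME C. \<forall>j<k. (\<Sum>s\<in>S. C s * core m s j) = W * (pderiv ^^ j) (laguerre_poly n (- real m)))"

lemma coefp: "j < k \<Longrightarrow> (\<Sum>s\<in>S. coefp s * core m s j) = W * (pderiv ^^ j) (laguerre_poly n (- real m))"
proof -
  have "\<exists>C. \<forall>j<k. (\<Sum>s\<in>S. C s * core m s j) = W * (pderiv ^^ j) (laguerre_poly n (- real m))"
    using core_interpolation[OF fin, of m "\<lambda>j. (pderiv ^^ j) (laguerre_poly n (- real m))"]
    unfolding S_def k_def W_def by metis
  then show "j < k \<Longrightarrow> ?thesis" unfolding coefp_def by (rule someI2_ex) blast
qed

lemma W_nz: "t \<ge> 0 \<Longrightarrow> poly W t \<noteq> 0"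
  using nz[of t] by (simp add: W_def Omega_det[OF fin])

text \<open>Coordinates of the interpolant u_t; since the base point t moves, they play the part of
  variation-of-parameters coefficients.\<close>

definition "coef s t = poly (coefp s) t / (poly W t * expf s t)"

lemma coef_seed: "t \<ge> 0 \<Longrightarrow> j < k \<Longrightarrow> (\<Sum>s\<in>S. coef s t * seed m s j t) = polyjet m n j t"
proof -
  assume t: "t \<ge> 0" and j: "j < k"
  have "(\<Sum>s\<in>S. coef s t * seed m s j t) = (\<Sum>s\<in>S. poly (coefp s * core m s j) t) / poly W t"
    unfolding sum_divide_distrib by (rule sum.cong) (auto simp: coef_def seed_core)
  also have "\<dots> = poly (\<Sum>s\<in>S. coefp s * core m s j) t / poly W t" by (simp add: poly_sum)
  also have "\<dots> = polyjet m n j t" unfolding coefp[OF j] using W_nz[OF t] by (simp add: polyjet_def)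
  finally show ?thesis .
qed

lemma coef_differentiable: "t \<ge> 0 \<Longrightarrow> \<exists>d. (coef s has_real_derivative d) (at t)"
proof -
  assume t: "t \<ge> 0"
  have g: "\<exists>d. (expf s has_real_derivative d) (at t)"
    by (cases s) (auto simp: expf_def [abs_def] intro!: exI derivative_eq_intros)
  then obtain d where "(expf s has_real_derivative d) (at t)" by blast
  then show ?thesis unfolding coef_def [abs_def]
    by (intro exI) (rule derivative_eq_intros poly_DERIV refl | use W_nz[OF t] in simp)+
qed

definition "dcoef s t = (SOME d. (coef s has_real_derivative d) (at t))"

lemma dcoef: "t \<ge> 0 \<Longrightarrow> (coef s has_real_derivative dcoef s t) (at t)"
  unfolding dcoef_def using coef_differentiable by (rule someI_ex)

text \<open>The first derivative at which u_t fails to match y. By Cramer's rule it is the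
  Darboux-Crum quotient of the Wronskian of the seeds and y by the Wronskian of the seeds; it is the
  Y of the overview.\<close>

definition "remk t = polyjet m n k t - (\<Sum>s\<in>S. coef s t * seed m s k t)"

text \<open>Differentiating the j-th interpolation condition gives the (j+1)-st plus the terms with
  \<open>dcoef\<close>. Below order k - 1 both conditions hold, so those terms cancel; at order k -
  1 the mismatch \<open>remk\<close> appears.\<close>

lemma dcoef_seed:
  assumes t: "t > 0" and j: "j < k"
  shows "(\<Sum>s\<in>S. dcoef s t * seed m s j t) = (if j = k - 1 then remk t else 0)"
proof -
  have D: "((\<lambda>t. \<Sum>s\<in>S. coef s t * seed m s j t) has_real_derivative
      (\<Sum>s\<in>S. dcoef s t * seed m s j t + seed m s (Suc j) t * coef s t)) (at t)"
    by (intro DERIV_sum DERIV_mult dcoef eigjet_deriv[OF eigjet_seed]) (use t in auto)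
  have evt: "\<forall>\<^sub>F x in nhds t. (\<Sum>s\<in>S. coef s x * seed m s j x) = polyjet m n j x"
  proof -
    have "\<forall>\<^sub>F x in nhds t. x \<in> {0<..}" by (rule eventually_nhds_in_open) (use t in auto)
    then show ?thesis by eventually_elim (use coef_seed j in auto)
  qed
  have "(polyjet m n j has_real_derivative
      (\<Sum>s\<in>S. dcoef s t * seed m s j t + seed m s (Suc j) t * coef s t)) (at t)"
    by (rule iffD1[OF DERIV_cong_ev[OF refl evt refl] D])
  then have "(\<Sum>s\<in>S. dcoef s t * seed m s j t + seed m s (Suc j) t * coef s t) = polyjet m n (Suc j) t"
    using eigjet_deriv[OF eigjet_polyjet] DERIV_unique by blast
  then have e: "(\<Sum>s\<in>S. dcoef s t * seed m s j t) = polyjet m n (Suc j) t - (\<Sum>s\<in>S. coef s t * seed m s (Suc j) t)"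
    by (simp add: sum.distrib mult.commute)
  show ?thesis
  proof (cases "j = k - 1")
    case True
    then have "Suc j = k" using j by simp
    then show ?thesis using e True by (simp add: remk_def)
  next
    case False
    then have "Suc j < k" using j by simp
    then show ?thesis using e False coef_seed[of t "Suc j"] t by simp
  qed
qed

definition "conc t = (\<Sum>s\<in>S. coef s t * (divdiff P (ev m s) (real n) * wr m (seed m s) (polyjet m n) t))"

definition "wt t = t powr (- real m) * exp (- t)"

lemma wt_pos: "t > 0 \<Longrightarrow> wt t > 0" by (simp add: wt_def)

text \<open>Adjoining the interpolated function as an extra index \<^term>\<open>None\<close> turns the remainder
  into a combination of eigenfunctions with \<^term>\<open>k\<close> vanishing jets.\<close>

lemma conc_deriv:
  assumes t: "t > 0"
  shows "(conc has_real_derivative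
     (t powr (1 - real m) * exp (- t) * t ^ (k - 1) * (remk t)\<^sup>2 - poly P (real n) * wt t * (polyjet m n 0 t)\<^sup>2)) (at t)"
proof -
  let ?y = "polyjet m n" and ?dd = "\<lambda>s. divdiff P (ev m s) (real n)"
  define lam where "lam o' = (case o' of None \<Rightarrow> real n | Some s \<Rightarrow> ev m s)" for o'
  define e where "e o' = (case o' of None \<Rightarrow> ?y | Some s \<Rightarrow> seed m s)" for o'
  define d where "d o' = (case o' of None \<Rightarrow> 1 | Some s \<Rightarrow> - coef s t)" for o'
  define B where "B = insert None (Some ` S)"
  have sumB: "(\<Sum>j\<in>B. f j) = f None + (\<Sum>s\<in>S. f (Some s))" for f :: "_ \<Rightarrow> real"
    unfolding B_def by (subst sum.insert) (auto simp: sum.reindex)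
  have eB: "eigjet m (lam j) (e j)" for j
    by (cases j) (auto simp: lam_def e_def eigjet_polyjet eigjet_seed)
  obtain P1 P2 where PP: "P = P1 * P2" "degree P1 = k div 2" "lead_coeff P1 = 1"
    "degree P2 = k div 2" "lead_coeff P2 = 1" by (rule P_split)
  have rB: "(\<Sum>s\<in>B. d s * e s j t) = ?y j t - (\<Sum>s\<in>S. coef s t * seed m s j t)" for j
    unfolding sumB by (simp add: d_def e_def sum_negf)
  have "(\<Sum>i\<in>S. \<Sum>j\<in>B. dcoef i t * d j * (divdiff (P1 * P2) (ev m i) (lam j) * wr m (seed m i) (e j) t)) =
     t powr (1 - real m) * exp (- t) * t ^ (2 * (k div 2) - 1) *
       ((\<Sum>s\<in>S. dcoef s t * seed m s (2 * (k div 2) - 1) t) * (\<Sum>s\<in>B. d s * e s (2 * (k div 2)) t))"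
  proof (rule concomitant_leading[OF finS eigjet_seed _ eB PP(2-5) k_half(2)])
    show "finite B" by (simp add: B_def)
    show "(\<Sum>s\<in>S. dcoef s t * seed m s i t) = 0" if "i < 2 * (k div 2) - 1" for i
      using that dcoef_seed[OF t, of i] by (simp add: k_half)
    show "(\<Sum>s\<in>B. d s * e s i t) = 0" if "i < 2 * (k div 2)" for i
      using that coef_seed[of t i] t unfolding rB k_half by simp
  qed
  also have "\<dots> = t powr (1 - real m) * exp (- t) * t ^ (k - 1) * (remk t)\<^sup>2"
    unfolding rB k_half using dcoef_seed[OF t, of "k - 1"] k_ge by (simp add: remk_def [symmetric] power2_eq_square)
  finally have K: "(\<Sum>i\<in>S. \<Sum>j\<in>B. dcoef i t * d j * (divdiff P (ev m i) (lam j) * wr m (seed m i) (e j) t)) = \<dots>"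
    unfolding PP(1) .
  \<comment> \<open>Pairs of seeds contribute nothing by \<open>divdiff_P_wr\<close>, so only the
    column of \<open>None\<close> remains: the part of the derivative of \<open>conc\<close> that
    comes from the moving coefficients.\<close>
  have K2: "(\<Sum>i\<in>S. \<Sum>j\<in>B. dcoef i t * d j * (divdiff P (ev m i) (lam j) * wr m (seed m i) (e j) t))
     = (\<Sum>i\<in>S. dcoef i t * (?dd i * wr m (seed m i) ?y t))"
  proof (rule sum.cong[OF refl])
    fix i assume i: "i \<in> S"
    have "(\<Sum>s\<in>S. dcoef i t * d (Some s) * (divdiff P (ev m i) (lam (Some s)) * wr m (seed m i) (e (Some s)) t)) = 0"
      by (rule sum.neutral) (use divdiff_P_wr[OF i] in \<open>auto simp: lam_def e_def\<close>)
    then show "(\<Sum>j\<in>B. dcoef i t * d j * (divdiff P (ev m i) (lam j) * wr m (seed m i) (e j) t))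
        = dcoef i t * (?dd i * wr m (seed m i) ?y t)"
      unfolding sumB by (simp add: d_def lam_def e_def)
  qed
  have "(conc has_real_derivative (\<Sum>s\<in>S. dcoef s t * (?dd s * wr m (seed m s) ?y t)
      + ?dd s * ((ev m s - real n) * (t powr (- real m) * exp (- t)) * seed m s 0 t * ?y 0 t) * coef s t)) (at t)"
    unfolding conc_def [abs_def]
    by (intro DERIV_sum DERIV_mult DERIV_cmult dcoef wr_deriv[OF eigjet_seed eigjet_polyjet]) (use t in auto)
  moreover have "(\<Sum>s\<in>S. dcoef s t * (?dd s * wr m (seed m s) ?y t)
      + ?dd s * ((ev m s - real n) * (t powr (- real m) * exp (- t)) * seed m s 0 t * ?y 0 t) * coef s t)
    = (\<Sum>s\<in>S. dcoef s t * (?dd s * wr m (seed m s) ?y t)) - poly P (real n) * wt t * ?y 0 t * (\<Sum>s\<in>S. coef s t * seed m s 0 t)"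
    unfolding sum_distrib_left sum_subtractf [symmetric]
  proof (rule sum.cong[OF refl])
    fix s assume s: "s \<in> S"
    \<comment> \<open>The eigenvalue difference produced by Lagrange's identity is exactly the
      denominator of the divided difference, and \<open>P\<close> vanishes at the seed
      eigenvalue.\<close>
    have z: "(ev m s - real n) * ?dd s = - poly P (real n)" using divdiff[of "ev m s" "real n" P] P_root[OF s] by simp
    have "?dd s * ((ev m s - real n) * (t powr (- real m) * exp (- t)) * seed m s 0 t * ?y 0 t) * coef s t
       = ((ev m s - real n) * ?dd s) * (t powr (- real m) * exp (- t)) * seed m s 0 t * ?y 0 t * coef s t"
      by (simp only: mult_ac)
    also have "\<dots> = - poly P (real n) * (t powr (- real m) * exp (- t)) * seed m s 0 t * ?y 0 t * coef s t"
      by (simp only: z)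
    finally have "?dd s * ((ev m s - real n) * (t powr (- real m) * exp (- t)) * seed m s 0 t * ?y 0 t) * coef s t
       = - poly P (real n) * (t powr (- real m) * exp (- t)) * seed m s 0 t * ?y 0 t * coef s t" .
    then show "dcoef s t * (?dd s * wr m (seed m s) ?y t)
      + ?dd s * ((ev m s - real n) * (t powr (- real m) * exp (- t)) * seed m s 0 t * ?y 0 t) * coef s t
      = dcoef s t * (?dd s * wr m (seed m s) ?y t) - poly P (real n) * wt t * ?y 0 t * (coef s t * seed m s 0 t)"
      by (simp add: wt_def)
  qed
  moreover have "(\<Sum>s\<in>S. coef s t * seed m s 0 t) = ?y 0 t" using coef_seed[of t 0] t k_ge by simp
  ultimately show ?thesis using K K2 by (simp add: power2_eq_square mult.assoc)
qed

text \<open>The exponential of a seed cancels against the one in \<open>coef\<close>, so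
  \<open>conc\<close> is t^(1-m) e^(-t) times a rational function of t.\<close>

lemma conc_at_top: "(conc \<longlongrightarrow> 0) at_top"
proof -
  let ?L = "laguerre_poly n (- real m)"
  define R where "R = (\<Sum>s\<in>S. smult (divdiff P (ev m s) (real n)) (coefp s * (core m s 0 * pderiv ?L - core m s 1 * ?L)))"
  have g: "conc t = t powr (1 - real m) * (poly R t * exp (- t) / poly W t)" if "t > 0" for t
  proof -
    have "conc t = (\<Sum>s\<in>S. t powr (1 - real m) * (poly (smult (divdiff P (ev m s) (real n))
       (coefp s * (core m s 0 * pderiv ?L - core m s 1 * ?L))) t * exp (- t) / poly W t))"
      unfolding conc_def
    proof (rule sum.cong[OF refl])
      fix s
      let ?G = "expf s t" and ?X = "poly (core m s 0) t * poly (pderiv ?L) t - poly (core m s 1) t * poly ?L t"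
      have "seed m s 0 t * polyjet m n 1 t - seed m s 1 t * polyjet m n 0 t = ?G * ?X"
        by (simp add: seed_core polyjet_def algebra_simps)
      then show "coef s t * (divdiff P (ev m s) (real n) * wr m (seed m s) (polyjet m n) t) =
         t powr (1 - real m) * (poly (smult (divdiff P (ev m s) (real n))
         (coefp s * (core m s 0 * pderiv ?L - core m s 1 * ?L))) t * exp (- t) / poly W t)"
        by (simp add: coef_def wr_def)
    qed
    also have "\<dots> = t powr (1 - real m) * (poly R t * exp (- t) / poly W t)"
      by (simp add: R_def poly_sum sum_distrib_left sum_distrib_right sum_divide_distrib)
    finally show ?thesis .
  qed
  have W: "W \<noteq> 0" using W_nz[of 0] by auto
  have 0: "((\<lambda>t. \<bar>poly R t * exp (- t) / poly W t\<bar>) \<longlongrightarrow> 0) at_top"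
    using tendsto_rabs[OF tendsto_rational_exp_0[OF W]] by simp
  show ?thesis
  proof (rule Lim_null_comparison[OF _ 0])
    have "norm (conc t) \<le> \<bar>poly R t * exp (- t) / poly W t\<bar>" if t: "t \<ge> 1" for t
    proof -
      have "t powr (1 - real m) \<le> t powr 0" by (rule powr_mono) (use t m in auto)
      then have "t powr (1 - real m) \<le> 1" using t by simp
      then have "t powr (1 - real m) * \<bar>poly R t * exp (- t) / poly W t\<bar> \<le> 1 * \<bar>poly R t * exp (- t) / poly W t\<bar>"
        by (rule mult_right_mono) simp
      then show ?thesis using t by (simp add: g abs_mult)
    qed
    then show "\<forall>\<^sub>F t in at_top. norm (conc t) \<le> \<bar>poly R t * exp (- t) / poly W t\<bar>"
      unfolding eventually_at_top_linorder by blast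
  qed
qed

text \<open>The divided difference has degree at most k - 1 in the eigenvalue, and at the origin k
  matching jets are enough for a polynomial of that degree in D.\<close>

lemma interpolation_at_0:
  "(\<Sum>s\<in>S. coef s 0 * divdiff P (ev m s) (real n) * seed m s 0 0) = divdiff P (real n) (real n) * polyjet m n 0 0"
proof -
  define lam where "lam o' = (case o' of None \<Rightarrow> real n | Some s \<Rightarrow> ev m s)" for o'
  define e where "e o' = (case o' of None \<Rightarrow> polyjet m n | Some s \<Rightarrow> seed m s)" for o'
  define d where "d o' = (case o' of None \<Rightarrow> 1 | Some s \<Rightarrow> - coef s 0)" for o'
  define B where "B = insert None (Some ` S)"
  have sumB: "(\<Sum>j\<in>B. f j) = f None + (\<Sum>s\<in>S. f (Some s))" for f :: "_ \<Rightarrow> real"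
    unfolding B_def by (subst sum.insert) (auto simp: sum.reindex)
  have eB: "eigjet m (lam j) (e j)" for j
    by (cases j) (auto simp: lam_def e_def eigjet_polyjet eigjet_seed)
  have "(\<Sum>s\<in>B. d s * poly (synthetic_div P (real n)) (lam s) * e s 0 0) = 0"
  proof (rule jets_eigen_poly_at_0[OF _ eB, where d = "k - 1"])
    show "finite B" by (simp add: B_def)
    show "degree (synthetic_div P (real n)) \<le> k - 1"
      by (simp add: degree_synthetic_div P_def degree_rootpoly cardS)
    show "(\<Sum>s\<in>B. d s * e s i 0) = 0" if "i \<le> 0 + (k - 1)" for i
      unfolding sumB using coef_seed[of 0 i] that k_ge by (simp add: d_def e_def sum_negf)
  qed
  then show ?thesis unfolding sumB by (simp add: d_def lam_def e_def divdiff_def sum_negf)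
qed

lemma coef_tendsto_0: "(coef s \<longlongrightarrow> coef s 0) (at_right 0)"
  using DERIV_isCont[OF dcoef[of 0 s]] unfolding isCont_def by (auto intro: tendsto_within_subset)

text \<open>Since y = x^m q, the singular power cancels and the limit is m q(0) times the sum
  evaluated in \<open>interpolation_at_0\<close>, which is proportional to y(0) = 0.\<close>

lemma conc_at_0_high:
  assumes mn: "m \<le> n"
  shows "(conc \<longlongrightarrow> 0) (at_right 0)"
proof -
  obtain q where q: "laguerre_poly n (- real m) = monom 1 m * q" using laguerre_neg_factor[OF mn] by blast
  define V where "V s t = coef s t * (divdiff P (ev m s) (real n) * (exp (- t) *
     (seed m s 0 t * (real m * poly q t + t * poly (pderiv q) t) - t * seed m s 1 t * poly q t)))" for s t
  have eq: "conc t = (\<Sum>s\<in>S. V s t)" if t: "t > 0" for t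
    unfolding conc_def
  proof (rule sum.cong[OF refl])
    fix s
    have p: "t powr (1 - real m) = t / t ^ m"
      using t by (simp add: powr_diff powr_realpow)
    have m1: "t * t ^ (m - 1) = t ^ m" using m by (cases m) auto
    have "polyjet m n 0 t = t ^ m * poly q t" "polyjet m n 1 t = real m * t ^ (m - 1) * poly q t + t ^ m * poly (pderiv q) t"
      by (simp_all add: polyjet_def q poly_monom pderiv_mult pderiv_monom)
    then have "wr m (seed m s) (polyjet m n) t = exp (- t) *
      ((1 / t ^ m) * (seed m s 0 t * (real m * (t * t ^ (m - 1)) * poly q t + t * t ^ m * poly (pderiv q) t)
        - t * seed m s 1 t * (t ^ m * poly q t)))"
      unfolding wr_def p by (simp add: algebra_simps)
    also have "\<dots> = exp (- t) * (seed m s 0 t * (real m * poly q t + t * poly (pderiv q) t) - t * seed m s 1 t * poly q t)"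
      unfolding m1 using t by (simp add: field_simps)
    finally show "coef s t * (divdiff P (ev m s) (real n) * wr m (seed m s) (polyjet m n) t) = V s t"
      by (simp add: V_def)
  qed
  have sd: "(seed m s j \<longlongrightarrow> seed m s j 0) (at_right 0)" for s j
    using DERIV_isCont[OF eigjet_deriv[OF eigjet_seed[of m s], of j 0]]
    unfolding isCont_def by (auto intro: tendsto_within_subset)
  have pl: "(poly p \<longlongrightarrow> poly p 0) (at_right 0)" for p :: "real poly"
    using DERIV_isCont[OF poly_DERIV[of p 0]] unfolding isCont_def by (auto intro: tendsto_within_subset)
  have V0: "(V s \<longlongrightarrow> V s 0) (at_right 0)" for s
    unfolding V_def
    by (intro tendsto_mult tendsto_diff tendsto_add tendsto_const tendsto_ident_at tendsto_exp tendsto_minus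
        coef_tendsto_0 sd pl)
  have "((\<lambda>t. \<Sum>s\<in>S. V s t) \<longlongrightarrow> (\<Sum>s\<in>S. V s 0)) (at_right 0)"
    by (intro tendsto_sum V0)
  moreover have "(\<Sum>s\<in>S. V s 0) = real m * poly q 0 * (\<Sum>s\<in>S. coef s 0 * divdiff P (ev m s) (real n) * seed m s 0 0)"
    unfolding sum_distrib_left by (rule sum.cong) (auto simp: V_def)
  moreover have "\<dots> = 0"
    unfolding interpolation_at_0 using polyjet_vanish[OF mn, of 0] m by simp
  moreover have "\<forall>\<^sub>F t in at_right 0. (\<Sum>s\<in>S. V s t) = conc t"
    unfolding eventually_at_right_field using eq by (intro exI[of _ 1]) auto
  ultimately show ?thesis by (simp add: tendsto_cong)
qed

text \<open>If P(n) < 0, both terms in the derivative of \<open>conc\<close> are nonnegative, while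
  its limits at 0 and at infinity are both 0. So it is constant, its derivative vanishes, and y = 0,
  which is absurd.\<close>

lemma poly_P_nonneg:
  assumes mn: "m \<le> n"
  shows "poly P (real n) \<ge> 0"
proof (rule ccontr)
  assume "\<not> poly P (real n) \<ge> 0"
  then have neg: "poly P (real n) < 0" by simp
  let ?g' = "\<lambda>t. t powr (1 - real m) * exp (- t) * t ^ (k - 1) * (remk t)\<^sup>2 - poly P (real n) * wt t * (polyjet m n 0 t)\<^sup>2"
  have t1: "t powr (1 - real m) * exp (- t) * t ^ (k - 1) * (remk t)\<^sup>2 \<ge> 0" if "t > 0" for t
    using that by simp
  have t2: "- poly P (real n) * wt t * (polyjet m n 0 t)\<^sup>2 \<ge> 0" if "t > 0" for t
    using that neg wt_pos[OF that] by (intro mult_nonneg_nonneg) auto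
  have nonneg: "?g' t \<ge> 0" if "t > 0" for t using t1[OF that] t2[OF that] by simp
  have z: "conc t = 0" if "t > 0" for t
    using nondecreasing_limits[OF conc_deriv nonneg conc_at_0_high[OF mn] conc_at_top that] by linarith
  have y0: "poly (laguerre_poly n (- real m)) t = poly 0 t" if t: "t \<in> {0<..}" for t
  proof -
    have "\<forall>\<^sub>F x in nhds t. x \<in> {0<..}" by (rule eventually_nhds_in_open) (use t in auto)
    then have evt: "\<forall>\<^sub>F x in nhds t. conc x = (\<lambda>_. 0) x" by eventually_elim (use z in auto)
    have tp: "t > 0" using t by simp
    have "((\<lambda>_. 0) has_real_derivative ?g' t) (at t)"
      by (rule iffD1[OF DERIV_cong_ev[OF refl evt refl] conc_deriv[OF tp]])
    then have "?g' t = 0" using DERIV_const DERIV_unique by blast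
    then have "- poly P (real n) * wt t * (polyjet m n 0 t)\<^sup>2 = 0" using t1[OF tp] t2[OF tp] by linarith
    then show ?thesis using neg wt_pos[OF tp] by (simp add: polyjet_def)
  qed
  have "laguerre_poly n (- real m) = 0"
    by (rule poly_eq_on_infinite[OF infinite_Ioi y0])
  then show False by simp
qed

text \<open>Since n is not in \<open>F1\<close>, the only seed with eigenvalue n is the exponential
  one with index m - 1 - n, and the divided difference kills the others. Hence \<open>conc\<close>
  collapses to coefficient times P'(n) times the constant Wronskian. As P(n) = 0, it is
  nondecreasing with limit 0 at infinity, so its limit at 0 is at most 0;
  \<open>interpolation_at_0\<close> then determines the sign of the coefficient when P'(n) is
  nonzero.\<close>

lemma divdiff_P_sign:
  assumes nm: "n < m"
  shows "(-1) ^ (m - 1 - n) * divdiff P (real n) (real n) \<ge> 0"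
proof -
  let ?f = "m - 1 - n" and ?dd = "divdiff P (real n) (real n)"
  let ?s = "Inr ?f :: nat + nat"
  have sS: "?s \<in> S" using cover[OF nm] n by (auto simp: S_def)
  have evs: "ev m ?s = real n" using nm by (simp add: of_nat_diff)
  have Pn: "poly P (real n) = 0" using P_root[OF sS] unfolding evs .
  have dd0: "divdiff P (ev m s) (real n) = 0" if "s \<in> S" "s \<noteq> ?s" for s
  proof -
    have "s \<noteq> Inl n" using that(1) n by (auto simp: S_def)
    then have "ev m s \<noteq> real n" using ev_eq_nat[OF that(1), of n] that(2) by auto
    then show ?thesis using divdiff[of "ev m s" "real n" P] P_root[OF that(1)] Pn by simp
  qed
  have single: "(\<Sum>s\<in>S. a s * divdiff P (ev m s) (real n) * b s) = a ?s * ?dd * b ?s" for a b :: "_ \<Rightarrow> real"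
  proof -
    have "(\<Sum>s\<in>S. a s * divdiff P (ev m s) (real n) * b s)
      = a ?s * divdiff P (ev m ?s) (real n) * b ?s + (\<Sum>s\<in>S - {?s}. a s * divdiff P (ev m s) (real n) * b s)"
      by (rule sum.remove[OF finS sS])
    moreover have "(\<Sum>s\<in>S - {?s}. a s * divdiff P (ev m s) (real n) * b s) = 0"
      by (rule sum.neutral) (use dd0 in auto)
    ultimately show ?thesis unfolding evs by simp
  qed
  obtain kap where kap: "kap * (-1) ^ n < 0" "\<And>x. x > 0 \<Longrightarrow> wr m (expjet m ?f) (polyjet m n) x = kap"
    using wr_expjet_polyjet[OF nm] by blast
  have conc: "conc t = coef ?s t * ?dd * kap" if "t > 0" for t
    unfolding conc_def mult.assoc [symmetric] single using kap(2)[OF that] by simp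
  have "((\<lambda>t. coef ?s t * ?dd * kap) \<longlongrightarrow> coef ?s 0 * ?dd * kap) (at_right 0)"
    by (intro tendsto_intros coef_tendsto_0)
  moreover have "\<forall>\<^sub>F t in at_right 0. coef ?s t * ?dd * kap = conc t"
    unfolding eventually_at_right_field using conc by (intro exI[of _ 1]) auto
  ultimately have lim: "(conc \<longlongrightarrow> coef ?s 0 * ?dd * kap) (at_right 0)" by (simp add: tendsto_cong)
  have nonneg: "t powr (1 - real m) * exp (- t) * t ^ (k - 1) * (remk t)\<^sup>2 - poly P (real n) * wt t * (polyjet m n 0 t)\<^sup>2 \<ge> 0"
    if "t > 0" for t using that by (simp add: Pn)
  have le: "coef ?s 0 * ?dd * kap \<le> 0"
    using nondecreasing_limits[OF conc_deriv nonneg lim conc_at_top, of 1] by linarith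
  have "coef ?s 0 * ?dd * seed m ?s 0 0 = ?dd * polyjet m n 0 0"
    using interpolation_at_0 unfolding single .
  moreover have y0: "polyjet m n 0 0 * (-1) ^ n > 0"
    using laguerre_poly_at_0_sign[OF nm] by (simp add: polyjet_def)
  moreover have s0: "seed m ?s 0 0 * (-1) ^ ?f > 0"
    using laguerre_poly_at_0_sign[of ?f m] nm by (simp add: expjet_def)
  ultimately show ?thesis using sign_transfer[of "(-1) ^ n" "(-1) ^ ?f"] le kap(1) by simp
qed

end
end

section \<open>Polynomial approximation in the weighted space\<close>

text \<open>The rate 1/8 leaves room: a product of two such functions grows at most like e^(x/4), so
  it is integrable against x^m e^(-x), and f(x) e^(-x/4) still tends to 0 at infinity.\<close>

definition subexp :: "(real \<Rightarrow> real) \<Rightarrow> bool" where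
  "subexp f \<longleftrightarrow> f \<in> borel_measurable borel \<and> (\<exists>C. \<forall>x>0. \<bar>f x\<bar> \<le> C * exp (x / 8))"

definition wip :: "nat \<Rightarrow> (real \<Rightarrow> real) \<Rightarrow> (real \<Rightarrow> real) \<Rightarrow> real" where
  "wip m f g = (\<integral>x. indicator {0<..} x * (f x * g x * (x ^ m * exp (- x))) \<partial>lborel)"

lemma gamma_moment:
  shows "integrable lborel (\<lambda>x. indicator {0<..} x * (x ^ k * exp (- x)) :: real)" (is ?int)
    and "(\<integral>x. indicator {0<..} x * (x ^ k * exp (- x) :: real) \<partial>lborel) = fact k" (is ?val)
proof -
  have "(\<integral>\<^sup>+x. ennreal (indicator {0<..} x * (x ^ k * exp (- x) :: real)) \<partial>lborel)
      = (\<integral>\<^sup>+x. ennreal (x ^ k * exp (- x)) * indicator {0..} x \<partial>lborel)"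
  proof (rule nn_integral_cong_AE)
    have "AE x in lborel. x \<noteq> (0 :: real)" by (rule AE_lborel_singleton)
    then show "AE x in lborel. ennreal (indicator {0<..} x * (x ^ k * exp (- x) :: real)) = ennreal (x ^ k * exp (- x)) * indicator {0..} x"
      by eventually_elim (auto split: split_indicator)
  qed
  also have "\<dots> = ennreal (fact k)"
    unfolding nn_intergal_power_times_exp_Ici by simp
  finally have nn: "(\<integral>\<^sup>+x. ennreal (indicator {0<..} x * (x ^ k * exp (- x) :: real)) \<partial>lborel) = ennreal (fact k)" .
  have "has_bochner_integral lborel (\<lambda>x. indicator {0<..} x * (x ^ k * exp (- x) :: real)) (fact k)"
    by (rule has_bochner_integral_nn_integral[OF _ _ _ nn]) (auto intro!: AE_I2 split: split_indicator)
  then show ?int ?val by (auto simp: has_bochner_integral_iff)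
qed

lemma integrable_pow_exp_half:
  "integrable lborel (\<lambda>x. indicator {0<..} x * (x ^ k * exp (- x / 2)) :: real)"
proof -
  have "integrable lborel (\<lambda>x. indicator {0<..} (0 + (1/2) * x) * ((0 + (1/2) * x) ^ k * exp (- (0 + (1/2) * x))) :: real)"
    by (rule lborel_integrable_real_affine[OF gamma_moment(1)]) simp
  then have "integrable lborel (\<lambda>x. 2 ^ k * (indicator {0<..} (0 + (1/2) * x) * ((0 + (1/2) * x) ^ k * exp (- (0 + (1/2) * x)))) :: real)"
    by (rule integrable_mult_right)
  moreover have "(\<lambda>x. 2 ^ k * (indicator {0<..} (0 + (1/2) * x) * ((0 + (1/2) * x) ^ k * exp (- (0 + (1/2) * x)))) :: real)
     = (\<lambda>x. indicator {0<..} x * (x ^ k * exp (- x / 2)))"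
    by (auto simp: fun_eq_iff power_divide split: split_indicator)
  ultimately show ?thesis by (simp only:)
qed

lemma subexp_integrable:
  assumes "subexp f" "subexp g"
  shows "integrable lborel (\<lambda>x. indicator {0<..} x * (f x * g x * (x ^ m * exp (- x))))"
proof -
  obtain C where C: "\<And>x. x > 0 \<Longrightarrow> \<bar>f x\<bar> \<le> C * exp (x / 8)" using assms(1) by (auto simp: subexp_def)
  obtain D where D: "\<And>x. x > 0 \<Longrightarrow> \<bar>g x\<bar> \<le> D * exp (x / 8)" using assms(2) by (auto simp: subexp_def)
  have [measurable]: "f \<in> borel_measurable borel" "g \<in> borel_measurable borel" using assms by (auto simp: subexp_def)
  have "integrable lborel (\<lambda>x. (C * D) * (indicator {0<..} x * (x ^ m * exp (- x / 2)) :: real))"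
    by (rule integrable_mult_right[OF integrable_pow_exp_half])
  then show ?thesis
  proof (rule Bochner_Integration.integrable_bound)
    show "(\<lambda>x. indicator {0<..} x * (f x * g x * (x ^ m * exp (- x)))) \<in> borel_measurable lborel" by measurable
    show "AE x in lborel. norm (indicator {0<..} x * (f x * g x * (x ^ m * exp (- x)))) \<le>
        norm ((C * D) * (indicator {0<..} x * (x ^ m * exp (- x / 2)) :: real))"
    proof (rule AE_I2)
      fix x :: real
      show "norm (indicator {0<..} x * (f x * g x * (x ^ m * exp (- x)))) \<le>
        norm ((C * D) * (indicator {0<..} x * (x ^ m * exp (- x / 2)) :: real))"
      proof (cases "x > 0")
        case True
        have c0: "0 \<le> C * exp (x / 8)" using C[OF True] abs_ge_zero order_trans by blast
        have d0: "0 \<le> D * exp (x / 8)" using D[OF True] abs_ge_zero order_trans by blast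
        have CD: "0 \<le> C" "0 \<le> D" using c0 d0 by (auto simp: zero_le_mult_iff)
        have "\<bar>f x\<bar> * \<bar>g x\<bar> \<le> (C * exp (x / 8)) * (D * exp (x / 8))"
          by (rule mult_mono[OF C[OF True] D[OF True] c0]) simp
        then have "\<bar>f x\<bar> * \<bar>g x\<bar> * (x ^ m * exp (- x)) \<le> (C * exp (x / 8)) * (D * exp (x / 8)) * (x ^ m * exp (- x))"
          by (rule mult_right_mono) (use True in simp)
        also have "\<dots> = C * D * (x ^ m * (exp (x / 8) * exp (x / 8) * exp (- x)))" by (simp only: mult_ac)
        also have "exp (x / 8) * exp (x / 8) * exp (- x) = exp (- (3 / 4) * x)"
          by (simp flip: exp_add)
        also have "C * D * (x ^ m * exp (- (3 / 4) * x)) \<le> C * D * (x ^ m * exp (- x / 2))"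
          using True CD by (intro mult_left_mono) auto
        finally show ?thesis using True CD by (simp add: abs_mult)
      qed simp
    qed
  qed
qed

lemma subexp_lincomb:
  assumes "subexp f" "subexp g"
  shows "subexp (\<lambda>x. a * f x + b * g x)"
proof -
  obtain C where C: "\<And>x. x > 0 \<Longrightarrow> \<bar>f x\<bar> \<le> C * exp (x / 8)" using assms(1) by (auto simp: subexp_def)
  obtain D where D: "\<And>x. x > 0 \<Longrightarrow> \<bar>g x\<bar> \<le> D * exp (x / 8)" using assms(2) by (auto simp: subexp_def)
  have [measurable]: "f \<in> borel_measurable borel" "g \<in> borel_measurable borel" using assms by (auto simp: subexp_def)
  have "\<bar>a * f x + b * g x\<bar> \<le> (\<bar>a\<bar> * C + \<bar>b\<bar> * D) * exp (x / 8)" if "x > 0" for x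
  proof -
    have "\<bar>a * f x + b * g x\<bar> \<le> \<bar>a\<bar> * \<bar>f x\<bar> + \<bar>b\<bar> * \<bar>g x\<bar>"
      by (rule order_trans[OF abs_triangle_ineq]) (simp add: abs_mult)
    also have "\<dots> \<le> \<bar>a\<bar> * (C * exp (x / 8)) + \<bar>b\<bar> * (D * exp (x / 8))"
      by (intro add_mono mult_left_mono C D that) auto
    finally show ?thesis by (simp add: algebra_simps)
  qed
  then show ?thesis unfolding subexp_def by auto
qed

lemma subexp_zero: "subexp (\<lambda>x. 0)"
  by (auto simp: subexp_def intro!: exI[of _ 0])

lemma subexp_add: "subexp f \<Longrightarrow> subexp g \<Longrightarrow> subexp (\<lambda>x. f x + g x)"
  using subexp_lincomb[of f g 1 1] by simp

lemma subexp_diff: "subexp f \<Longrightarrow> subexp g \<Longrightarrow> subexp (\<lambda>x. f x - g x)"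
  using subexp_lincomb[of f g 1 "-1"] by simp

lemma subexp_cmult: "subexp f \<Longrightarrow> subexp (\<lambda>x. a * f x)"
  using subexp_lincomb[of f f a 0] by simp

lemma subexp_sum: "(\<And>i. i \<in> A \<Longrightarrow> subexp (f i)) \<Longrightarrow> subexp (\<lambda>x. \<Sum>i\<in>A. f i x)"
  by (induction A rule: infinite_finite_induct) (auto simp: subexp_zero subexp_add)

lemma power_le_exp: "x > 0 \<Longrightarrow> x ^ k \<le> (8 * real k) ^ k * exp (x / 8)"
proof (cases "k = 0")
  case False
  assume x: "x > 0"
  have "x / (8 * real k) \<le> exp (x / (8 * real k))"
    using exp_ge_add_one_self[of "x / (8 * real k)"] by linarith
  then have "(x / (8 * real k)) ^ k \<le> exp (x / (8 * real k)) ^ k"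
    by (rule power_mono) (use x in simp)
  also have "exp (x / (8 * real k)) ^ k = exp (x / 8)"
    using False by (simp flip: exp_of_nat_mult)
  finally show ?thesis using False by (simp add: power_divide field_simps)
qed simp

lemma subexp_monom: "subexp (\<lambda>x. x ^ k)"
  unfolding subexp_def using power_le_exp[of _ k] by (auto intro!: exI[of _ "(8 * real k) ^ k"])

lemma subexp_poly: "subexp (poly p)"
proof -
  have "subexp (\<lambda>x. \<Sum>i\<le>degree p. coeff p i * x ^ i)" by (intro subexp_sum subexp_cmult subexp_monom)
  moreover have "(\<lambda>x. \<Sum>i\<le>degree p. coeff p i * x ^ i) = poly p" by (simp add: poly_altdef fun_eq_iff)
  ultimately show ?thesis by simp
qed

lemma wip_commute: "wip m f g = wip m g f"
  by (simp add: wip_def mult.commute)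

lemma wip_lincomb:
  assumes "subexp f" "subexp g" "subexp h"
  shows "wip m (\<lambda>x. a * f x + b * g x) h = a * wip m f h + b * wip m g h"
proof -
  have "wip m (\<lambda>x. a * f x + b * g x) h =
     (\<integral>x. a * (indicator {0<..} x * (f x * h x * (x ^ m * exp (- x)))) + b * (indicator {0<..} x * (g x * h x * (x ^ m * exp (- x)))) \<partial>lborel)"
    unfolding wip_def by (rule Bochner_Integration.integral_cong) (auto simp: algebra_simps)
  also have "\<dots> = a * wip m f h + b * wip m g h"
    unfolding wip_def using subexp_integrable[OF assms(1,3), of m] subexp_integrable[OF assms(2,3), of m]
    by (subst Bochner_Integration.integral_add) auto
  finally show ?thesis .
qed

lemma wip_lincomb_right:
  assumes "subexp f" "subexp g" "subexp h"
  shows "wip m h (\<lambda>x. a * f x + b * g x) = a * wip m h f + b * wip m h g"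
  using wip_lincomb[OF assms] by (simp only: wip_commute[of m h])

lemma wip_diff: "subexp f \<Longrightarrow> subexp g \<Longrightarrow> subexp h \<Longrightarrow> wip m (\<lambda>x. f x - g x) h = wip m f h - wip m g h"
  using wip_lincomb[of f g h m 1 "-1"] by simp

lemma wip_cmult: "subexp f \<Longrightarrow> subexp h \<Longrightarrow> wip m (\<lambda>x. a * f x) h = a * wip m f h"
  using wip_lincomb[of f f h m a 0] by simp

lemma wip_sum:
  assumes "subexp h" "\<And>i. i \<in> A \<Longrightarrow> subexp (f i)"
  shows "wip m (\<lambda>x. \<Sum>i\<in>A. c i * f i x) h = (\<Sum>i\<in>A. c i * wip m (f i) h)"
  using assms(2)
proof (induction A rule: infinite_finite_induct)
  case (insert i A)
  have "wip m (\<lambda>x. c i * f i x + 1 * (\<Sum>i\<in>A. c i * f i x)) h = c i * wip m (f i) h + 1 * wip m (\<lambda>x. \<Sum>i\<in>A. c i * f i x) h"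
    by (rule wip_lincomb) (use insert.prems assms(1) in \<open>auto intro!: subexp_sum subexp_cmult\<close>)
  then show ?case using insert by simp
qed (simp_all add: wip_def)

lemma wip_nonneg: "wip m f f \<ge> 0"
  unfolding wip_def by (rule Bochner_Integration.integral_nonneg) (auto split: split_indicator)

lemma wip_mono:
  assumes "subexp f" "subexp g" "\<And>x. x > 0 \<Longrightarrow> \<bar>f x\<bar> \<le> \<bar>g x\<bar>"
  shows "wip m f f \<le> wip m g g"
  unfolding wip_def
proof (rule integral_mono[OF subexp_integrable[OF assms(1,1)] subexp_integrable[OF assms(2,2)]])
  fix x :: real
  show "indicator {0<..} x * (f x * f x * (x ^ m * exp (- x))) \<le> indicator {0<..} x * (g x * g x * (x ^ m * exp (- x)))"
  proof (cases "x > 0")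
    case True
    have "f x * f x \<le> g x * g x" using assms(3)[OF True] by (simp flip: power2_eq_square add: abs_le_square_iff)
    then show ?thesis using True by (simp add: mult_right_mono)
  qed simp
qed

text \<open>The parallelogram identity with the nonnegative term for f - g dropped.\<close>

lemma wip_add_le:
  assumes "subexp f" "subexp g"
  shows "wip m (\<lambda>x. f x + g x) (\<lambda>x. f x + g x) \<le> 2 * wip m f f + 2 * wip m g g"
proof -
  let ?s = "\<lambda>x. f x + g x" and ?d = "\<lambda>x. f x - g x"
  have s: "subexp ?s" and d: "subexp ?d" using assms subexp_add subexp_diff by auto
  have "wip m ?s ?s = wip m f f + 2 * wip m f g + wip m g g"
    using wip_lincomb[OF assms s, of m 1 1] wip_lincomb_right[OF assms assms(1), of m 1 1]
      wip_lincomb_right[OF assms assms(2), of m 1 1] wip_commute[of m g f] by simp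
  moreover have "wip m ?d ?d = wip m f f - 2 * wip m f g + wip m g g"
    using wip_lincomb[OF assms d, of m 1 "-1"] wip_lincomb_right[OF assms assms(1), of m 1 "-1"]
      wip_lincomb_right[OF assms assms(2), of m 1 "-1"] wip_commute[of m g f] by simp
  ultimately show ?thesis using wip_nonneg[of m ?d] by linarith
qed

text \<open>Cauchy-Schwarz in weighted additive form: the squared norm of f - e d g is nonnegative
  for both signs e. No square roots are taken, and g may have norm zero.\<close>

lemma wip_young:
  assumes "subexp f" "subexp g" "d > 0"
  shows "2 * \<bar>wip m f g\<bar> \<le> wip m f f / d + d * wip m g g"
proof -
  have "2 * (e * wip m f g) \<le> wip m f f / d + d * wip m g g" if e: "e * e = 1" for e :: real
  proof -
    let ?h = "\<lambda>x. 1 * f x + (- (e * d)) * g x"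
    have h: "subexp ?h" by (rule subexp_lincomb[OF assms(1,2)])
    have "0 \<le> wip m ?h ?h" by (rule wip_nonneg)
    also have "wip m ?h ?h = wip m f f - 2 * (e * d) * wip m f g + (e * e) * d * d * wip m g g"
    proof -
      have 1: "wip m ?h ?h = 1 * wip m f ?h + (- (e * d)) * wip m g ?h" by (rule wip_lincomb[OF assms(1,2) h])
      have 2: "wip m f ?h = 1 * wip m f f + (- (e * d)) * wip m f g" by (rule wip_lincomb_right[OF assms(1,2,1)])
      have 3: "wip m g ?h = 1 * wip m g f + (- (e * d)) * wip m g g" by (rule wip_lincomb_right[OF assms(1,2,2)])
      show ?thesis unfolding 1 2 3 wip_commute[of m g f] by (simp add: algebra_simps)
    qed
    finally have "2 * (e * wip m f g) * d \<le> wip m f f + d * wip m g g * d" by (simp add: e algebra_simps)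
    then show ?thesis using assms(3) by (simp add: field_simps)
  qed
  from this[of 1] this[of "-1"] show ?thesis by (simp add: abs_if)
qed

text \<open>Continuity is asked for at the single point t because glued functions may jump at the
  gluing point.\<close>

lemma wip_zero_imp:
  assumes f: "subexp f" and z: "wip m f f = 0" and c: "isCont f t" and t: "t > 0"
  shows "f t = 0"
proof (rule ccontr)
  assume nz: "f t \<noteq> 0"
  have "AE x in lborel. indicator {0<..} x * (f x * f x * (x ^ m * exp (- x))) = 0"
    using z unfolding wip_def
    by (subst (asm) integral_nonneg_eq_0_iff_AE[OF subexp_integrable[OF f f]]) (auto split: split_indicator)
  then have ae: "AE x in lborel. x > 0 \<longrightarrow> f x = 0"
    by eventually_elim (auto split: split_indicator)
  have "\<forall>\<^sub>F x in at t. f x \<noteq> 0" using c nz unfolding isCont_def by (rule tendsto_imp_eventually_ne)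
  then obtain d where d: "d > 0" "\<And>x. x \<noteq> t \<Longrightarrow> dist x t < d \<Longrightarrow> f x \<noteq> 0" by (auto simp: eventually_at)
  obtain N where N: "{x. \<not> (x > 0 \<longrightarrow> f x = 0)} \<subseteq> N" "N \<in> null_sets lborel"
    using ae by (auto simp: eventually_ae_filter)
  have "{t<..<t + d} \<subseteq> N" using d(2) t N(1) by (force simp: dist_real_def)
  then have "emeasure lborel {t<..<t + d} \<le> emeasure lborel N" using N(2) by (intro emeasure_mono) auto
  then show False using N(2) d(1) by auto
qed

lemma wip_poly_pos: "p \<noteq> 0 \<Longrightarrow> wip m (poly p) (poly p) > 0"
proof (rule ccontr)
  assume p: "p \<noteq> 0" and "\<not> wip m (poly p) (poly p) > 0"
  then have z: "wip m (poly p) (poly p) = 0" using wip_nonneg[of m "poly p"] by linarith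
  have "poly p t = poly 0 t" if "t \<in> {0<..}" for t
    using wip_zero_imp[OF subexp_poly z DERIV_isCont[OF poly_DERIV]] that by simp
  then have "p = 0" by (rule poly_eq_on_infinite[OF infinite_Ioi])
  then show False using p by simp
qed

section \<open>Density of the polynomials\<close>

definition papprox :: "nat \<Rightarrow> (real \<Rightarrow> real) \<Rightarrow> bool" where
  "papprox m f \<longleftrightarrow> subexp f \<and> (\<forall>e>0. \<exists>q. wip m (\<lambda>x. f x - poly q x) (\<lambda>x. f x - poly q x) < e)"

lemma papprox_poly: "papprox m (poly p)"
  unfolding papprox_def by (auto simp: subexp_poly wip_def intro!: exI[of _ p])

lemma papprox_limit:
  assumes f: "subexp f" and g: "\<And>e. e > 0 \<Longrightarrow> \<exists>g. papprox m g \<and> wip m (\<lambda>x. f x - g x) (\<lambda>x. f x - g x) < e"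
  shows "papprox m f"
  unfolding papprox_def
proof (intro conjI allI impI f)
  fix e :: real assume e: "e > 0"
  then obtain g where g: "papprox m g" "wip m (\<lambda>x. f x - g x) (\<lambda>x. f x - g x) < e / 4" using assms(2)[of "e / 4"] by auto
  then obtain q where q: "wip m (\<lambda>x. g x - poly q x) (\<lambda>x. g x - poly q x) < e / 4" using e unfolding papprox_def by (metis zero_less_divide_iff zero_less_numeral)
  have og: "subexp g" using g by (simp add: papprox_def)
  have "wip m (\<lambda>x. (f x - g x) + (g x - poly q x)) (\<lambda>x. (f x - g x) + (g x - poly q x)) \<le>
     2 * wip m (\<lambda>x. f x - g x) (\<lambda>x. f x - g x) + 2 * wip m (\<lambda>x. g x - poly q x) (\<lambda>x. g x - poly q x)"
    by (rule wip_add_le) (intro subexp_diff f og subexp_poly)+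
  also have "\<dots> < e" using g q by linarith
  finally show "\<exists>q. wip m (\<lambda>x. f x - poly q x) (\<lambda>x. f x - poly q x) < e" by auto
qed

lemma papprox_add:
  assumes "papprox m f" "papprox m g"
  shows "papprox m (\<lambda>x. f x + g x)"
  unfolding papprox_def
proof (intro conjI allI impI)
  have of': "subexp f" and og: "subexp g" using assms by (auto simp: papprox_def)
  show "subexp (\<lambda>x. f x + g x)" by (rule subexp_add[OF of' og])
  fix e :: real assume e: "e > 0"
  then have e4: "e / 4 > 0" by simp
  obtain p where p: "wip m (\<lambda>x. f x - poly p x) (\<lambda>x. f x - poly p x) < e / 4" using assms(1) e4 unfolding papprox_def by blast
  obtain q where q: "wip m (\<lambda>x. g x - poly q x) (\<lambda>x. g x - poly q x) < e / 4" using assms(2) e4 unfolding papprox_def by blast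
  have "wip m (\<lambda>x. (f x - poly p x) + (g x - poly q x)) (\<lambda>x. (f x - poly p x) + (g x - poly q x)) \<le>
     2 * wip m (\<lambda>x. f x - poly p x) (\<lambda>x. f x - poly p x) + 2 * wip m (\<lambda>x. g x - poly q x) (\<lambda>x. g x - poly q x)"
    by (rule wip_add_le) (intro subexp_diff of' og subexp_poly)+
  also have "\<dots> < e" using p q by linarith
  finally show "\<exists>q. wip m (\<lambda>x. f x + g x - poly q x) (\<lambda>x. f x + g x - poly q x) < e"
    by (intro exI[of _ "p + q"]) (simp add: algebra_simps)
qed

lemma papprox_cmult:
  assumes "papprox m f"
  shows "papprox m (\<lambda>x. c * f x)"
  unfolding papprox_def
proof (intro conjI allI impI)
  have of': "subexp f" using assms by (auto simp: papprox_def)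
  show "subexp (\<lambda>x. c * f x)" by (rule subexp_cmult[OF of'])
  fix e :: real assume e: "e > 0"
  have coef: "0 < c * c + 1" using zero_le_square[of c] by linarith
  then have e4: "e / (c * c + 1) > 0" using e by simp
  obtain p where p: "wip m (\<lambda>x. f x - poly p x) (\<lambda>x. f x - poly p x) < e / (c * c + 1)" using assms(1) e4 unfolding papprox_def by blast
  have d: "subexp (\<lambda>x. f x - poly p x)" by (intro subexp_diff of' subexp_poly)
  let ?I = "wip m (\<lambda>x. f x - poly p x) (\<lambda>x. f x - poly p x)"
  have "wip m (\<lambda>x. c * (f x - poly p x)) (\<lambda>x. c * (f x - poly p x)) = c * c * ?I"
    using wip_cmult[OF d subexp_cmult[OF d], of m c c] wip_cmult[OF d d, of m c] wip_commute[of m "\<lambda>x. f x - poly p x" "\<lambda>x. c * (f x - poly p x)"]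
    by simp
  also have "\<dots> \<le> (c * c + 1) * ?I" using wip_nonneg[of m "\<lambda>x. f x - poly p x"] by (intro mult_right_mono) auto
  also have "\<dots> < e" using p coef by (simp add: pos_less_divide_eq mult.commute)
  finally show "\<exists>q. wip m (\<lambda>x. c * f x - poly q x) (\<lambda>x. c * f x - poly q x) < e"
    by (intro exI[of _ "smult c p"]) (simp add: algebra_simps)
qed

lemma papprox_sum: "(\<And>i. i \<in> A \<Longrightarrow> papprox m (f i)) \<Longrightarrow> papprox m (\<lambda>x. \<Sum>i\<in>A. f i x)"
  by (induction A rule: infinite_finite_induct) (use papprox_poly[of m 0] in \<open>auto simp: poly_0 [abs_def] intro: papprox_add\<close>)

lemma exp_taylor_bound:
  fixes y :: real
  assumes "y > 0" "0 < N"
  shows "\<bar>exp (- y) - (\<Sum>i<N. (- y) ^ i / fact i)\<bar> \<le> y ^ N / fact N"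
proof -
  have "\<exists>t. - y < t \<and> t < 0 \<and> exp (- y) = (\<Sum>i<N. exp 0 / fact i * (- y) ^ i) + exp t / fact N * (- y) ^ N"
    by (rule Maclaurin_minus[where diff = "\<lambda>_. exp"]) (use assms in \<open>auto intro!: derivative_eq_intros\<close>)
  then obtain t where t: "- y < t" "t < 0" "exp (- y) = (\<Sum>i<N. exp 0 / fact i * (- y) ^ i) + exp t / fact N * (- y) ^ N" by blast
  have "exp (- y) - (\<Sum>i<N. (- y) ^ i / fact i) = exp t / fact N * (- y) ^ N"
    unfolding t(3) by simp
  then have "\<bar>exp (- y) - (\<Sum>i<N. (- y) ^ i / fact i)\<bar> = exp t * (y ^ N / fact N)"
    using assms by (simp add: abs_mult power_abs)
  also have "\<dots> \<le> 1 * (y ^ N / fact N)" using t assms by (intro mult_right_mono) auto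
  finally show ?thesis by simp
qed

text \<open>Consecutive terms have ratio tending to 1/4; the crude bound 9/16 comes from 2n + b + 2
  <= 3(n + 1).\<close>

lemma factorial_ratio_tendsto_0:
  "(\<lambda>N. fact (2 * N + b) / (16 ^ N * (fact N * fact N)) :: real) \<longlonglongrightarrow> 0"
proof (rule summable_LIMSEQ_zero, rule summable_ratio_test[of "9 / 16" "b + 2"])
  fix n :: nat assume n: "b + 2 \<le> n"
  let ?f = "\<lambda>N. fact (2 * N + b) / (16 ^ N * (fact N * fact N)) :: real"
  have e: "2 * Suc n + b = Suc (Suc (2 * n + b))" by simp
  have "?f (Suc n) = (real (Suc (Suc (2 * n + b))) * real (Suc (2 * n + b))) / (16 * (real (Suc n) * real (Suc n))) * ?f n"
    unfolding e by (simp add: field_simps del: of_nat_Suc)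
  also have "\<dots> \<le> 9 / 16 * ?f n"
  proof (rule mult_right_mono)
    have "real (Suc (Suc (2 * n + b))) * real (Suc (2 * n + b)) \<le> (3 * real (Suc n)) * (3 * real (Suc n))"
      using n by (intro mult_mono) auto
    also have "\<dots> = 9 * (real (Suc n) * real (Suc n))" by (simp only: mult_ac)
    finally have "(real (Suc (Suc (2 * n + b))) * real (Suc (2 * n + b))) / (16 * (real (Suc n) * real (Suc n)))
       \<le> 9 * (real (Suc n) * real (Suc n)) / (16 * (real (Suc n) * real (Suc n)))"
      by (intro divide_right_mono) auto
    also have "\<dots> = 9 / 16" by (simp del: of_nat_Suc)
    finally show "(real (Suc (Suc (2 * n + b))) * real (Suc (2 * n + b))) / (16 * (real (Suc n) * real (Suc n))) \<le> 9 / 16" .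
  qed simp
  finally show "norm (?f (Suc n)) \<le> 9 / 16 * norm (?f n)" by simp
qed simp

lemma subexp_monom_exp: "subexp (\<lambda>x. x ^ a * exp (- (real j * x / 4)))"
proof -
  have "\<bar>x ^ a * exp (- (real j * x / 4))\<bar> \<le> (8 * real a) ^ a * exp (x / 8)" if x: "x > 0" for x :: real
  proof -
    have "\<bar>x ^ a * exp (- (real j * x / 4))\<bar> \<le> x ^ a * 1"
      using x by (simp add: abs_mult mult_left_le)
    then show ?thesis using power_le_exp[OF x, of a] by simp
  qed
  then show ?thesis unfolding subexp_def by auto
qed

text \<open>One factor e^(-x/4) is replaced by its Taylor polynomial of N terms; the squared error
  is at most (2N + 2a + m)! / (16^N N!^2), which tends to 0. The rate is raised in steps of 1/4
  because for a direct expansion of e^(-jx/4) the same bound grows like (j/2)^(2N) when j >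
  2.\<close>

lemma papprox_monom_exp: "papprox m (\<lambda>x. x ^ a * exp (- (real j * x / 4)))"
proof (induction j arbitrary: a)
  case 0
  show ?case using papprox_poly[of m "monom 1 a"] by (simp add: poly_monom [abs_def])
next
  case (Suc j)
  let ?f = "\<lambda>x. x ^ a * exp (- (real (Suc j) * x / 4))"
  define T where "T N x = (\<Sum>i<N. ((- 1 / 4) ^ i / fact i) * (x ^ (a + i) * exp (- (real j * x / 4))))" for N and x :: real
  have aT: "papprox m (T N)" for N unfolding T_def by (intro papprox_sum papprox_cmult Suc)
  have err: "wip m (\<lambda>x. ?f x - T N x) (\<lambda>x. ?f x - T N x) \<le> fact (2 * N + (2 * a + m)) / (16 ^ N * (fact N * fact N))"
    if N: "0 < N" for N
  proof -
    let ?c = "1 / (4 ^ N * fact N) :: real"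
    have b: "\<bar>?f x - T N x\<bar> \<le> \<bar>?c * x ^ (a + N)\<bar>" if x: "x > 0" for x
    proof -
      have "?f x = x ^ a * exp (- (real j * x / 4)) * exp (- (x / 4))"
        by (simp add: algebra_simps add_divide_distrib flip: exp_add)
      moreover have "T N x = x ^ a * exp (- (real j * x / 4)) * (\<Sum>i<N. (- (x / 4)) ^ i / fact i)"
        unfolding T_def sum_distrib_left
      proof (rule sum.cong[OF refl])
        fix i
        have "(- (x / 4)) ^ i = (- 1 / 4) ^ i * x ^ i" by (simp flip: power_mult_distrib)
        then show "((- 1 / 4) ^ i / fact i) * (x ^ (a + i) * exp (- (real j * x / 4))) =
           x ^ a * exp (- (real j * x / 4)) * ((- (x / 4)) ^ i / fact i)"
          by (simp add: power_add)
      qed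
      ultimately have "\<bar>?f x - T N x\<bar> = x ^ a * exp (- (real j * x / 4)) * \<bar>exp (- (x / 4)) - (\<Sum>i<N. (- (x / 4)) ^ i / fact i)\<bar>"
        using x by (simp add: abs_mult mult.assoc flip: right_diff_distrib)
      also have "\<dots> \<le> (x ^ a * 1) * ((x / 4) ^ N / fact N)"
        using x N by (intro mult_mono exp_taylor_bound) (auto simp: mult_left_le)
      also have "\<dots> = \<bar>?c * x ^ (a + N)\<bar>" using x by (simp add: power_divide power_add)
      finally show ?thesis .
    qed
    have "wip m (\<lambda>x. ?f x - T N x) (\<lambda>x. ?f x - T N x) \<le> wip m (\<lambda>x. ?c * x ^ (a + N)) (\<lambda>x. ?c * x ^ (a + N))"
      using aT[of N] by (intro wip_mono b subexp_diff subexp_monom_exp subexp_cmult subexp_monom) (auto simp: papprox_def)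
    also have "\<dots> = (\<integral>x. ?c * ?c * (indicator {0<..} x * (x ^ (2 * N + (2 * a + m)) * exp (- x))) \<partial>lborel)"
    proof -
      have "2 * N + (2 * a + m) = (a + N) + (a + N) + m" by simp
      then have "x ^ (2 * N + (2 * a + m)) = x ^ (a + N) * x ^ (a + N) * x ^ m" for x :: real
        by (simp only: power_add)
      then show ?thesis unfolding wip_def
        by (intro Bochner_Integration.integral_cong refl) (simp only: mult_ac)
    qed
    also have "\<dots> = ?c * ?c * fact (2 * N + (2 * a + m))"
      by (simp only: integral_mult_right_zero gamma_moment(2))
    also have "\<dots> = fact (2 * N + (2 * a + m)) / (16 ^ N * (fact N * fact N))"
      by (simp add: field_simps flip: power_mult_distrib)
    finally show ?thesis .
  qed
  show ?case
  proof (rule papprox_limit[OF subexp_monom_exp])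
    fix e :: real assume e: "e > 0"
    have "\<forall>\<^sub>F N in sequentially. fact (2 * N + (2 * a + m)) / (16 ^ N * (fact N * fact N)) < e"
      by (rule order_tendstoD(2)[OF factorial_ratio_tendsto_0 e])
    then have "\<forall>\<^sub>F N in sequentially. wip m (\<lambda>x. ?f x - T N x) (\<lambda>x. ?f x - T N x) < e"
      using eventually_gt_at_top[of 0] by eventually_elim (use err in \<open>auto intro: le_less_trans\<close>)
    then obtain N where "wip m (\<lambda>x. ?f x - T N x) (\<lambda>x. ?f x - T N x) < e"
      using eventually_happens by fastforce
    then show "\<exists>g. papprox m g \<and> wip m (\<lambda>x. ?f x - g x) (\<lambda>x. ?f x - g x) < e" using aT by blast
  qed
qed

text \<open>The substitution s = e^(-x/4) compactifies the half-line. F(s) = f(x) s is continuous on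
  [0,1] with F(0) = 0, since it is bounded by a multiple of s^(1/2). Weierstrass approximates F by a
  polynomial in s, and dividing by s gives a combination of the exponentials e^(-ix/4).\<close>

lemma papprox_continuous:
  assumes f: "subexp f" and c: "continuous_on {0..} f"
  shows "papprox m f"
proof (rule papprox_limit[OF f])
  obtain C where C: "\<And>x. x > 0 \<Longrightarrow> \<bar>f x\<bar> \<le> C * exp (x / 8)" using f by (auto simp: subexp_def)
  define F where "F s = (if s \<le> 0 then 0 else f (- 4 * ln s) * s)" for s :: real
  have contF: "continuous_on {0..1} F"
    unfolding continuous_on_eq_continuous_within
  proof
    fix s :: real assume s: "s \<in> {0..1}"
    show "continuous (at s within {0..1}) F"
    proof (cases "s = 0")
      case True
      have "((\<lambda>s. C * sqrt s) \<longlongrightarrow> C * sqrt 0) (at 0 within {0..1})"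
        by (intro tendsto_intros)
      then have 0: "((\<lambda>s. C * sqrt s) \<longlongrightarrow> 0) (at 0 within {0..1})" by simp
      have b: "norm (F x) \<le> C * sqrt x" if "x \<in> {0..1}" "x \<noteq> 0" "dist x 0 < 1" for x
      proof -
        have x: "0 < x" "x < 1" using that by auto
        have "\<bar>f (- 4 * ln x)\<bar> * x \<le> C * exp (- 4 * ln x / 8) * x"
          using C[of "- 4 * ln x"] x by (intro mult_right_mono) auto
        then have "\<bar>f (- 4 * ln x)\<bar> * x \<le> C * (exp (- 4 * ln x / 8) * x)" by (simp only: mult.assoc)
        also have "exp (- 4 * ln x / 8) * x = exp (- 4 * ln x / 8) * exp (ln x)" using x by simp
        also have "\<dots> = exp (1 / 2 * ln x)" by (simp only: exp_add [symmetric]) simp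
        also have "\<dots> = x powr (1 / 2)" using x by (simp only: powr_def) simp
        finally show ?thesis using x by (simp add: F_def abs_mult powr_half_sqrt mult.assoc)
      qed
      have "(F \<longlongrightarrow> 0) (at 0 within {0..1})"
      proof (rule Lim_null_comparison[OF _ 0])
        show "\<forall>\<^sub>F x in at 0 within {0..1}. norm (F x) \<le> C * sqrt x"
          unfolding eventually_at using b by (intro exI[of _ 1]) auto
      qed
      then show ?thesis using True by (simp add: continuous_within F_def)
    next
      case False
      then have s0: "0 < s" using s by auto
      have "continuous_on {0<..1} (\<lambda>s. f (- 4 * ln s) * s)"
        by (intro continuous_intros continuous_on_compose2[OF c]) auto
      then have "continuous_on {0<..1} F"
        by (rule continuous_on_eq) (auto simp: F_def)
      then have "continuous (at s within {0<..1}) F" using s s0 by (simp add: continuous_on_eq_continuous_within)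
      moreover have "at s within {0<..1} = at s within {0..1}"
        by (rule at_within_nhd[of s "{0<..}"]) (use s0 in auto)
      ultimately show ?thesis by simp
    qed
  qed
  define J where "J = (\<integral>x. indicator {0<..} x * (x ^ m * exp (- x / 2) :: real) \<partial>lborel)"
  have J0: "J \<ge> 0" unfolding J_def by (rule Bochner_Integration.integral_nonneg) (auto split: split_indicator)
  fix e :: real assume e: "e > 0"
  \<comment> \<open>The final error is 4 d J: the cap at 1 lets d * d be replaced by d, and J + 1
    keeps the quotient defined when J = 0.\<close>
  define d where "d = min 1 (e / (8 * (J + 1)))"
  have d: "d > 0" "d \<le> 1" "d \<le> e / (8 * (J + 1))" using e J0 by (auto simp: d_def)
  obtain N where N: "\<And>x. x \<in> {0..1} \<Longrightarrow> \<bar>F x - (\<Sum>k\<le>N. F (real k / real N) * Bernstein N k x)\<bar> < d"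
    using Bernstein_Weierstrass[OF contF d(1)] by blast
  define p where "p = (\<Sum>k\<le>N. smult (F (real k / real N) * real (N choose k)) (monom 1 k * [:1, -1:] ^ (N - k)))"
  have p: "\<bar>F x - poly p x\<bar> < d" if "x \<in> {0..1}" for x
    using N[OF that] by (simp add: p_def poly_sum poly_monom Bernstein_def mult.assoc)
  obtain c0 p' where pc: "p = pCons c0 p'" by (cases p) auto
  have c0: "\<bar>c0\<bar> < d" using p[of 0] by (simp add: F_def pc)
  define G where "G x = (\<Sum>i\<le>degree p'. coeff p' i * (x ^ 0 * exp (- (real i * x / 4))))" for x :: real
  have G: "G x = poly p' (exp (- x / 4))" for x
    unfolding G_def poly_altdef by (intro sum.cong refl) (simp flip: exp_of_nat_mult)
  have aG: "papprox m G" unfolding G_def by (intro papprox_sum papprox_cmult papprox_monom_exp)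
  then have oG: "subexp G" by (simp add: papprox_def)
  have b: "\<bar>f x - G x\<bar> \<le> 2 * d * exp (x / 4)" if x: "x > 0" for x
  proof -
    let ?s = "exp (- x / 4)"
    have "F ?s = f x * ?s" by (simp add: F_def not_le)
    moreover have "\<bar>F ?s - poly p ?s\<bar> < d" by (rule p) (use x in auto)
    ultimately have "\<bar>f x * ?s - (c0 + ?s * G x)\<bar> < d" by (simp add: pc G)
    then have "\<bar>f x * ?s - ?s * G x\<bar> \<le> 2 * d" using c0 by linarith
    moreover have "f x * ?s - ?s * G x = (f x - G x) * ?s" by (simp add: algebra_simps)
    ultimately have "\<bar>f x - G x\<bar> * ?s \<le> 2 * d" by (simp add: abs_mult)
    then have "\<bar>f x - G x\<bar> * ?s * exp (x / 4) \<le> 2 * d * exp (x / 4)" by (rule mult_right_mono) simp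
    then show ?thesis by (simp add: mult.assoc flip: exp_add)
  qed
  have "wip m (\<lambda>x. f x - G x) (\<lambda>x. f x - G x) \<le> (\<integral>x. (4 * d) * (indicator {0<..} x * (x ^ m * exp (- x / 2))) \<partial>lborel)"
    unfolding wip_def
  proof (rule integral_mono)
    show "integrable lborel (\<lambda>x. indicator {0<..} x * ((f x - G x) * (f x - G x) * (x ^ m * exp (- x))))"
      by (intro subexp_integrable subexp_diff f oG)
    show "integrable lborel (\<lambda>x. (4 * d) * (indicator {0<..} x * (x ^ m * exp (- x / 2)) :: real))"
      by (rule integrable_mult_right[OF integrable_pow_exp_half])
    fix x :: real
    show "indicator {0<..} x * ((f x - G x) * (f x - G x) * (x ^ m * exp (- x))) \<le> (4 * d) * (indicator {0<..} x * (x ^ m * exp (- x / 2)))"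
    proof (cases "x > 0")
      case True
      have "(f x - G x) * (f x - G x) = \<bar>f x - G x\<bar> * \<bar>f x - G x\<bar>" by simp
      also have "\<dots> \<le> (2 * d * exp (x / 4)) * (2 * d * exp (x / 4))"
        using b[OF True] d by (intro mult_mono) auto
      also have "\<dots> = 4 * (d * d) * (exp (x / 4) * exp (x / 4))" by (simp only: mult_ac)
      also have "exp (x / 4) * exp (x / 4) = exp (x / 2)" by (simp flip: exp_add)
      also have "4 * (d * d) * exp (x / 2) \<le> 4 * d * exp (x / 2)" using d by (simp add: mult_left_le)
      finally have "(f x - G x) * (f x - G x) * (x ^ m * exp (- x)) \<le> 4 * d * exp (x / 2) * (x ^ m * exp (- x))"
        by (rule mult_right_mono) (use True in simp)
      also have "\<dots> = 4 * d * (x ^ m * (exp (x / 2) * exp (- x)))" by (simp only: mult_ac)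
      also have "exp (x / 2) * exp (- x) = exp (- x / 2)" by (simp flip: exp_add)
      finally show ?thesis using True by simp
    qed simp
  qed
  also have "\<dots> = 4 * d * J" unfolding J_def by (rule integral_mult_right_zero)
  also have "\<dots> \<le> 4 * (e / (8 * (J + 1))) * J" using d J0 by (intro mult_right_mono) auto
  also have "\<dots> < e" using e J0 by (simp add: field_simps add_pos_nonneg)
  finally show "\<exists>g. papprox m g \<and> wip m (\<lambda>x. f x - g x) (\<lambda>x. f x - g x) < e" using aG by blast
qed

text \<open>The cutoff \<open>th n\<close> vanishes at 0 and at x0 and equals 1 eventually at every
  other point of the half-line. Hence f times the cutoff is continuous, and dominated convergence
  with majorant f^2 brings it close to f.\<close>

lemma papprox_piecewise:
  assumes f: "subexp f" and c: "\<And>x. x > 0 \<Longrightarrow> x \<noteq> x0 \<Longrightarrow> isCont f x" and x0: "x0 > 0"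
  shows "papprox m f"
proof (rule papprox_limit[OF f])
  obtain C where C: "\<And>x. x > 0 \<Longrightarrow> \<bar>f x\<bar> \<le> C * exp (x / 8)" using f by (auto simp: subexp_def)
  have [measurable]: "f \<in> borel_measurable borel" using f by (simp add: subexp_def)
  have C0: "C \<ge> 0"
    using order_trans[OF abs_ge_zero C[of 1]] by (simp add: zero_le_mult_iff)
  define th where "th n x = min 1 (real n * \<bar>x * (x - x0)\<bar>)" for n and x :: real
  define g where "g n x = (if x \<le> 0 then 0 else f x * th n x)" for n x
  have th: "0 \<le> th n x" "th n x \<le> 1" for n x by (auto simp: th_def)
  have thmeas [measurable]: "th n \<in> borel_measurable borel" for n unfolding th_def [abs_def] by measurable
  have gm [measurable]: "g n \<in> borel_measurable borel" for n unfolding g_def [abs_def] by measurable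
  have gle: "\<bar>g n x\<bar> \<le> \<bar>f x\<bar>" for n x using th[of n x] by (auto simp: g_def abs_mult mult_left_le)
  have og: "subexp (g n)" for n
    unfolding subexp_def using gle C by (auto intro!: exI[of _ C] order_trans[OF gle])
  have gb: "norm (g n x) \<le> C * exp (\<bar>x\<bar> / 8) * (real n * \<bar>x * (x - x0)\<bar>)" for n x
  proof (cases "x \<le> 0")
    case True
    then show ?thesis using C0 by (simp add: g_def)
  next
    case False
    have "\<bar>f x\<bar> * th n x \<le> (C * exp (\<bar>x\<bar> / 8)) * (real n * \<bar>x * (x - x0)\<bar>)"
      using False C[of x] C0 th[of n x] by (intro mult_mono) (auto simp: th_def)
    then show ?thesis using False th[of n x] by (simp add: g_def abs_mult)
  qed
  have ic0: "isCont (g n) a" if "a = 0 \<or> a = x0" for n a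
  proof -
    have g0: "g n a = 0" using that x0 by (auto simp: g_def th_def)
    have "((\<lambda>x. C * exp (\<bar>x\<bar> / 8) * (real n * \<bar>x * (x - x0)\<bar>)) \<longlongrightarrow> C * exp (\<bar>a\<bar> / 8) * (real n * \<bar>a * (a - x0)\<bar>)) (at a)"
      by (intro tendsto_intros) auto
    then have "((\<lambda>x. C * exp (\<bar>x\<bar> / 8) * (real n * \<bar>x * (x - x0)\<bar>)) \<longlongrightarrow> 0) (at a)" using that by auto
    then have "(g n \<longlongrightarrow> 0) (at a)" by (rule Lim_null_comparison[OF always_eventually[OF allI[OF gb]]])
    then show ?thesis by (simp add: isCont_def g0)
  qed
  have ic1: "isCont (g n) a" if a: "a > 0" "a \<noteq> x0" for n a
  proof -
    have "isCont (th n) a" unfolding th_def [abs_def] by (intro continuous_intros)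
    then have "isCont (\<lambda>x. f x * th n x) a" using c[OF a] by (intro continuous_mult)
    moreover have evt: "\<forall>\<^sub>F x in nhds a. f x * th n x = g n x"
    proof -
      have "\<forall>\<^sub>F x in nhds a. x \<in> {0<..}" by (rule eventually_nhds_in_open) (use a in auto)
      then show ?thesis by eventually_elim (auto simp: g_def)
    qed
    ultimately show ?thesis by (rule iffD1[OF isCont_cong, rotated])
  qed
  have cg: "continuous_on {0..} (g n)" for n
    by (rule continuous_at_imp_continuous_on) (use ic0 ic1 in \<open>metis atLeast_iff le_less\<close>)
  have ag: "papprox m (g n)" for n by (rule papprox_continuous[OF og cg])
  have "(\<lambda>n. wip m (\<lambda>x. f x - g n x) (\<lambda>x. f x - g n x)) \<longlonglongrightarrow> (\<integral>x. 0 \<partial>(lborel :: real measure))"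
    unfolding wip_def
  proof (rule integral_dominated_convergence)
    show "integrable lborel (\<lambda>x. indicator {0<..} x * (f x * f x * (x ^ m * exp (- x))))" by (rule subexp_integrable[OF f f])
    have "AE x in lborel. x \<noteq> x0" by (rule AE_lborel_singleton)
    then show "AE x in lborel. (\<lambda>n. indicator {0<..} x * ((f x - g n x) * (f x - g n x) * (x ^ m * exp (- x)))) \<longlonglongrightarrow> 0"
    proof eventually_elim
      case (elim x)
      show ?case
      proof (cases "x > 0")
        case True
        let ?y = "\<bar>x * (x - x0)\<bar>"
        have y: "?y > 0" using True elim by simp
        obtain M where M: "1 / ?y < real M" using reals_Archimedean2 by blast
        have "\<forall>n\<ge>M. g n x = f x"
        proof (intro allI impI)
          fix n assume "n \<ge> M"
          then have "1 / ?y \<le> real n" using M by linarith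
          then have "1 \<le> real n * ?y" using y by (simp add: pos_divide_le_eq)
          then show "g n x = f x" using True by (simp add: g_def th_def)
        qed
        then have "\<forall>\<^sub>F n in sequentially. g n x = f x" unfolding eventually_sequentially by blast
        then have "\<forall>\<^sub>F n in sequentially. indicator {0<..} x * ((f x - g n x) * (f x - g n x) * (x ^ m * exp (- x))) = 0"
          by eventually_elim simp
        then show ?thesis by (rule tendsto_eventually)
      qed simp
    qed
    show "AE x in lborel. norm (indicator {0<..} x * ((f x - g n x) * (f x - g n x) * (x ^ m * exp (- x)))) \<le>
      indicator {0<..} x * (f x * f x * (x ^ m * exp (- x)))" for n
    proof (rule AE_I2)
      fix x :: real
      show "norm (indicator {0<..} x * ((f x - g n x) * (f x - g n x) * (x ^ m * exp (- x)))) \<le>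
        indicator {0<..} x * (f x * f x * (x ^ m * exp (- x)))"
      proof (cases "x > 0")
        case True
        have "f x - g n x = f x * (1 - th n x)" using True by (simp add: g_def algebra_simps)
        then have "\<bar>f x - g n x\<bar> \<le> \<bar>f x\<bar>" using th[of n x] by (simp add: abs_mult mult_left_le)
        then have "(f x - g n x) * (f x - g n x) \<le> f x * f x" by (simp flip: power2_eq_square add: abs_le_square_iff)
        then show ?thesis using True by (simp add: abs_mult mult_right_mono)
      qed simp
    qed
  qed measurable
  then have lim: "(\<lambda>n. wip m (\<lambda>x. f x - g n x) (\<lambda>x. f x - g n x)) \<longlonglongrightarrow> 0" by simp
  fix e :: real assume e: "e > 0"
  have "\<forall>\<^sub>F n in sequentially. wip m (\<lambda>x. f x - g n x) (\<lambda>x. f x - g n x) < e" by (rule order_tendstoD(2)[OF lim e])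
  then obtain n where "wip m (\<lambda>x. f x - g n x) (\<lambda>x. f x - g n x) < e" using eventually_happens by fastforce
  then show "\<exists>g. papprox m g \<and> wip m (\<lambda>x. f x - g x) (\<lambda>x. f x - g x) < e" using ag by blast
qed

section \<open>Orthogonal expansions\<close>

lemma poly_in_span:
  fixes E :: "nat \<Rightarrow> real poly"
  assumes E: "\<And>n. degree (E n) = n" "\<And>n. E n \<noteq> 0"
  shows "(q = 0 \<or> degree q < N) \<Longrightarrow> \<exists>b. q = (\<Sum>n<N. smult (b n) (E n))"
proof (induction N arbitrary: q)
  case (Suc N)
  define c where "c = coeff q N / coeff (E N) N"
  have l: "coeff (E N) N \<noteq> 0" using E(1)[of N] E(2)[of N] by (metis leading_coeff_0_iff)
  let ?q = "q - smult c (E N)"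
  have cz: "coeff ?q i = 0" if "i \<ge> N" for i
  proof (cases "i = N")
    case False
    then have "coeff q i = 0" "coeff (E N) i = 0" using that Suc.prems E(1)[of N] by (auto intro: coeff_eq_0)
    then show ?thesis by simp
  qed (use l in \<open>simp add: c_def\<close>)
  have "?q = 0 \<or> degree ?q < N"
    using cz[of "degree ?q"] leading_coeff_0_iff[of ?q] not_less by blast
  then obtain b where b: "?q = (\<Sum>n<N. smult (b n) (E n))" using Suc.IH by blast
  have "q = (\<Sum>n<Suc N. smult ((b(N := c)) n) (E n))"
    using b by (simp add: algebra_simps)
  then show ?case by blast
qed simp

text \<open>The partial sum \<open>S N\<close> is the best approximation of f by polynomials of
  degree below N, so density forces the residual to 0, and \<open>wip_young\<close> transfers this
  to the pairing with g.\<close>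

lemma parseval:
  fixes E :: "nat \<Rightarrow> real poly"
  assumes E: "\<And>n. degree (E n) = n" "\<And>n. E n \<noteq> 0"
    and orth: "\<And>i j. i \<noteq> j \<Longrightarrow> wip m (poly (E i)) (poly (E j)) = 0"
    and f: "papprox m f" and g: "subexp g"
  shows "(\<lambda>N. \<Sum>n<N. wip m f (poly (E n)) * wip m g (poly (E n)) / wip m (poly (E n)) (poly (E n))) \<longlonglongrightarrow> wip m f g"
proof (rule LIMSEQ_I)
  have of': "subexp f" using f by (simp add: papprox_def)
  define h where "h n = wip m (poly (E n)) (poly (E n))" for n
  have h: "h n > 0" for n unfolding h_def by (rule wip_poly_pos[OF E(2)])
  define S where "S N x = (\<Sum>n<N. (wip m f (poly (E n)) / h n) * poly (E n) x)" for N x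
  have oS: "subexp (S N)" for N unfolding S_def [abs_def] by (intro subexp_sum subexp_cmult subexp_poly)
  have Sg: "wip m (S N) g' = (\<Sum>n<N. wip m f (poly (E n)) / h n * wip m (poly (E n)) g')" if "subexp g'" for N g'
    unfolding S_def [abs_def] by (rule wip_sum[OF that subexp_poly])
  have res: "wip m (\<lambda>x. f x - S N x) (poly (E i)) = 0" if "i < N" for i N
  proof -
    have "wip m (S N) (poly (E i)) = (\<Sum>n<N. if n = i then wip m f (poly (E i)) else 0)"
      unfolding Sg[OF subexp_poly]
      by (rule sum.cong) (use h orth in \<open>auto simp: h_def [symmetric] less_imp_neq[symmetric]\<close>)
    also have "\<dots> = wip m f (poly (E i))" using that by simp
    finally show ?thesis by (simp add: wip_diff[OF of' oS subexp_poly])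
  qed
  have best: "wip m (\<lambda>x. f x - S N x) (\<lambda>x. f x - S N x) \<le> wip m (\<lambda>x. f x - poly q x) (\<lambda>x. f x - poly q x)"
    if q: "q = 0 \<or> degree q < N" for q N
  proof -
    obtain b where b: "q = (\<Sum>n<N. smult (b n) (E n))" using poly_in_span[OF E q] by blast
    let ?u = "\<lambda>x. f x - S N x" and ?v = "\<lambda>x. \<Sum>n<N. (wip m f (poly (E n)) / h n - b n) * poly (E n) x"
    have ou: "subexp ?u" by (rule subexp_diff[OF of' oS])
    have ov: "subexp ?v" by (intro subexp_sum subexp_cmult subexp_poly)
    have vu: "wip m ?v ?u = 0"
      unfolding wip_sum[OF ou subexp_poly]
      by (rule sum.neutral) (use res in \<open>auto simp: wip_commute[of m "poly _"]\<close>)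
    have "f x - poly q x = 1 * ?u x + 1 * ?v x" for x
      unfolding b S_def by (simp add: poly_sum sum_subtractf algebra_simps)
    then have e: "(\<lambda>x. f x - poly q x) = (\<lambda>x. 1 * ?u x + 1 * ?v x)" by blast
    let ?w = "\<lambda>x. 1 * ?u x + 1 * ?v x"
    have 1: "wip m ?w ?w = 1 * wip m ?u ?w + 1 * wip m ?v ?w" by (rule wip_lincomb[OF ou ov subexp_lincomb[OF ou ov]])
    have 2: "wip m ?u ?w = 1 * wip m ?u ?u + 1 * wip m ?u ?v" by (rule wip_lincomb_right[OF ou ov ou])
    have 3: "wip m ?v ?w = 1 * wip m ?v ?u + 1 * wip m ?v ?v" by (rule wip_lincomb_right[OF ou ov ov])
    have "wip m ?w ?w = wip m ?u ?u + wip m ?v ?v"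
      unfolding 1 2 3 wip_commute[of m ?u ?v] vu by simp
    then show ?thesis unfolding e using wip_nonneg[of m ?v] by linarith
  qed
  fix e :: real assume e: "e > 0"
  \<comment> \<open>Balances the two terms of \<open>wip_young\<close>: d times the squared norm of
    g is below e, and the residual is made smaller than e * d, so twice the error is below 2
    e.\<close>
  define d where "d = e / (wip m g g + 1)"
  have conc: "wip m g g \<ge> 0" by (rule wip_nonneg)
  have d: "d > 0" "d * wip m g g < e" using e conc by (auto simp: d_def field_simps)
  have "e * d > 0" using e d by simp
  then obtain q where q: "wip m (\<lambda>x. f x - poly q x) (\<lambda>x. f x - poly q x) < e * d" using f unfolding papprox_def by blast
  show "\<exists>no. \<forall>N\<ge>no. norm ((\<Sum>n<N. wip m f (poly (E n)) * wip m g (poly (E n)) / wip m (poly (E n)) (poly (E n))) - wip m f g) < e"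
  proof (intro exI allI impI)
    fix N assume N: "Suc (degree q) \<le> N"
    let ?u = "\<lambda>x. f x - S N x"
    have "wip m ?u ?u < e * d" using best[of q N] N q by auto
    then have "wip m ?u ?u / d < e" using d by (simp add: pos_divide_less_eq)
    then have "2 * \<bar>wip m ?u g\<bar> < 2 * e"
      using wip_young[OF subexp_diff[OF of' oS] g d(1), of m N] d(2) by linarith
    moreover have "wip m ?u g = wip m f g - (\<Sum>n<N. wip m f (poly (E n)) * wip m g (poly (E n)) / wip m (poly (E n)) (poly (E n)))"
      unfolding wip_diff[OF of' oS g] Sg[OF g] h_def unfolding wip_commute[of m _ g] by simp
    ultimately show "norm ((\<Sum>n<N. wip m f (poly (E n)) * wip m g (poly (E n)) / wip m (poly (E n)) (poly (E n))) - wip m f g) < e"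
      by (simp add: abs_minus_commute)
  qed
qed

section \<open>Glued eigenfunctions\<close>

lemma taylor_bound_at_0:
  fixes f :: "nat \<Rightarrow> real \<Rightarrow> real"
  assumes f: "\<And>j x. (f j has_real_derivative f (Suc j) x) (at x)" and z: "\<And>j. j < M \<Longrightarrow> f j 0 = 0"
  shows "\<exists>C. \<forall>x. 0 \<le> x \<and> x \<le> b \<longrightarrow> \<bar>f 0 x\<bar> \<le> C * x ^ M"
proof (cases "0 \<le> b")
  case True
  have "continuous_on {0..b} (f M)"
    by (rule DERIV_continuous_on) (rule has_field_derivative_at_within[OF f])
  then have "bounded (f M ` {0..b})" by (intro compact_imp_bounded compact_continuous_image) auto
  then obtain B where "\<forall>y\<in>f M ` {0..b}. norm y \<le> B" unfolding bounded_iff by blast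
  then have B: "\<And>x. x \<in> {0..b} \<Longrightarrow> \<bar>f M x\<bar> \<le> B" by simp
  have B0: "0 \<le> B" using B[of 0] True by auto
  have "\<bar>f 0 x\<bar> \<le> B * x ^ M" if x: "0 \<le> x" "x \<le> b" for x
  proof (cases "M = 0 \<or> x = 0")
    case True
    then show ?thesis using B[of x] x z B0 by (auto simp: power_0_left)
  next
    case False
    have "\<exists>t. 0 < t \<and> t < x \<and> f 0 x = (\<Sum>i<M. f i 0 / fact i * x ^ i) + f M t / fact M * x ^ M"
      by (rule Maclaurin) (use False x in \<open>auto intro: f\<close>)
    then obtain t where t: "0 < t" "t < x" "f 0 x = (\<Sum>i<M. f i 0 / fact i * x ^ i) + f M t / fact M * x ^ M" by blast
    have "(\<Sum>i<M. f i 0 / fact i * x ^ i) = 0" by (rule sum.neutral) (auto simp: z)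
    then have "\<bar>f 0 x\<bar> = \<bar>f M t\<bar> / fact M * x ^ M" using t(3) x by (simp add: abs_mult)
    also have "\<dots> \<le> B * x ^ M"
    proof (rule mult_right_mono)
      have "\<bar>f M t\<bar> / fact M \<le> \<bar>f M t\<bar> / 1" by (rule divide_left_mono) auto
      also have "\<dots> \<le> B" using B[of t] t x by auto
      finally show "\<bar>f M t\<bar> / fact M \<le> B" .
    qed (use x in auto)
    finally show ?thesis .
  qed
  then show ?thesis by blast
qed auto

text \<open>At x = 0 the equation is the recurrence (j + 1 - m) f_(j+1) = (j - l) f_j, whose left
  coefficient is nonzero until j = m - 1: the exponents at the origin are 0 and m.\<close>

lemma eigjet_vanish_at_0:
  assumes f: "eigjet m l f" "f 0 0 = 0"
  shows "j < m \<Longrightarrow> f j 0 = 0"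
proof (induction j)
  case (Suc j)
  have "(real j + 1 - real m) * f (Suc j) 0 = 0"
    using eigjet_ode[OF f(1), of j 0] Suc by simp
  moreover have "real j + 1 - real m \<noteq> 0" using Suc.prems by linarith
  ultimately show ?case by simp
qed (use f(2) in simp)

lemma eigjet_isCont: "eigjet m l f \<Longrightarrow> isCont (f j) x"
  using DERIV_isCont eigjet_deriv by blast

lemma jets_zero_on_interval:
  fixes G :: "nat \<Rightarrow> real \<Rightarrow> real"
  assumes d: "\<And>j x. (G j has_real_derivative G (Suc j) x) (at x)" and ab: "a < b"
    and z: "\<And>x. a < x \<Longrightarrow> x < b \<Longrightarrow> G 0 x = 0"
  shows "G j a = 0" "G j b = 0"
proof -
  have i: "\<forall>x\<in>{a<..<b}. G j x = 0"
  proof (induction j)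
    case (Suc j)
    show ?case
    proof
      fix x assume x: "x \<in> {a<..<b}"
      have "\<forall>\<^sub>F y in nhds x. y \<in> {a<..<b}" by (rule eventually_nhds_in_open) (use x in auto)
      then have "\<forall>\<^sub>F y in nhds x. G j y = (\<lambda>_. 0) y" by eventually_elim (use Suc in auto)
      then have "((\<lambda>_. 0) has_real_derivative G (Suc j) x) (at x)"
        by (rule iffD1[OF DERIV_cong_ev[OF refl _ refl] d])
      then show "G (Suc j) x = 0" using DERIV_const DERIV_unique by blast
    qed
  qed (use z in auto)
  have c: "isCont (G j) x" for x using DERIV_isCont[OF d] .
  have "(G j \<longlongrightarrow> G j a) (at_right a)" using c[of a] unfolding isCont_def by (auto intro: tendsto_within_subset)
  moreover have "\<forall>\<^sub>F x in at_right a. G j x = 0"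
    unfolding eventually_at_right_field using i ab by (intro exI[of _ b]) auto
  then have "(G j \<longlongrightarrow> 0) (at_right a)" by (rule tendsto_eventually)
  ultimately show "G j a = 0" using tendsto_unique by (metis trivial_limit_at_right_real)
  have "(G j \<longlongrightarrow> G j b) (at_left b)" using c[of b] unfolding isCont_def by (auto intro: tendsto_within_subset)
  moreover have "\<forall>\<^sub>F x in at_left b. G j x = 0"
    unfolding eventually_at_left_field using i ab by (intro exI[of _ a]) auto
  then have "(G j \<longlongrightarrow> 0) (at_left b)" by (rule tendsto_eventually)
  ultimately show "G j b = 0" using tendsto_unique by (metis trivial_limit_at_left_real)
qed

text \<open>These conditions kill the boundary terms of Green's formula at the two ends: vanishing
  of order m handles 0, polynomial growth handles infinity.\<close>

definition goodpair :: "nat \<Rightarrow> real \<Rightarrow> (nat \<Rightarrow> real \<Rightarrow> real) \<Rightarrow> (nat \<Rightarrow> real \<Rightarrow> real) \<Rightarrow> bool" where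
  "goodpair m lam l r \<longleftrightarrow> eigjet m lam l \<and> eigjet m lam r \<and> (\<forall>j<m. l j 0 = 0) \<and>
     (\<exists>p. \<forall>j x. r j x = poly ((pderiv ^^ j) p) x)"

text \<open>Division by $x^m$ turns the weight $x^{-m}e^{-x}$ into the integrable weight $x^m e^{-x}$.\<close>

definition glued :: "nat \<Rightarrow> real \<Rightarrow> (nat \<Rightarrow> real \<Rightarrow> real) \<Rightarrow> (nat \<Rightarrow> real \<Rightarrow> real) \<Rightarrow> real \<Rightarrow> real" where
  "glued m x0 l r x = (if x \<le> 0 then 0 else if x < x0 then l 0 x / x ^ m else r 0 x / x ^ m)"

lemma subexp_glued:
  assumes g: "goodpair m lam l r" and x0: "x0 > 0"
  shows "subexp (glued m x0 l r)"
proof -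
  have l: "eigjet m lam l" and r: "eigjet m lam r" using g by (auto simp: goodpair_def)
  have "continuous_on UNIV (l 0)" "continuous_on UNIV (r 0)"
    by (auto intro!: continuous_at_imp_continuous_on eigjet_isCont[OF l] eigjet_isCont[OF r])
  then have [measurable]: "l 0 \<in> borel_measurable borel" "r 0 \<in> borel_measurable borel"
    by (auto intro: borel_measurable_continuous_onI)
  have meas: "glued m x0 l r \<in> borel_measurable borel" unfolding glued_def [abs_def] by measurable
  obtain C where C: "\<And>x. 0 \<le> x \<Longrightarrow> x \<le> x0 \<Longrightarrow> \<bar>l 0 x\<bar> \<le> C * x ^ m"
    using taylor_bound_at_0[of l m x0] eigjet_deriv[OF l] g unfolding goodpair_def by blast
  obtain p where p: "\<And>x. r 0 x = poly p x" using g unfolding goodpair_def by (metis funpow_0)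
  obtain D where D: "\<And>x. x > 0 \<Longrightarrow> \<bar>poly p x\<bar> \<le> D * exp (x / 8)" using subexp_poly[of p] by (auto simp: subexp_def)
  have D0: "D \<ge> 0" using order_trans[OF abs_ge_zero D[of 1]] by (simp add: zero_le_mult_iff)
  have C0: "C \<ge> 0" using order_trans[OF abs_ge_zero C[of x0]] x0 zero_less_power[OF x0, of m]
    by (auto simp: zero_le_mult_iff simp del: zero_less_power)
  have "\<bar>glued m x0 l r x\<bar> \<le> (C + D / x0 ^ m) * exp (x / 8)" if x: "x > 0" for x
  proof (cases "x < x0")
    case True
    have "\<bar>l 0 x\<bar> / x ^ m \<le> C" using C[of x] x True by (simp add: pos_divide_le_eq)
    also have "\<dots> \<le> C * exp (x / 8)" using C0 x by (simp add: mult_left_le mult_le_cancel_left1)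
    also have "\<dots> \<le> (C + D / x0 ^ m) * exp (x / 8)" using D0 x0 by (intro mult_right_mono) auto
    finally show ?thesis using x True by (simp add: glued_def abs_divide)
  next
    case False
    have "\<bar>poly p x\<bar> / x ^ m \<le> (D * exp (x / 8)) / x0 ^ m"
      using False x0 x D[OF x] D0 by (intro frac_le power_mono) auto
    also have "\<dots> \<le> (C + D / x0 ^ m) * exp (x / 8)" using C0 by (simp add: algebra_simps)
    finally show ?thesis using x False by (simp add: glued_def abs_divide p)
  qed
  then show ?thesis using meas by (auto simp: subexp_def)
qed

lemma isCont_glued:
  assumes g: "goodpair m lam l r" and x: "x > 0" "x \<noteq> x0"
  shows "isCont (glued m x0 l r) x"
proof (cases "x < x0")
  case True
  have "\<forall>\<^sub>F y in nhds x. y \<in> {0<..<x0}" by (rule eventually_nhds_in_open) (use x True in auto)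
  then have ev: "\<forall>\<^sub>F y in nhds x. l 0 y / y ^ m = glued m x0 l r y" by eventually_elim (auto simp: glued_def)
  have "isCont (\<lambda>y. l 0 y / y ^ m) x"
    using g x by (intro continuous_intros eigjet_isCont) (auto simp: goodpair_def)
  then show ?thesis by (rule iffD1[OF isCont_cong[OF ev]])
next
  case False
  have "\<forall>\<^sub>F y in nhds x. y \<in> {max 0 x0<..}" by (rule eventually_nhds_in_open) (use x False in auto)
  then have ev: "\<forall>\<^sub>F y in nhds x. r 0 y / y ^ m = glued m x0 l r y" by eventually_elim (auto simp: glued_def)
  have "isCont (\<lambda>y. r 0 y / y ^ m) x"
    using g x by (intro continuous_intros eigjet_isCont) (auto simp: goodpair_def)
  then show ?thesis by (rule iffD1[OF isCont_cong[OF ev]])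
qed

lemma papprox_glued:
  assumes "goodpair m lam l r" "x0 > 0"
  shows "papprox m (glued m x0 l r)"
  by (rule papprox_piecewise[OF subexp_glued[OF assms] isCont_glued[OF assms(1)] assms(2)])

lemma powr_eq_divide: "x > 0 \<Longrightarrow> x powr (- real m) = 1 / x ^ m" "x > 0 \<Longrightarrow> x powr (1 - real m) = x / x ^ m"
  by (simp_all add: powr_diff powr_minus powr_realpow inverse_eq_divide)

lemma tendsto_div_power_0:
  assumes l: "eigjet m lam l" and z: "\<And>j. j < m \<Longrightarrow> l j 0 = 0"
  shows "((\<lambda>x. x powr (1 - real m) * l 0 x) \<longlongrightarrow> 0) (at_right 0)"
proof -
  obtain C where C: "\<And>x. 0 \<le> x \<Longrightarrow> x \<le> 1 \<Longrightarrow> \<bar>l 0 x\<bar> \<le> C * x ^ m"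
    using taylor_bound_at_0[of l m 1] eigjet_deriv[OF l] z by blast
  have "((\<lambda>x. C * x) \<longlongrightarrow> C * 0) (at_right (0 :: real))" by (intro tendsto_intros)
  then have 0: "((\<lambda>x. C * x) \<longlongrightarrow> 0) (at_right (0 :: real))" by simp
  show ?thesis
  proof (rule Lim_null_comparison[OF _ 0])
    have "norm (x powr (1 - real m) * l 0 x) \<le> C * x" if x: "0 < x" "x < 1" for x
    proof -
      have "norm (x powr (1 - real m) * l 0 x) = (x / x ^ m) * \<bar>l 0 x\<bar>"
        using x by (simp add: abs_mult powr_eq_divide)
      also have "\<dots> \<le> (x / x ^ m) * (C * x ^ m)" using C[of x] x by (intro mult_left_mono) auto
      also have "\<dots> = C * x" using x by simp
      finally show ?thesis .
    qed
    then show "\<forall>\<^sub>F x in at_right 0. norm (x powr (1 - real m) * l 0 x) \<le> C * x"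
      unfolding eventually_at_right_field by (intro exI[of _ 1]) auto
  qed
qed

lemma wr_tendsto_0:
  assumes l: "eigjet m lam l" "\<And>j. j < m \<Longrightarrow> l j 0 = 0" and k: "eigjet m mu k" "\<And>j. j < m \<Longrightarrow> k j 0 = 0"
  shows "(wr m l k \<longlongrightarrow> 0) (at_right 0)"
proof -
  have t: "(f j \<longlongrightarrow> f j 0) (at_right 0)" if "eigjet m nu f" for nu f and j :: nat
    using eigjet_isCont[OF that, where j = j and x = 0] unfolding isCont_def by (auto intro: tendsto_within_subset)
  have "((\<lambda>x. exp (- x) * ((x powr (1 - real m) * l 0 x) * k 1 x - (x powr (1 - real m) * k 0 x) * l 1 x))
     \<longlongrightarrow> exp (- 0) * (0 * k 1 0 - 0 * l 1 0)) (at_right 0)"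
    by (intro tendsto_mult tendsto_diff tendsto_exp tendsto_minus tendsto_ident_at tendsto_div_power_0[OF l]
        tendsto_div_power_0[OF k] t[OF l(1)] t[OF k(1)])
  then show ?thesis by (simp add: wr_def [abs_def] algebra_simps)
qed

lemma wr_poly_tendsto_0:
  assumes m: "m > 0" and r: "\<And>j x. r j x = poly ((pderiv ^^ j) p) x" and k: "\<And>j x. k j x = poly ((pderiv ^^ j) q) x"
  shows "(wr m r k \<longlongrightarrow> 0) at_top"
proof -
  let ?R = "p * pderiv q - pderiv p * q"
  have 0: "((\<lambda>x. \<bar>poly ?R x * exp (- x)\<bar>) \<longlongrightarrow> 0) at_top"
    using tendsto_rabs[OF tendsto_poly_exp_0[of ?R]] by simp
  show ?thesis
  proof (rule Lim_null_comparison[OF _ 0])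
    have "norm (wr m r k x) \<le> \<bar>poly ?R x * exp (- x)\<bar>" if x: "x \<ge> 1" for x
    proof -
      have "x powr (1 - real m) \<le> x powr 0" by (rule powr_mono) (use x m in auto)
      then have "x powr (1 - real m) \<le> 1" using x by simp
      then have "x powr (1 - real m) * \<bar>poly ?R x * exp (- x)\<bar> \<le> 1 * \<bar>poly ?R x * exp (- x)\<bar>"
        by (rule mult_right_mono) simp
      then show ?thesis using x by (simp add: wr_def r k abs_mult mult_ac)
    qed
    then show "\<forall>\<^sub>F x in at_top. norm (wr m r k x) \<le> \<bar>poly ?R x * exp (- x)\<bar>"
      unfolding eventually_at_top_linorder by blast
  qed
qed

text \<open>Green's formula: Lagrange's identity is integrated over (0, x0) and over (x0, infinity).
  The outer boundary terms vanish, and the jump of the weighted Wronskian at x0 remains.\<close>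

lemma wip_glued:
  assumes g: "goodpair m lam l r" and h: "goodpair m mu l' r'" and x0: "x0 > 0" and m: "m > 0"
  shows "(lam - mu) * wip m (glued m x0 l r) (glued m x0 l' r') = wr m l l' x0 - wr m r r' x0"
proof -
  have l: "eigjet m lam l" "\<And>j. j < m \<Longrightarrow> l j 0 = 0" and r: "eigjet m lam r"
    and l': "eigjet m mu l'" "\<And>j. j < m \<Longrightarrow> l' j 0 = 0" and r': "eigjet m mu r'"
    using g h by (auto simp: goodpair_def)
  obtain p q where p: "\<And>j x. r j x = poly ((pderiv ^^ j) p) x" and q: "\<And>j x. r' j x = poly ((pderiv ^^ j) q) x"
    using g h unfolding goodpair_def by blast
  let ?H = "\<lambda>x. indicator {0<..} x * (glued m x0 l r x * glued m x0 l' r' x * (x ^ m * exp (- x)))"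
  define fl where "fl x = (lam - mu) * (x powr (- real m) * exp (- x)) * l 0 x * l' 0 x" for x
  define fr where "fr x = (lam - mu) * (x powr (- real m) * exp (- x)) * r 0 x * r' 0 x" for x
  have H: "integrable lborel ?H" by (rule subexp_integrable[OF subexp_glued[OF g x0] subexp_glued[OF h x0]])
  have el: "einterval 0 (ereal x0) = {0<..<x0}" by (auto simp: einterval_def)
  have er: "einterval (ereal x0) \<infinity> = {x0<..}" by (auto simp: einterval_def)
  have eqL: "indicator {0<..<x0} x *\<^sub>R fl x = (lam - mu) * (indicator {0<..<x0} x *\<^sub>R ?H x)" for x
    by (auto simp: fl_def glued_def powr_eq_divide split: split_indicator)
  have eqR: "indicator {x0<..} x *\<^sub>R fr x = (lam - mu) * (indicator {x0<..} x *\<^sub>R ?H x)" for x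
    using x0 by (auto simp: fr_def glued_def powr_eq_divide split: split_indicator)
  have IL: "integrable lborel (\<lambda>x. indicator {0<..<x0} x *\<^sub>R ?H x)"
    by (rule integrable_mult_indicator[OF _ H]) simp
  have IR: "integrable lborel (\<lambda>x. indicator {x0<..} x *\<^sub>R ?H x)"
    by (rule integrable_mult_indicator[OF _ H]) simp
  have split: "wip m (glued m x0 l r) (glued m x0 l' r') =
    (\<integral>x. indicator {0<..<x0} x *\<^sub>R ?H x \<partial>lborel) + (\<integral>x. indicator {x0<..} x *\<^sub>R ?H x \<partial>lborel)"
  proof -
    have "wip m (glued m x0 l r) (glued m x0 l' r') = (\<integral>x. indicator {0<..<x0} x *\<^sub>R ?H x + indicator {x0<..} x *\<^sub>R ?H x \<partial>lborel)"
      unfolding wip_def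
    proof (rule integral_cong_AE)
      show "?H \<in> borel_measurable lborel" using H by auto
      show "(\<lambda>x. indicator {0<..<x0} x *\<^sub>R ?H x + indicator {x0<..} x *\<^sub>R ?H x) \<in> borel_measurable lborel"
        using IL IR by (intro borel_measurable_add) auto
      have "AE x in lborel. x \<noteq> x0" by (rule AE_lborel_singleton)
      then show "AE x in lborel. ?H x = indicator {0<..<x0} x *\<^sub>R ?H x + indicator {x0<..} x *\<^sub>R ?H x"
        by eventually_elim (use x0 in \<open>auto split: split_indicator\<close>)
    qed
    also have "\<dots> = (\<integral>x. indicator {0<..<x0} x *\<^sub>R ?H x \<partial>lborel) + (\<integral>x. indicator {x0<..} x *\<^sub>R ?H x \<partial>lborel)"
      by (rule Bochner_Integration.integral_add[OF IL IR])
    finally show ?thesis .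
  qed
  have "(LBINT x=0..ereal x0. fl x) = wr m l l' x0 - 0"
  proof (rule interval_integral_FTC_integrable)
    show "0 < ereal x0" using x0 by simp
    show "(wr m l l' has_vector_derivative fl x) (at x)" if "0 < ereal x" for x
      using wr_deriv[OF l(1) l'(1), of x] that by (simp add: fl_def has_real_derivative_iff_has_vector_derivative)
    show "isCont fl x" if "0 < ereal x" for x
      unfolding fl_def [abs_def] using that by (intro continuous_intros eigjet_isCont[OF l(1)] eigjet_isCont[OF l'(1)]) auto
    show "set_integrable lborel (einterval 0 (ereal x0)) fl"
      unfolding set_integrable_def el eqL by (rule integrable_mult_right[OF IL])
    show "((wr m l l' \<circ> real_of_ereal) \<longlongrightarrow> 0) (at_right 0)"
      unfolding zero_ereal_def ereal_tendsto_simps by (rule wr_tendsto_0[OF l l'])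
    have "isCont (wr m l l') x0" using DERIV_isCont[OF wr_deriv[OF l(1) l'(1) x0]] .
    then show "((wr m l l' \<circ> real_of_ereal) \<longlongrightarrow> wr m l l' x0) (at_left (ereal x0))"
      unfolding ereal_tendsto_simps isCont_def by (auto intro: tendsto_within_subset)
  qed
  then have L: "(lam - mu) * (\<integral>x. indicator {0<..<x0} x *\<^sub>R ?H x \<partial>lborel) = wr m l l' x0"
    unfolding interval_lebesgue_integral_le_eq[OF less_imp_le[OF ereal_less(2)[THEN iffD2, OF x0]]]
      set_lebesgue_integral_def el eqL by simp
  have "(LBINT x=ereal x0..\<infinity>. fr x) = 0 - wr m r r' x0"
  proof (rule interval_integral_FTC_integrable)
    show "ereal x0 < \<infinity>" by simp
    show "(wr m r r' has_vector_derivative fr x) (at x)" if "ereal x0 < ereal x" for x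
      using wr_deriv[OF r r', of x] that x0 by (simp add: fr_def has_real_derivative_iff_has_vector_derivative)
    show "isCont fr x" if "ereal x0 < ereal x" for x
      unfolding fr_def [abs_def] using that x0 by (intro continuous_intros eigjet_isCont[OF r] eigjet_isCont[OF r']) auto
    show "set_integrable lborel (einterval (ereal x0) \<infinity>) fr"
      unfolding set_integrable_def er eqR by (rule integrable_mult_right[OF IR])
    have "isCont (wr m r r') x0" using DERIV_isCont[OF wr_deriv[OF r r' x0]] .
    then show "((wr m r r' \<circ> real_of_ereal) \<longlongrightarrow> wr m r r' x0) (at_right (ereal x0))"
      unfolding ereal_tendsto_simps isCont_def by (auto intro: tendsto_within_subset)
    show "((wr m r r' \<circ> real_of_ereal) \<longlongrightarrow> 0) (at_left \<infinity>)"
      unfolding ereal_tendsto_simps by (rule wr_poly_tendsto_0[OF m p q])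
  qed
  then have R: "(lam - mu) * (\<integral>x. indicator {x0<..} x *\<^sub>R ?H x \<partial>lborel) = - wr m r r' x0"
    unfolding interval_integral_to_infinity_eq set_lebesgue_integral_def eqR by simp
  show ?thesis unfolding split using L R by (simp add: distrib_left)
qed

section \<open>Sufficiency of admissibility on the open half-line\<close>

lemma higher_pderiv_minus: "(pderiv ^^ j) (- p) = - ((pderiv ^^ j) p)" for p :: "real poly"
  by (induction j) (simp_all add: pderiv_minus)

lemma higher_pderiv_diff: "(pderiv ^^ j) (p - q) = (pderiv ^^ j) p - (pderiv ^^ j) q" for p :: "real poly"
  by (induction j) (simp_all add: pderiv_diff)

lemma higher_pderiv_zero: "(pderiv ^^ j) 0 = (0 :: real poly)"
  by (induction j) simp_all

lemma higher_pderiv_degree_nonzero: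
  fixes p :: "real poly"
  assumes "p \<noteq> 0"
  shows "poly ((pderiv ^^ degree p) p) x \<noteq> 0"
proof -
  have "degree ((pderiv ^^ degree p) p) = 0" by (simp add: degree_higher_pderiv)
  then obtain a where a: "(pderiv ^^ degree p) p = [:a:]" by (metis degree_eq_zeroE)
  have "coeff ((pderiv ^^ degree p) p) 0 \<noteq> 0"
    using assms by (simp add: coeff_higher_pderiv pochhammer_fact [symmetric])
  then show ?thesis by (simp add: a)
qed

lemma polyjet_nonzero: "\<exists>j. polyjet m f j x \<noteq> 0"
  using higher_pderiv_degree_nonzero[of "laguerre_poly f (- real m)" x] unfolding polyjet_def by auto

text \<open>Raising the parameter subtracts a derivative. If L_f^(j-m)(-x) were zero for all j, all
  derivatives of L_f^(-m) would vanish at -x, including the f-th, which is a nonzero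
  constant.\<close>

lemma expjet_nonzero: "\<exists>j. expjet m f j x \<noteq> 0"
proof (rule ccontr)
  assume "\<not> (\<exists>j. expjet m f j x \<noteq> 0)"
  then have z: "poly (laguerre_poly f (real j - real m)) (- x) = 0" for j by (simp add: expjet_def)
  have "\<forall>j. poly ((pderiv ^^ i) (laguerre_poly f (real j - real m))) (- x) = 0" for i
  proof (induction i)
    case (Suc i)
    show ?case
    proof
      fix j
      let ?a = "real j - real m"
      have "pderiv (laguerre_poly f ?a) = laguerre_poly f ?a - laguerre_poly f (real (Suc j) - real m)"
        using laguerre_poly_Suc_param[of f ?a] by (simp add: algebra_simps)
      then have "(pderiv ^^ Suc i) (laguerre_poly f ?a) = (pderiv ^^ i) (laguerre_poly f ?a) - (pderiv ^^ i) (laguerre_poly f (real (Suc j) - real m))"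
        by (simp add: funpow_swap1 higher_pderiv_diff del: of_nat_Suc)
      then show "poly ((pderiv ^^ Suc i) (laguerre_poly f ?a)) (- x) = 0" using Suc by (simp del: of_nat_Suc)
    qed
  qed (use z in simp)
  then have "poly ((pderiv ^^ f) (laguerre_poly f (real 0 - real m))) (- x) = 0" by blast
  then show False
    using higher_pderiv_degree_nonzero[of "laguerre_poly f (real 0 - real m)" "- x"]
    by (metis degree_laguerre_poly laguerre_poly_nonzero)
qed

lemma seed_nonzero: "\<exists>j. seed m s j x \<noteq> 0"
  by (cases s) (auto simp: polyjet_nonzero expjet_nonzero)

text \<open>The multiple of L_n^(-m) that must be subtracted from the exponential solution with the
  same eigenvalue n to get value 0, hence a zero of order m, at the origin.\<close>

definition partner :: "nat \<Rightarrow> nat \<Rightarrow> real" where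
  "partner m n = expjet m (m - 1 - n) 0 0 / polyjet m n 0 0"

text \<open>High seeds already vanish to order m at 0 and stay on the left; a low polynomial seed
  goes entirely to the right; a low exponential seed is corrected by its polynomial partner on both
  sides. The signs make each seed equal to left minus right, and no exponential reaches the right
  side, where decay at infinity is needed.\<close>

definition lpart :: "nat \<Rightarrow> nat + nat \<Rightarrow> nat \<Rightarrow> real \<Rightarrow> real" where
  "lpart m s = (case s of Inl f \<Rightarrow> if m \<le> f then polyjet m f else (\<lambda>j x. 0)
     | Inr f \<Rightarrow> if m \<le> f then expjet m f else (\<lambda>j x. expjet m f j x - partner m (m - 1 - f) * polyjet m (m - 1 - f) j x))"

definition rpart :: "nat \<Rightarrow> nat + nat \<Rightarrow> nat \<Rightarrow> real \<Rightarrow> real" where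
  "rpart m s = (case s of Inl f \<Rightarrow> if m \<le> f then (\<lambda>j x. 0) else (\<lambda>j x. - polyjet m f j x)
     | Inr f \<Rightarrow> if m \<le> f then (\<lambda>j x. 0) else (\<lambda>j x. - partner m (m - 1 - f) * polyjet m (m - 1 - f) j x))"

lemma seed_eq_diff: "seed m s j x = lpart m s j x - rpart m s j x"
  by (cases s) (auto simp: lpart_def rpart_def)

lemma polyjet_at_0_nonzero: "n < m \<Longrightarrow> polyjet m n 0 0 \<noteq> 0"
  using laguerre_poly_at_0_sign[of n m] by (auto simp: polyjet_def)

lemma ev_Inr_low: "f < m \<Longrightarrow> ev m (Inr f) = real (m - 1 - f)"
  by (simp add: of_nat_diff)

lemma eigjet_rpart: "eigjet m (ev m s) (rpart m s)"
proof (cases s)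
  case (Inl f)
  then show ?thesis using eigjet_scale[OF eigjet_polyjet[of m f], of "-1"] by (auto simp: rpart_def eigjet_zero)
next
  case (Inr f)
  show ?thesis
  proof (cases "m \<le> f")
    case False
    then have e: "ev m s = real (m - 1 - f)" unfolding Inr by (intro ev_Inr_low) simp
    have r: "rpart m s = (\<lambda>j x. - partner m (m - 1 - f) * polyjet m (m - 1 - f) j x)"
      using False by (simp add: rpart_def Inr)
    show ?thesis unfolding e r by (rule eigjet_scale[OF eigjet_polyjet])
  qed (simp add: rpart_def Inr eigjet_zero)
qed

lemma eigjet_lpart: "eigjet m (ev m s) (lpart m s)"
proof -
  have "lpart m s = (\<lambda>j x. 1 * seed m s j x + 1 * rpart m s j x)"
    by (intro ext) (simp add: seed_eq_diff)
  then show ?thesis using eigjet_lincomb[OF eigjet_seed eigjet_rpart, of m s 1 1] by simp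
qed

lemma lpart_vanish: "j < m \<Longrightarrow> lpart m s j 0 = 0"
proof (cases s)
  case (Inl f)
  then show "j < m \<Longrightarrow> ?thesis" by (auto simp: lpart_def polyjet_vanish)
next
  case (Inr f)
  show "j < m \<Longrightarrow> ?thesis"
  proof (cases "m \<le> f")
    case True
    then show "j < m \<Longrightarrow> ?thesis" using Inr by (auto simp: lpart_def expjet_vanish)
  next
    case False
    then have n: "m - 1 - f < m" "m - 1 - (m - 1 - f) = f" by auto
    have "lpart m s 0 0 = 0" using False Inr polyjet_at_0_nonzero[OF n(1)] by (simp add: lpart_def partner_def n(2))
    then show "j < m \<Longrightarrow> ?thesis" by (rule eigjet_vanish_at_0[OF eigjet_lpart])
  qed
qed

lemma goodpair_lpart_rpart: "goodpair m (ev m s) (lpart m s) (rpart m s)"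
proof -
  have "\<exists>p. \<forall>j x. rpart m s j x = poly ((pderiv ^^ j) p) x"
  proof (cases s)
    case (Inl f)
    then show ?thesis
      by (intro exI[of _ "if m \<le> f then 0 else smult (-1) (laguerre_poly f (- real m))"])
         (auto simp: rpart_def polyjet_def higher_pderiv_smult higher_pderiv_minus higher_pderiv_zero)
  next
    case (Inr f)
    then show ?thesis
      by (intro exI[of _ "if m \<le> f then 0 else smult (- partner m (m - 1 - f)) (laguerre_poly (m - 1 - f) (- real m))"])
         (auto simp: rpart_def polyjet_def higher_pderiv_smult higher_pderiv_minus higher_pderiv_zero)
  qed
  then show ?thesis unfolding goodpair_def using eigjet_lpart eigjet_rpart lpart_vanish by blast
qed

lemma goodpair_polyjet: "m \<le> f \<Longrightarrow> goodpair m (real f) (polyjet m f) (polyjet m f)"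
  unfolding goodpair_def using eigjet_polyjet polyjet_vanish by (auto simp: polyjet_def)

text \<open>Up to a constant factor this is the classical polynomial L_n^m, because L_(m+n)^(-m) is
  a multiple of x^m L_n^m.\<close>

definition lagq :: "nat \<Rightarrow> nat \<Rightarrow> real poly" where
  "lagq m n = (SOME q. laguerre_poly (m + n) (- real m) = monom 1 m * q \<and> degree q = n \<and> poly q 0 \<noteq> 0)"

lemma lagq: "laguerre_poly (m + n) (- real m) = monom 1 m * lagq m n" "degree (lagq m n) = n" "lagq m n \<noteq> 0"
proof -
  have "\<exists>q. laguerre_poly (m + n) (- real m) = monom 1 m * q \<and> degree q = n \<and> poly q 0 \<noteq> 0"
    using laguerre_neg_factor[of m "m + n"] by (metis add_diff_cancel_left' le_add1)
  then have *: "laguerre_poly (m + n) (- real m) = monom 1 m * lagq m n \<and> degree (lagq m n) = n \<and> poly (lagq m n) 0 \<noteq> 0"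
    unfolding lagq_def by (rule someI_ex)
  then show "laguerre_poly (m + n) (- real m) = monom 1 m * lagq m n" "degree (lagq m n) = n" "lagq m n \<noteq> 0" by auto
qed

lemma glued_polyjet: "x > 0 \<Longrightarrow> glued m x0 (polyjet m (m + n)) (polyjet m (m + n)) x = poly (lagq m n) x"
  by (simp add: glued_def polyjet_def lagq(1) poly_monom)

lemma wip_cong: "(\<And>x. x > 0 \<Longrightarrow> f x = f' x) \<Longrightarrow> (\<And>x. x > 0 \<Longrightarrow> g x = g' x) \<Longrightarrow> wip m f g = wip m f' g'"
  unfolding wip_def by (rule Bochner_Integration.integral_cong) (auto split: split_indicator)

text \<open>Gluing each eigenfunction to itself produces no jump, so \<open>wip_glued\<close> gives
  orthogonality for different eigenvalues; the cut at 1 is arbitrary.\<close>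

lemma lagq_orth:
  assumes m: "m > 0" and ij: "i \<noteq> j"
  shows "wip m (poly (lagq m i)) (poly (lagq m j)) = 0"
proof -
  let ?p = "\<lambda>i. polyjet m (m + i)"
  have "(real (m + i) - real (m + j)) * wip m (glued m 1 (?p i) (?p i)) (glued m 1 (?p j) (?p j)) = 0"
    using wip_glued[OF goodpair_polyjet goodpair_polyjet, of m "m + i" "m + j" 1] m by simp
  then have "wip m (glued m 1 (?p i) (?p i)) (glued m 1 (?p j) (?p j)) = 0" using ij by simp
  moreover have "wip m (glued m 1 (?p i) (?p i)) (glued m 1 (?p j) (?p j)) = wip m (poly (lagq m i)) (poly (lagq m j))"
    by (rule wip_cong) (simp_all add: glued_polyjet)
  ultimately show ?thesis by simp
qed

context laguerre_pair
begin

text \<open>The product Q over the other eigenvalues projects onto one eigenspace. It consumes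
  derivatives, but here all of them vanish. An eigenspace contains one seed or the two seeds with
  common eigenvalue n < m, whose Wronskian is nonzero.\<close>

lemma all_jets_zero:
  assumes x: "x > 0" and z: "\<And>j. (\<Sum>s\<in>S. c s * seed m s j x) = 0" and s: "s \<in> S"
  shows "c s = 0"
proof -
  define Q where "Q = (\<Prod>v\<in>ev m ` S - {ev m s}. [:- v, 1:])"
  have Q0: "poly Q (ev m t) = 0 \<longleftrightarrow> ev m t \<noteq> ev m s" if "t \<in> S" for t
    using that by (auto simp: Q_def poly_prod)
  have proj: "(\<Sum>t\<in>{t\<in>S. ev m t = ev m s}. c t * seed m t j x) = 0" for j
  proof -
    have "(\<Sum>t\<in>S. c t * poly Q (ev m t) * seed m t j x) = 0"
      by (rule jets_eigen_poly_zero[OF finS eigjet_seed, of Q "degree Q"]) (use z in auto)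
    moreover have "(\<Sum>t\<in>S. c t * poly Q (ev m t) * seed m t j x) = (\<Sum>t\<in>{t\<in>S. ev m t = ev m s}. c t * poly Q (ev m t) * seed m t j x)"
      by (rule sum.mono_neutral_right) (use Q0 in auto)
    moreover have "\<dots> = (\<Sum>t\<in>{t\<in>S. ev m t = ev m s}. poly Q (ev m s) * (c t * seed m t j x))"
      by (rule sum.cong) auto
    ultimately have "poly Q (ev m s) * (\<Sum>t\<in>{t\<in>S. ev m t = ev m s}. c t * seed m t j x) = 0"
      by (simp add: sum_distrib_left)
    then show ?thesis using Q0[OF s] by simp
  qed
  show ?thesis
  proof (cases "\<exists>t\<in>S. t \<noteq> s \<and> ev m t = ev m s")
    case False
    then have "{t\<in>S. ev m t = ev m s} = {s}" using s by auto
    then have "c s * seed m s j x = 0" for j using proj[of j] by simp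
    then show ?thesis using seed_nonzero[of m s x] by auto
  next
    case True
    then obtain t where t: "t \<in> S" "t \<noteq> s" "ev m t = ev m s" by blast
    obtain n where n: "n < m" "{s, t} = {Inl n, Inr (m - 1 - n)}" "ev m s = real n"
    proof (cases s)
      case (Inl n)
      then have "t = Inr (m - 1 - n) \<and> n < m" using ev_eq_nat[OF t(1), of n] t by auto
      then show ?thesis using that[of n] Inl by auto
    next
      case (Inr f)
      obtain n where tn: "t = Inl n" using t Inr by (cases t) auto
      then have "s = Inr (m - 1 - n) \<and> n < m" using ev_eq_nat[OF s, of n] t Inr by auto
      then show ?thesis using that[of n] tn t(3) by auto
    qed
    have "Inl n \<in> S" "Inr (m - 1 - n) \<in> S" using n(2) s t(1) by (auto simp: doubleton_eq_iff)
    then have set: "{t\<in>S. ev m t = ev m s} = {Inl n, Inr (m - 1 - n)}"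
      using n ev_eq_nat[of _ n] by (auto simp: of_nat_diff)
    let ?a = "c (Inl n)" and ?b = "c (Inr (m - 1 - n))"
    have e: "?a * polyjet m n j x + ?b * expjet m (m - 1 - n) j x = 0" for j
      using proj[of j] unfolding set by simp
    obtain kap where kap: "kap * (-1) ^ n < 0" "\<And>x. x > 0 \<Longrightarrow> wr m (expjet m (m - 1 - n)) (polyjet m n) x = kap"
      using wr_expjet_polyjet[OF n(1)] by blast
    have nzk: "expjet m (m - 1 - n) 0 x * polyjet m n 1 x - expjet m (m - 1 - n) 1 x * polyjet m n 0 x \<noteq> 0" (is "?w \<noteq> 0")
      using kap(2)[OF x] kap(1) by (auto simp: wr_def)
    have "?b * ?w = (?a * polyjet m n 0 x + ?b * expjet m (m - 1 - n) 0 x) * polyjet m n 1 x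
        - (?a * polyjet m n 1 x + ?b * expjet m (m - 1 - n) 1 x) * polyjet m n 0 x"
      by (simp add: algebra_simps)
    then have b: "?b = 0" unfolding e using nzk by simp
    have "?a * ?w = (?a * polyjet m n 1 x + ?b * expjet m (m - 1 - n) 1 x) * expjet m (m - 1 - n) 0 x
        - (?a * polyjet m n 0 x + ?b * expjet m (m - 1 - n) 0 x) * expjet m (m - 1 - n) 1 x"
      by (simp add: algebra_simps)
    then have a: "?a = 0" unfolding e using nzk by simp
    have "s \<in> {Inl n, Inr (m - 1 - n)}" using n(2) by blast
    then show ?thesis using a b by auto
  qed
qed

section \<open>The glued combination and its expansion\<close>

context
  fixes x0 :: real and c :: "nat + nat \<Rightarrow> real"
  assumes x0: "x0 > 0" and jets: "\<And>j. j < k \<Longrightarrow> (\<Sum>s\<in>S. c s * seed m s j x0) = 0"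
    and pos: "\<And>n. m \<le> n \<Longrightarrow> n \<notin> F1 \<Longrightarrow> poly P (real n) \<ge> 0"
    and neg: "\<And>n. n < m \<Longrightarrow> n \<notin> F1 \<Longrightarrow> (-1) ^ (m - 1 - n) * divdiff P (real n) (real n) \<ge> 0"
begin

definition "gseed s = glued m x0 (lpart m s) (rpart m s)"
definition "glue d x = (\<Sum>s\<in>S. d s * gseed s x)" for d :: "nat + nat \<Rightarrow> real"

lemma subexp_gseed: "subexp (gseed s)"
  unfolding gseed_def by (rule subexp_glued[OF goodpair_lpart_rpart x0])

lemma papprox_gseed: "papprox m (gseed s)"
  unfolding gseed_def by (rule papprox_glued[OF goodpair_lpart_rpart x0])

lemma papprox_glue: "papprox m (glue d)"
  unfolding glue_def [abs_def] by (intro papprox_sum papprox_cmult papprox_gseed)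

lemma subexp_glue: "subexp (glue d)"
  using papprox_glue by (simp add: papprox_def)

lemma wip_glue: "subexp g \<Longrightarrow> wip m (glue d) g = (\<Sum>s\<in>S. d s * wip m (gseed s) g)"
  unfolding glue_def [abs_def] by (rule wip_sum) (auto intro: subexp_gseed)

lemma wip_glue_right: "subexp g \<Longrightarrow> wip m g (glue d) = (\<Sum>t\<in>S. d t * wip m g (gseed t))"
  using wip_glue[of g d] by (simp only: wip_commute[of m g])

lemma wip_gseed_gseed:
  "(ev m s - ev m t) * wip m (gseed s) (gseed t) = wr m (lpart m s) (lpart m t) x0 - wr m (rpart m s) (rpart m t) x0"
  unfolding gseed_def by (rule wip_glued[OF goodpair_lpart_rpart goodpair_lpart_rpart x0 m])

lemma wip_gseed_lagq:
  "(ev m s - real (m + n)) * wip m (gseed s) (poly (lagq m n)) = wr m (seed m s) (polyjet m (m + n)) x0"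
proof -
  let ?p = "polyjet m (m + n)"
  have "wip m (gseed s) (poly (lagq m n)) = wip m (glued m x0 (lpart m s) (rpart m s)) (glued m x0 ?p ?p)"
    unfolding gseed_def by (rule wip_cong) (simp_all add: glued_polyjet)
  then have "(ev m s - real (m + n)) * wip m (gseed s) (poly (lagq m n)) = wr m (lpart m s) ?p x0 - wr m (rpart m s) ?p x0"
    using wip_glued[OF goodpair_lpart_rpart goodpair_polyjet x0 m, of "m + n" s] by simp
  also have "\<dots> = wr m (seed m s) ?p x0" by (simp add: wr_def seed_eq_diff algebra_simps)
  finally show ?thesis .
qed

text \<open>Derivatives up to order 1 + 2 (k/2 - 1) = k - 1 enter, all within the assumed zero of
  order k.\<close>

lemma seed_poly_zero:
  assumes "degree Q \<le> k div 2 - 1" "j \<le> 1"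
  shows "(\<Sum>s\<in>S. c s * poly Q (ev m s) * seed m s j x0) = 0"
  by (rule jets_eigen_poly_zero[OF finS eigjet_seed assms(1)]) (use assms(2) jets k_half in auto)

text \<open>R(-D) may be moved from the glued function onto the eigenfunction: the boundary terms at
  x0 carry a divided difference of degree k/2 - 1 and vanish.\<close>

lemma coefficient_factor:
  assumes R: "degree R = k div 2"
  shows "wip m (glue (\<lambda>s. c s * poly R (ev m s))) (poly (lagq m n)) = poly R (real (m + n)) * wip m (glue c) (poly (lagq m n))"
proof -
  let ?x = "real (m + n)" and ?X = "\<lambda>s. wip m (gseed s) (poly (lagq m n))"
  have "wip m (glue (\<lambda>s. c s * poly R (ev m s))) (poly (lagq m n)) - poly R ?x * wip m (glue c) (poly (lagq m n))
     = (\<Sum>s\<in>S. c s * divdiff R (ev m s) ?x * wr m (seed m s) (polyjet m (m + n)) x0)"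
    unfolding wip_glue[OF subexp_poly] sum_distrib_left sum_subtractf [symmetric]
  proof (rule sum.cong[OF refl])
    fix s
    have "c s * poly R (ev m s) * ?X s - poly R ?x * (c s * ?X s) = c s * ((poly R (ev m s) - poly R ?x) * ?X s)"
      by (simp add: algebra_simps)
    also have "\<dots> = c s * divdiff R (ev m s) ?x * ((ev m s - ?x) * ?X s)"
      by (simp only: divdiff [symmetric] mult_ac)
    also have "\<dots> = c s * divdiff R (ev m s) ?x * wr m (seed m s) (polyjet m (m + n)) x0"
      by (simp only: wip_gseed_lagq)
    finally show "c s * poly R (ev m s) * ?X s - poly R ?x * (c s * ?X s)
       = c s * divdiff R (ev m s) ?x * wr m (seed m s) (polyjet m (m + n)) x0" .
  qed
  also have "\<dots> = 0"
    unfolding divdiff_def wr_sum_left using R by (simp add: seed_poly_zero degree_synthetic_div)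
  finally show ?thesis by simp
qed

text \<open>Green's formula turns the form into a double sum of Wronskians at x0 weighted by divided
  differences of \<open>P\<close>, with seeds on one side and right parts on the other. Off-diagonal
  weights vanish because they join two roots of \<open>P\<close>. On the diagonal only low
  exponential seeds have a nonzero Wronskian with their right part, and there \<open>neg\<close>
  supplies the sign.\<close>

lemma glued_form_nonpos:
  assumes PP: "P = P1 * P2" "degree P1 = k div 2" "degree P2 = k div 2"
  shows "wip m (glue (\<lambda>s. c s * poly P1 (ev m s))) (glue (\<lambda>s. c s * poly P2 (ev m s))) \<le> 0"
proof -
  let ?I = "\<lambda>s t. wip m (gseed s) (gseed t)"
  have "wip m (glue (\<lambda>s. c s * poly P1 (ev m s))) (glue (\<lambda>s. c s * poly P2 (ev m s)))
     = (\<Sum>s\<in>S. \<Sum>t\<in>S. c s * poly P1 (ev m s) * (c t * poly P2 (ev m t) * ?I s t))"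
    unfolding wip_glue[OF subexp_glue] wip_glue_right[OF subexp_gseed] sum_distrib_left by (rule refl)
  also have "\<dots> = - (\<Sum>s\<in>S. c s * poly P1 (ev m s) * (\<Sum>t\<in>S. c t * divdiff P2 (ev m s) (ev m t) * wr m (seed m s) (rpart m t) x0))"
    unfolding sum_negf [symmetric]
  proof (rule sum.cong[OF refl])
    fix s assume s: "s \<in> S"
    let ?Q = "synthetic_div P2 (ev m s)"
    have Q: "degree ?Q \<le> k div 2 - 1" using PP by (simp add: degree_synthetic_div)
    have dQ: "divdiff P2 (ev m s) (ev m t) = poly ?Q (ev m t)" for t
      by (subst divdiff_commute) (rule divdiff_def)
    \<comment> \<open>Allows P2 at t to be replaced by its difference from P2 at s, which provides
      the factor ev s - ev t required by \<open>wip_gseed_gseed\<close>.\<close>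
    have Ps: "poly P1 (ev m s) * poly P2 (ev m s) = 0" using P_root[OF s] by (simp add: PP(1))
    have "(\<Sum>t\<in>S. c s * poly P1 (ev m s) * (c t * poly P2 (ev m t) * ?I s t))
      = - (c s * poly P1 (ev m s) * (\<Sum>t\<in>S. c t * poly ?Q (ev m t) * (wr m (lpart m s) (lpart m t) x0 - wr m (rpart m s) (rpart m t) x0)))"
      unfolding sum_distrib_left sum_negf [symmetric]
    proof (rule sum.cong[OF refl])
      fix t
      have "poly P1 (ev m s) * poly P2 (ev m t) * ?I s t = poly P1 (ev m s) * (poly P2 (ev m t) - poly P2 (ev m s)) * ?I s t"
        by (simp only: right_diff_distrib left_diff_distrib Ps mult_zero_left diff_zero)
      also have "\<dots> = - poly P1 (ev m s) * poly ?Q (ev m t) * ((ev m s - ev m t) * ?I s t)"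
        unfolding divdiff [symmetric] divdiff_def by (simp add: algebra_simps)
      also have "\<dots> = - poly P1 (ev m s) * poly ?Q (ev m t) * (wr m (lpart m s) (lpart m t) x0 - wr m (rpart m s) (rpart m t) x0)"
        by (simp only: wip_gseed_gseed)
      finally have "c s * c t * (poly P1 (ev m s) * poly P2 (ev m t) * ?I s t)
          = c s * c t * (- poly P1 (ev m s) * poly ?Q (ev m t) * (wr m (lpart m s) (lpart m t) x0 - wr m (rpart m s) (rpart m t) x0))"
        by (rule arg_cong)
      then show "c s * poly P1 (ev m s) * (c t * poly P2 (ev m t) * ?I s t)
         = - (c s * poly P1 (ev m s) * (c t * poly ?Q (ev m t) * (wr m (lpart m s) (lpart m t) x0 - wr m (rpart m s) (rpart m t) x0)))"
        by (simp add: mult_ac)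
    qed
    also have "(\<Sum>t\<in>S. c t * poly ?Q (ev m t) * (wr m (lpart m s) (lpart m t) x0 - wr m (rpart m s) (rpart m t) x0))
      = (\<Sum>t\<in>S. c t * poly ?Q (ev m t) * wr m (seed m s) (rpart m t) x0)"
    proof -
      \<comment> \<open>The two combinations differ by one of seeds whose value and slope vanish at
        x0, so the left parts in the second argument can be traded for right parts.\<close>
      have eq: "(\<Sum>t\<in>S. c t * poly ?Q (ev m t) * lpart m t j x0) = (\<Sum>t\<in>S. c t * poly ?Q (ev m t) * rpart m t j x0)"
        if "j \<le> 1" for j
      proof -
        have "(\<Sum>t\<in>S. c t * poly ?Q (ev m t) * lpart m t j x0) - (\<Sum>t\<in>S. c t * poly ?Q (ev m t) * rpart m t j x0)
          = (\<Sum>t\<in>S. c t * poly ?Q (ev m t) * seed m t j x0)"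
          unfolding sum_subtractf [symmetric] by (rule sum.cong) (auto simp: seed_eq_diff algebra_simps)
        then show ?thesis using seed_poly_zero[OF Q that] by simp
      qed
      have "(\<Sum>t\<in>S. c t * poly ?Q (ev m t) * (wr m (lpart m s) (lpart m t) x0 - wr m (rpart m s) (rpart m t) x0))
        = (\<Sum>t\<in>S. c t * poly ?Q (ev m t) * wr m (lpart m s) (lpart m t) x0) - (\<Sum>t\<in>S. c t * poly ?Q (ev m t) * wr m (rpart m s) (rpart m t) x0)"
        by (simp add: right_diff_distrib sum_subtractf)
      also have "\<dots> = (\<Sum>t\<in>S. c t * poly ?Q (ev m t) * wr m (seed m s) (rpart m t) x0)"
        unfolding wr_sum_right eq[OF order_refl] eq[OF zero_le] by (simp add: seed_eq_diff algebra_simps)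
      finally show ?thesis .
    qed
    finally show "(\<Sum>t\<in>S. c s * poly P1 (ev m s) * (c t * poly P2 (ev m t) * ?I s t))
      = - (c s * poly P1 (ev m s) * (\<Sum>t\<in>S. c t * divdiff P2 (ev m s) (ev m t) * wr m (seed m s) (rpart m t) x0))"
      unfolding dQ .
  qed
  also have "\<dots> = - (\<Sum>s\<in>S. \<Sum>t\<in>S. c s * c t * (divdiff P (ev m s) (ev m t) * wr m (seed m s) (rpart m t) x0))"
  proof -
    \<comment> \<open>The other half of the Leibniz rule vanishes and can be added for free; it
      completes the weight to a divided difference of the whole \<open>P\<close>.\<close>
    have z: "(\<Sum>t\<in>S. c t * poly P2 (ev m t) * (\<Sum>s\<in>S. c s * divdiff P1 (ev m s) (ev m t) * wr m (seed m s) (rpart m t) x0)) = 0"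
    proof (rule sum.neutral, rule ballI)
      fix t
      show "c t * poly P2 (ev m t) * (\<Sum>s\<in>S. c s * divdiff P1 (ev m s) (ev m t) * wr m (seed m s) (rpart m t) x0) = 0"
        unfolding divdiff_def wr_sum_left using PP by (simp add: seed_poly_zero degree_synthetic_div)
    qed
    have "(\<Sum>s\<in>S. \<Sum>t\<in>S. c s * c t * (divdiff P (ev m s) (ev m t) * wr m (seed m s) (rpart m t) x0))
      = (\<Sum>s\<in>S. \<Sum>t\<in>S. c s * poly P1 (ev m s) * (c t * divdiff P2 (ev m s) (ev m t) * wr m (seed m s) (rpart m t) x0)
          + c t * poly P2 (ev m t) * (c s * divdiff P1 (ev m s) (ev m t) * wr m (seed m s) (rpart m t) x0))"
      unfolding PP(1) by (intro sum.cong refl) (simp add: divdiff_mult algebra_simps)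
    also have "\<dots> = (\<Sum>s\<in>S. c s * poly P1 (ev m s) * (\<Sum>t\<in>S. c t * divdiff P2 (ev m s) (ev m t) * wr m (seed m s) (rpart m t) x0))
        + (\<Sum>t\<in>S. c t * poly P2 (ev m t) * (\<Sum>s\<in>S. c s * divdiff P1 (ev m s) (ev m t) * wr m (seed m s) (rpart m t) x0))"
      unfolding sum_distrib_left sum.distrib by (intro arg_cong2[where f = "(+)"] refl sum.swap)
    finally show ?thesis using z by simp
  qed
  also have "\<dots> = - (\<Sum>s\<in>S. (c s * c s) * (divdiff P (ev m s) (ev m s) * wr m (seed m s) (rpart m s) x0))"
  proof -
    have "(\<Sum>t\<in>S. c s * c t * (divdiff P (ev m s) (ev m t) * wr m (seed m s) (rpart m t) x0))
       = (c s * c s) * (divdiff P (ev m s) (ev m s) * wr m (seed m s) (rpart m s) x0)" if s: "s \<in> S" for s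
    proof -
      have "divdiff P (ev m s) (ev m t) = 0" if "t \<in> S" "t \<noteq> s" for t
        using divdiff_rootpoly_double[OF finS s that(1)] divdiff_rootpoly_distinct[OF finS s that(1)] that(2)
        unfolding P_def by metis
      then show ?thesis
        by (subst sum.remove[OF finS s]) (simp add: sum.neutral)
    qed
    then show ?thesis by simp
  qed
  also have "\<dots> \<le> 0"
  proof -
    have "divdiff P (ev m s) (ev m s) * wr m (seed m s) (rpart m s) x0 \<ge> 0" if s: "s \<in> S" for s
    proof (cases s)
      case (Inl f)
      then show ?thesis by (cases "m \<le> f") (auto simp: rpart_def wr_def)
    next
      case (Inr f)
      show ?thesis
      proof (cases "m \<le> f")
        case True
        then show ?thesis using Inr by (auto simp: rpart_def wr_def)
      next
        case False
        define n where "n = m - 1 - f"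
        have n: "n < m" "f = m - 1 - n" using False by (auto simp: n_def)
        have evs: "ev m s = real n" using False Inr by (simp add: n_def of_nat_diff)
        obtain kap where kap: "kap * (-1) ^ n < 0" "\<And>x. x > 0 \<Longrightarrow> wr m (expjet m (m - 1 - n)) (polyjet m n) x = kap"
          using wr_expjet_polyjet[OF n(1)] by blast
        have kap': "wr m (expjet m f) (polyjet m n) x0 = kap" using kap(2)[OF x0] unfolding n(2) [symmetric] .
        have r: "rpart m (Inr f) = (\<lambda>j x. - partner m n * polyjet m n j x)"
          using False by (simp add: rpart_def n_def)
        have w: "wr m (seed m s) (rpart m s) x0 = - (partner m n * kap)"
          unfolding kap' [symmetric] Inr r seed_simps by (simp add: wr_def algebra_simps)
        \<comment> \<open>If n also belongs to \<open>F1\<close>, it is a double root of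
          \<open>P\<close> and the weight P'(n) is 0; otherwise the signs of partner, constant
          Wronskian and P'(n) combine.\<close>
        show ?thesis
        proof (cases "n \<in> F1")
          case True
          then have "Inl n \<in> S" unfolding S_def by (rule InlI)
          moreover have "s \<noteq> Inl n" by (simp add: Inr)
          moreover have "ev m s = ev m (Inl n)" unfolding evs by simp
          ultimately have "divdiff P (ev m s) (ev m (Inl n)) = 0"
            unfolding P_def using divdiff_rootpoly_double[OF finS s] by blast
          then show ?thesis by (simp add: evs)
        next
          case False
          have D: "(-1) ^ f * divdiff P (real n) (real n) \<ge> 0" using neg[OF n(1) False] n(2) by simp
          have y: "polyjet m n 0 0 * (-1) ^ n > 0" using laguerre_poly_at_0_sign[OF n(1)] by (simp add: polyjet_def)
          have f: "f < m" using n by simp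
          have s0: "expjet m f 0 0 * (-1) ^ f > 0" using laguerre_poly_at_0_sign[OF f] by (simp add: expjet_def)
          have pe: "partner m n = expjet m f 0 0 / polyjet m n 0 0"
            unfolding partner_def n(2) [symmetric] ..
          have "(partner m n * kap) * (-1) ^ f = (expjet m f 0 0 * (-1) ^ f) * (kap * (-1) ^ n) / (polyjet m n 0 0 * (-1) ^ n)"
            by (simp add: pe)
          also have "\<dots> \<le> 0"
            by (rule divide_nonpos_pos[OF less_imp_le[OF mult_pos_neg[OF s0 kap(1)]] y])
          finally have K: "(partner m n * kap) * (-1) ^ f \<le> 0" .
          have "((partner m n * kap) * (-1) ^ f) * ((-1) ^ f * divdiff P (real n) (real n)) \<le> 0"
            by (rule mult_nonpos_nonneg[OF K D])
          then have "(partner m n * kap) * divdiff P (real n) (real n) \<le> 0"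
            by (cases "even f") simp_all
          then show ?thesis unfolding w evs by (simp add: mult.commute)
        qed
      qed
    qed
    then have "0 \<le> (\<Sum>s\<in>S. (c s * c s) * (divdiff P (ev m s) (ev m s) * wr m (seed m s) (rpart m s) x0))"
      by (intro sum_nonneg mult_nonneg_nonneg[OF zero_le_square])
    then show ?thesis by simp
  qed
  finally show ?thesis .
qed

text \<open>Parseval writes the form as a series with terms P(m+n) times the squared coefficient
  over the squared norm. The terms are nonnegative and the sum is at most 0, so each one vanishes,
  and P(m+n) is nonzero because no seed has this eigenvalue.\<close>

lemma glued_coefficient_zero:
  assumes n: "m + n \<notin> F1"
  shows "wip m (glue c) (poly (lagq m n)) = 0"
proof -
  obtain P1 P2 where PP: "P = P1 * P2" "degree P1 = k div 2" "lead_coeff P1 = 1"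
    "degree P2 = k div 2" "lead_coeff P2 = 1" by (rule P_split)
  let ?V = "glue (\<lambda>s. c s * poly P1 (ev m s))" and ?W = "glue (\<lambda>s. c s * poly P2 (ev m s))"
  let ?h = "\<lambda>n. wip m (poly (lagq m n)) (poly (lagq m n))"
  define a where "a n = wip m ?V (poly (lagq m n)) * wip m ?W (poly (lagq m n)) / ?h n" for n
  have h: "?h n > 0" for n by (rule wip_poly_pos[OF lagq(3)])
  have a: "a n = poly P (real (m + n)) * (wip m (glue c) (poly (lagq m n)))\<^sup>2 / ?h n" for n
    unfolding a_def coefficient_factor[OF PP(2)] coefficient_factor[OF PP(4)] PP(1)
    by (simp add: power2_eq_square mult_ac)
  have Pp: "poly P (real (m + n)) \<ge> 0" for n
  proof (cases "m + n \<in> F1")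
    case True
    then have "Inl (m + n) \<in> S" unfolding S_def by (rule InlI)
    then show ?thesis using P_root[of "Inl (m + n)"] by simp
  next
    case False
    then show ?thesis by (intro pos) simp_all
  qed
  have an: "a n \<ge> 0" for n unfolding a using Pp[of n] h[of n] by simp
  have "(\<lambda>N. \<Sum>n<N. a n) \<longlonglongrightarrow> wip m ?V ?W"
    unfolding a_def by (rule parseval[OF lagq(2,3) lagq_orth[OF m] papprox_glue subexp_glue])
  then have "(\<Sum>n<N. a n) \<le> wip m ?V ?W" for N
    by (intro incseq_le) (auto simp: incseq_def intro!: sum_mono2 an)
  then have "(\<Sum>i<Suc n. a i) \<le> 0" using glued_form_nonpos[OF PP(1,2,4)] order_trans by blast
  moreover have "(\<Sum>i<n. a i) \<ge> 0" by (rule sum_nonneg) (simp add: an)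
  ultimately have "a n = 0" using an[of n] by simp
  moreover have "poly P (real (m + n)) \<noteq> 0"
  proof
    assume "poly P (real (m + n)) = 0"
    then obtain s where "s \<in> S" "ev m s = real (m + n)" by (auto simp: P_def poly_rootpoly)
    then have "s = Inl (m + n)" using ev_eq_nat[of s "m + n"] by auto
    then show False using \<open>s \<in> S\<close> n by (auto simp: S_def)
  qed
  ultimately show ?thesis unfolding a using h[of n] by auto
qed

text \<open>Only finitely many coefficients can be nonzero. Subtracting that finite part leaves a
  function orthogonal to every \<open>lagq\<close>, which is 0 off x0. So the sums of left and of
  right parts continue the same polynomial across x0; their difference, the seed combination, has
  all derivatives zero there.\<close>

lemma glued_trivial:
  assumes s: "s \<in> S"
  shows "c s = 0"
proof -
  let ?h = "\<lambda>n. wip m (poly (lagq m n)) (poly (lagq m n))"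
  define B where "B = {n. m + n \<in> F1}"
  have "(\<lambda>n. m + n) ` B \<subseteq> F1" by (auto simp: B_def)
  then have "finite ((\<lambda>n. m + n) ` B)" by (rule finite_subset[OF _ fin(1)])
  then have finB: "finite B" by (rule finite_imageD) simp
  define b where "b n = wip m (glue c) (poly (lagq m n)) / ?h n" for n
  have h: "?h n > 0" for n by (rule wip_poly_pos[OF lagq(3)])
  define q where "q = (\<Sum>n\<in>B. smult (b n) (lagq m n))"
  have q: "poly q = (\<lambda>x. \<Sum>n\<in>B. b n * poly (lagq m n) x)" by (auto simp: q_def poly_sum)
  define U where "U x = glue c x - poly q x" for x
  have oU: "subexp U" unfolding U_def by (intro subexp_diff subexp_glue subexp_poly)
  have aU: "papprox m U"
    using papprox_add[OF papprox_glue papprox_cmult[OF papprox_poly[of m q], of "-1"]] by (simp add: U_def [abs_def])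
  have z: "wip m U (poly (lagq m n)) = 0" for n
  proof -
    have "wip m (poly q) (poly (lagq m n)) = (\<Sum>i\<in>B. b i * wip m (poly (lagq m i)) (poly (lagq m n)))"
      unfolding q by (rule wip_sum) (auto intro: subexp_poly)
    also have "\<dots> = (\<Sum>i\<in>B. if i = n then b n * ?h n else 0)"
      by (rule sum.cong) (auto simp: lagq_orth[OF m])
    also have "\<dots> = (if n \<in> B then wip m (glue c) (poly (lagq m n)) else 0)"
      using h[of n] finB by (simp add: b_def)
    also have "\<dots> = wip m (glue c) (poly (lagq m n))" using glued_coefficient_zero[of n] by (simp add: B_def)
    finally show ?thesis unfolding U_def by (simp add: wip_diff[OF subexp_glue subexp_poly subexp_poly])
  qed
  have "(\<lambda>N. \<Sum>n<N. wip m U (poly (lagq m n)) * wip m U (poly (lagq m n)) / ?h n) \<longlonglongrightarrow> wip m U U"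
    by (rule parseval[OF lagq(2,3) lagq_orth[OF m] aU oU])
  then have UU: "wip m U U = 0" unfolding z using LIMSEQ_unique[OF _ tendsto_const] by fastforce
  have cU: "isCont U x" if "x > 0" "x \<noteq> x0" for x
    unfolding U_def glue_def gseed_def
    by (intro continuous_intros isCont_glued[OF goodpair_lpart_rpart that] DERIV_isCont[OF poly_DERIV])
  have U0: "glue c x = poly q x" if "x > 0" "x \<noteq> x0" for x
    using wip_zero_imp[OF oU UU cU[OF that] that(1)] by (simp add: U_def)
  have q0: "x ^ m * poly q x = (\<Sum>n\<in>B. b n * polyjet m (m + n) 0 x)" for x
    unfolding q sum_distrib_left by (rule sum.cong) (auto simp: polyjet_def lagq(1) poly_monom)
  have L: "(\<Sum>s\<in>S. c s * lpart m s 0 x) - (\<Sum>n\<in>B. b n * polyjet m (m + n) 0 x) = 0" if x: "0 < x" "x < x0" for x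
  proof -
    have "(\<Sum>s\<in>S. c s * lpart m s 0 x) = x ^ m * glue c x"
      unfolding glue_def sum_distrib_left by (rule sum.cong) (use x in \<open>auto simp: gseed_def glued_def\<close>)
    then show ?thesis using U0[of x] q0[of x] x by simp
  qed
  have R: "(\<Sum>s\<in>S. c s * rpart m s 0 x) - (\<Sum>n\<in>B. b n * polyjet m (m + n) 0 x) = 0" if x: "x0 < x" for x
  proof -
    have "(\<Sum>s\<in>S. c s * rpart m s 0 x) = x ^ m * glue c x"
      unfolding glue_def sum_distrib_left by (rule sum.cong) (use x x0 in \<open>auto simp: gseed_def glued_def\<close>)
    then show ?thesis using U0[of x] q0[of x] x x0 by simp
  qed
  have D: "((\<lambda>x. (\<Sum>s\<in>S. c s * f s j x) - (\<Sum>n\<in>B. b n * polyjet m (m + n) j x)) has_real_derivative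
     (\<Sum>s\<in>S. c s * f s (Suc j) x) - (\<Sum>n\<in>B. b n * polyjet m (m + n) (Suc j) x)) (at x)"
    if "\<And>s. eigjet m (ev m s) (f s)" for f and j :: nat and x :: real
    by (intro DERIV_diff DERIV_sum DERIV_cmult eigjet_deriv[OF that] eigjet_deriv[OF eigjet_polyjet])
  have LJ: "(\<Sum>s\<in>S. c s * lpart m s j x0) - (\<Sum>n\<in>B. b n * polyjet m (m + n) j x0) = 0" for j
    by (rule jets_zero_on_interval(2)[where G = "\<lambda>j x. (\<Sum>s\<in>S. c s * lpart m s j x) - (\<Sum>n\<in>B. b n * polyjet m (m + n) j x)",
          OF D[OF eigjet_lpart] x0 L])
  have "x0 < x0 + 1" by simp
  then have RJ: "(\<Sum>s\<in>S. c s * rpart m s j x0) - (\<Sum>n\<in>B. b n * polyjet m (m + n) j x0) = 0" for j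
    by (rule jets_zero_on_interval(1)[where G = "\<lambda>j x. (\<Sum>s\<in>S. c s * rpart m s j x) - (\<Sum>n\<in>B. b n * polyjet m (m + n) j x)",
          OF D[OF eigjet_rpart] _ R])
  have "(\<Sum>s\<in>S. c s * seed m s j x0) = 0" for j
    using LJ[of j] RJ[of j] by (simp add: seed_eq_diff right_diff_distrib sum_subtractf)
  then show ?thesis by (rule all_jets_zero[OF x0 _ s])
qed

end
end

section \<open>The origin, the shift and the main theorem\<close>

text \<open>If the m-th derivative vanished too, the left part would be O(x^(m+1)) and its weighted
  Wronskian with L_n^(-m) would tend to 0 at the origin, but that Wronskian is the nonzero constant
  \<open>kap\<close>.\<close>

lemma lpart_Inr_jet_m:
  assumes f: "f < m"
  shows "lpart m (Inr f) m 0 \<noteq> 0"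
proof
  assume z: "lpart m (Inr f) m 0 = 0"
  define n where "n = m - 1 - f"
  have n: "n < m" "m - 1 - n = f" using f by (auto simp: n_def)
  let ?l = "lpart m (Inr f)" and ?p = "polyjet m n"
  obtain kap where kap: "kap * (-1) ^ n < 0" "\<And>x. x > 0 \<Longrightarrow> wr m (expjet m f) ?p x = kap"
    using wr_expjet_polyjet[OF n(1)] unfolding n(2) by blast
  have l: "?l = (\<lambda>j x. expjet m f j x - partner m n * polyjet m n j x)"
    using f by (simp add: lpart_def n_def)
  have w: "wr m ?l ?p x = kap" if "x > 0" for x
    unfolding kap(2)[OF that, symmetric] l by (simp add: wr_def algebra_simps)
  have v: "?l j 0 = 0" if "j < Suc m" for j
    using that z lpart_vanish[of j m "Inr f"] by (cases "j = m") auto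
  obtain C where C: "\<And>x. 0 \<le> x \<Longrightarrow> x \<le> 1 \<Longrightarrow> \<bar>?l 0 x\<bar> \<le> C * x ^ Suc m"
    using taylor_bound_at_0[of ?l "Suc m" 1] eigjet_deriv[OF eigjet_lpart] v by blast
  obtain D where D: "\<And>x. 0 \<le> x \<Longrightarrow> x \<le> 1 \<Longrightarrow> \<bar>?l (Suc 0) x\<bar> \<le> D * x ^ m"
    using taylor_bound_at_0[of "\<lambda>j. ?l (Suc j)" m 1] eigjet_deriv[OF eigjet_lpart] v by blast
  let ?h = "\<lambda>x. exp (- x) * (C * x * x * \<bar>?p 1 x\<bar> + D * x * \<bar>?p 0 x\<bar>)"
  have t: "(?p j \<longlongrightarrow> ?p j 0) (at_right 0)" for j
    using eigjet_isCont[OF eigjet_polyjet[of m n], where j = j and x = 0]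
    unfolding isCont_def by (auto intro: tendsto_within_subset)
  have "(?h \<longlongrightarrow> exp (- 0) * (C * 0 * 0 * \<bar>?p 1 0\<bar> + D * 0 * \<bar>?p 0 0\<bar>)) (at_right 0)"
    by (intro tendsto_mult tendsto_add tendsto_rabs tendsto_exp tendsto_minus tendsto_ident_at tendsto_const t)
  then have h0: "(?h \<longlongrightarrow> 0) (at_right 0)" by simp
  have "\<bar>kap\<bar> \<le> ?h x" if x: "0 < x" "x < 1" for x
  proof -
    have "\<bar>kap\<bar> = (x / x ^ m) * exp (- x) * \<bar>?l 0 x * ?p 1 x - ?l 1 x * ?p 0 x\<bar>"
      using x w[OF x(1), symmetric] by (simp add: wr_def powr_eq_divide abs_mult)
    also have "\<dots> \<le> (x / x ^ m) * exp (- x) * (\<bar>?l 0 x\<bar> * \<bar>?p 1 x\<bar> + \<bar>?l 1 x\<bar> * \<bar>?p 0 x\<bar>)"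
      using x by (intro mult_left_mono order_trans[OF abs_triangle_ineq4]) (auto simp: abs_mult)
    also have "\<dots> \<le> (x / x ^ m) * exp (- x) * ((C * x ^ Suc m) * \<bar>?p 1 x\<bar> + (D * x ^ m) * \<bar>?p 0 x\<bar>)"
      using x C[of x] D[of x] by (intro mult_left_mono add_mono mult_right_mono) auto
    also have "\<dots> = ?h x" using x by (simp add: field_simps)
    finally show ?thesis .
  qed
  then have "\<forall>\<^sub>F x in at_right 0. \<bar>kap\<bar> \<le> ?h x"
    unfolding eventually_at_right_field by (intro exI[of _ 1]) auto
  then have "\<bar>kap\<bar> \<le> 0" by (rule tendsto_lowerbound[OF h0]) simp
  then show False using kap(1) by simp
qed

lemma lpart_jet_m: "(case s of Inl f \<Rightarrow> m \<le> f | Inr f \<Rightarrow> True) \<Longrightarrow> lpart m s m 0 \<noteq> 0"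
proof (cases s)
  case (Inl f)
  then show "(case s of Inl f \<Rightarrow> m \<le> f | Inr f \<Rightarrow> True) \<Longrightarrow> ?thesis"
    using coeff_laguerre_neg_m[of m f] by (simp add: lpart_def polyjet_at_0)
next
  case (Inr f)
  show "(case s of Inl f \<Rightarrow> m \<le> f | Inr f \<Rightarrow> True) \<Longrightarrow> ?thesis"
  proof (cases "m \<le> f")
    case True
    then show ?thesis using expjet_at_0_m[of m f] Inr by (simp add: lpart_def)
  next
    case False
    then show ?thesis using lpart_Inr_jet_m[of f m] Inr by simp
  qed
qed

context laguerre_pair
begin

text \<open>At the origin the exponents of the span are $0,\dots,m-1$ (one for each $n<m$) and then
  $m,\dots,k-1$ coming from the solutions that are $O(x^m)$.\<close>

lemma jets_zero_at_0:
  assumes z: "\<And>j. j < k \<Longrightarrow> (\<Sum>s\<in>S. c s * seed m s j 0) = 0" and s: "s \<in> S"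
  shows "c s = 0"
proof -
  \<comment> \<open>Projection onto one eigenvalue needs degree at most k - 1, which at the origin
    the k vanishing derivatives just allow.\<close>
  have A: "(\<Sum>t\<in>{t\<in>S. ev m t = v}. c t * seed m t 0 0) = 0" if v: "v \<in> ev m ` S" for v
  proof -
    define Q where "Q = (\<Prod>v\<in>ev m ` S - {v}. [:- v, 1:])"
    have Q0: "poly Q (ev m t) = 0 \<longleftrightarrow> ev m t \<noteq> v" if "t \<in> S" for t
      using that by (auto simp: Q_def poly_prod)
    have "card (ev m ` S) \<le> k" using card_image_le[OF finS, of "ev m"] cardS by simp
    then have dQ: "degree Q \<le> k - 1"
      unfolding Q_def using v by (subst degree_prod_eq_sum_degree) (auto simp: card_Diff_singleton)
    have "(\<Sum>t\<in>S. c t * poly Q (ev m t) * seed m t 0 0) = 0"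
      by (rule jets_eigen_poly_at_0[OF finS eigjet_seed dQ]) (use z k_ge in auto)
    moreover have "(\<Sum>t\<in>S. c t * poly Q (ev m t) * seed m t 0 0) = (\<Sum>t\<in>{t\<in>S. ev m t = v}. c t * poly Q (ev m t) * seed m t 0 0)"
      by (rule sum.mono_neutral_right) (use Q0 in auto)
    moreover have "\<dots> = (\<Sum>t\<in>{t\<in>S. ev m t = v}. poly Q v * (c t * seed m t 0 0))"
      by (rule sum.cong) auto
    ultimately have "poly Q v * (\<Sum>t\<in>{t\<in>S. ev m t = v}. c t * seed m t 0 0) = 0"
      by (simp add: sum_distrib_left)
    moreover have "poly Q v \<noteq> 0" using v Q0 by auto
    ultimately show ?thesis by simp
  qed
  have rg: "rpart m t j 0 = - (seed m t 0 0 / polyjet m n 0 0) * polyjet m n j 0"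
    if "t \<in> S" "ev m t = real n" "n < m" for t n j
    using ev_eq_nat[OF that(1,2)] that(3) polyjet_at_0_nonzero[OF that(3)]
    by (auto simp: rpart_def partner_def)
  have rz: "rpart m t j x = 0" if "\<And>n. n < m \<Longrightarrow> ev m t \<noteq> real n" for t j x
  proof (cases t)
    case (Inl f)
    then show ?thesis using that[of f] by (auto simp: rpart_def)
  next
    case (Inr f)
    then show ?thesis using that[of "m - 1 - f"] ev_Inr_low[of f m] by (auto simp: rpart_def)
  qed
  \<comment> \<open>Within the group of eigenvalue n < m every right part is a multiple of L_n^(-m)
    proportional to the seed's value at 0, so \<open>A\<close> cancels the group; in all other
    groups the right parts are zero.\<close>
  have B: "(\<Sum>t\<in>S. c t * rpart m t j 0) = 0" for j
  proof -
    have "(\<Sum>t\<in>S. c t * rpart m t j 0) = (\<Sum>v\<in>ev m ` S. \<Sum>t\<in>{t\<in>S. ev m t = v}. c t * rpart m t j 0)"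
      by (rule sum.group[symmetric]) auto
    also have "\<dots> = 0"
    proof (rule sum.neutral, rule ballI)
      fix v assume v: "v \<in> ev m ` S"
      show "(\<Sum>t\<in>{t\<in>S. ev m t = v}. c t * rpart m t j 0) = 0"
      proof (cases "\<exists>n<m. v = real n")
        case True
        then obtain n where n: "n < m" "v = real n" by blast
        have "(\<Sum>t\<in>{t\<in>S. ev m t = v}. c t * rpart m t j 0)
          = (\<Sum>t\<in>{t\<in>S. ev m t = v}. - (polyjet m n j 0 / polyjet m n 0 0) * (c t * seed m t 0 0))"
          by (rule sum.cong) (use rg n in auto)
        also have "\<dots> = - (polyjet m n j 0 / polyjet m n 0 0) * (\<Sum>t\<in>{t\<in>S. ev m t = v}. c t * seed m t 0 0)"
          by (simp only: sum_distrib_left)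
        finally show ?thesis using A[OF v] by simp
      next
        case False
        then show ?thesis by (intro sum.neutral ballI) (use rz in auto)
      qed
    qed
    finally show ?thesis .
  qed
  have L: "(\<Sum>t\<in>S. c t * lpart m t j 0) = 0" if "j < k" for j
  proof -
    have "(\<Sum>t\<in>S. c t * lpart m t j 0) = (\<Sum>t\<in>S. c t * seed m t j 0) + (\<Sum>t\<in>S. c t * rpart m t j 0)"
      unfolding sum.distrib [symmetric] by (rule sum.cong) (auto simp: seed_eq_diff algebra_simps)
    then show ?thesis using z[OF that] B by simp
  qed
  \<comment> \<open>One seed for each exponent 0 to m - 1. The remaining k - m seeds, collected in
    \<open>D\<close>, are detected by their derivatives of order m to k - 1.\<close>
  define low where "low n = (if n \<in> F1 then Inl n else Inr (m - 1 - n))" for n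
  define D where "D = S - low ` {..<m}"
  have lowS: "low ` {..<m} \<subseteq> S" using cover by (auto simp: low_def S_def)
  have low_inj: "inj_on low {..<m}" by (auto simp: inj_on_def low_def split: if_splits)
  have finD: "finite D" by (simp add: D_def)
  have cardD: "card D = k - m"
    unfolding D_def using lowS card_image[OF low_inj] by (subst card_Diff_subset) (auto simp: cardS)
  have single: "c (low n) = 0" if n: "n < m" "n \<notin> F1" for n
  proof -
    have lS: "low n \<in> S" using lowS n by auto
    have e: "ev m (low n) = real n" using n by (simp add: low_def of_nat_diff)
    have u: "t = low n" if "t \<in> S" "ev m t = real n" for t
      using ev_eq_nat[OF that] that(1) n by (auto simp: low_def S_def)
    have set: "{t\<in>S. ev m t = real n} = {low n}"
    proof
      show "{t\<in>S. ev m t = real n} \<subseteq> {low n}" using u by blast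
      show "{low n} \<subseteq> {t\<in>S. ev m t = real n}" using lS e by simp
    qed
    have "real n \<in> ev m ` S" using imageI[OF lS, of "ev m"] unfolding e .
    then have "c (low n) * seed m (low n) 0 0 = 0" using A[of "real n"] unfolding set by simp
    moreover have "seed m (low n) 0 0 \<noteq> 0"
      using laguerre_poly_at_0_sign[of "m - 1 - n" m] n by (auto simp: low_def expjet_def)
    ultimately show ?thesis by simp
  qed
  have Dform: "case t of Inl f \<Rightarrow> m \<le> f | Inr f \<Rightarrow> True" if "t \<in> D" for t
  proof (cases t)
    case (Inl f)
    have "m \<le> f"
    proof (rule ccontr)
      assume "\<not> m \<le> f"
      then have "f \<in> {..<m}" by simp
      moreover have "f \<in> F1" using that Inl by (auto simp: D_def S_def)
      then have "t = low f" by (simp add: low_def Inl)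
      ultimately show False using that unfolding D_def by blast
    qed
    then show ?thesis by (simp add: Inl)
  qed simp
  \<comment> \<open>Polynomial seeds in \<open>D\<close> have eigenvalue at least m, exponential
    ones at most m - 1, so no eigenvalue repeats.\<close>
  have evD: "t = u" if tu: "t \<in> D" "u \<in> D" "ev m t = ev m u" for t u
  proof -
    have no: False if "Inl f \<in> D" "ev m (Inl f) = ev m (Inr g)" for f g
      using Dform[OF that(1)] that(2) by simp
    show ?thesis
    proof (cases t)
      case t: (Inl f)
      then show ?thesis using tu no[of f] by (cases u) auto
    next
      case t: (Inr g)
      show ?thesis
      proof (cases u)
        case (Inl f)
        then show ?thesis using tu no[of f g] t by simp
      next
        case (Inr h)
        then show ?thesis using tu t by simp
      qed
    qed
  qed
  \<comment> \<open>Q has degree at most k - m - 1, so starting from derivative m it stays below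
    order k. Seeds outside \<open>D\<close> drop out: their left part is zero or their coefficient
    is already known to be zero.\<close>
  have cD: "c t = 0" if t: "t \<in> D" for t
  proof -
    define Q where "Q = (\<Prod>v\<in>ev m ` D - {ev m t}. [:- v, 1:])"
    have cp: "0 < card D" using t finD by (auto simp: card_gt_0_iff)
    have "card (ev m ` D) \<le> k - m" using card_image_le[OF finD, of "ev m"] cardD by simp
    then have dQ: "degree Q \<le> k - m - 1"
      unfolding Q_def using t finD by (subst degree_prod_eq_sum_degree) (auto simp: card_Diff_singleton)
    have Q0: "poly Q (ev m u) = 0" if "u \<in> D" "u \<noteq> t" for u
      using that evD[OF that(1) t] finD by (auto simp: Q_def poly_prod)
    have Qt: "poly Q (ev m t) \<noteq> 0" using finD by (auto simp: Q_def poly_prod)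
    have "(\<Sum>u\<in>S. c u * poly Q (ev m u) * lpart m u m 0) = 0"
      by (rule jets_eigen_poly_at_0[OF finS eigjet_lpart dQ]) (use L cp cardD in auto)
    moreover have "(\<Sum>u\<in>S - {t}. c u * poly Q (ev m u) * lpart m u m 0) = 0"
    proof (rule sum.neutral, rule ballI)
      fix u assume u: "u \<in> S - {t}"
      show "c u * poly Q (ev m u) * lpart m u m 0 = 0"
      proof (cases "u \<in> D")
        case True
        then show ?thesis using Q0[of u] u by simp
      next
        case False
        then obtain n where n: "n < m" "u = low n" using u by (auto simp: D_def)
        show ?thesis
        proof (cases "n \<in> F1")
          case True
          then show ?thesis using n by (simp add: low_def lpart_def)
        next
          case False
          then show ?thesis using single[OF n(1)] n by simp
        qed
      qed
    qed
    moreover have "t \<in> S" using t by (simp add: D_def)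
    ultimately have "c t * poly Q (ev m t) * lpart m t m 0 = 0" by (simp add: sum.remove[OF finS])
    then show ?thesis using Qt lpart_jet_m[OF Dform[OF t]] by simp
  qed
  show ?thesis
  proof (cases "s \<in> D")
    case False
    then obtain n where n: "n < m" "s = low n" using s by (auto simp: D_def)
    show ?thesis
    proof (cases "n \<in> F1")
      case True
      have sn: "s = Inl n" using n True by (simp add: low_def)
      have "(\<Sum>t\<in>{t\<in>S. ev m t = real n}. c t * seed m t 0 0) = 0" using A[of "real n"] imageI[OF s, of "ev m"] sn by simp
      moreover have "(\<Sum>t\<in>{t\<in>S. ev m t = real n}. c t * seed m t 0 0) = (\<Sum>t\<in>{s}. c t * seed m t 0 0)"
      proof (rule sum.mono_neutral_right)
        show "\<forall>t\<in>{t\<in>S. ev m t = real n} - {s}. c t * seed m t 0 0 = 0"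
        proof
          fix t assume t: "t \<in> {t\<in>S. ev m t = real n} - {s}"
          then have tS: "t \<in> S" "ev m t = real n" "t \<noteq> Inl n" unfolding sn by simp_all
          then have ti: "t = Inr (m - 1 - n)" using ev_eq_nat[OF tS(1,2)] by blast
          have "t \<noteq> low n'" if n': "n' < m" for n'
          proof
            assume "t = low n'"
            then have "n' \<notin> F1" "m - 1 - n = m - 1 - n'" unfolding ti low_def by (simp_all split: if_splits)
            moreover from this(2) have "n = n'" using n(1) n' by linarith
            ultimately show False using True by simp
          qed
          then have "t \<in> D" using tS(1) unfolding D_def by blast
          then show "c t * seed m t 0 0 = 0" using cD by simp
        qed
      qed (use s sn in auto)
      ultimately show ?thesis using polyjet_at_0_nonzero[OF n(1)] sn by simp
    next
      case False
      then show ?thesis using single n by simp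
    qed
  qed (use cD in simp)
qed

lemma Omega_nonzero_iff:
  "(\<forall>x\<ge>0. Omega (- real m) F1 F2 x \<noteq> 0) \<longleftrightarrow>
    (\<forall>n. n \<notin> F1 \<longrightarrow> (if m \<le> n then poly P (real n) \<ge> 0 else (-1) ^ (m - 1 - n) * divdiff P (real n) (real n) \<ge> 0))"
    (is "?L \<longleftrightarrow> ?R")
proof
  assume ?L
  then show ?R using poly_P_nonneg divdiff_P_sign by (metis not_le)
next
  assume R: ?R
  show ?L
  proof (intro allI impI notI)
    fix x :: real assume x: "x \<ge> 0" and "Omega (- real m) F1 F2 x = 0"
    then obtain c s where s: "s \<in> S" "c s \<noteq> 0" and z: "\<And>j. j < k \<Longrightarrow> (\<Sum>s\<in>S. c s * seed m s j x) = 0"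
      unfolding Omega_eq_0_iff[OF fin] S_def [symmetric] k_def [symmetric] by blast
    show False
    proof (cases "x = 0")
      case True
      then show ?thesis using jets_zero_at_0[of c s] z s by simp
    next
      case False
      then have "x > 0" using x by simp
      then have "c s = 0"
      proof (rule glued_trivial[OF _ z _ _ s(1)])
        show "poly P (real n) \<ge> 0" if "m \<le> n" "n \<notin> F1" for n using R that by auto
        show "(-1) ^ (m - 1 - n) * divdiff P (real n) (real n) \<ge> 0" if "n < m" "n \<notin> F1" for n
          using R that by (metis not_le)
      qed
      then show ?thesis using s(2) by simp
    qed
  qed
qed

end

section \<open>Admissibility as a sign condition on the root polynomial\<close>

lemma divdiff_linear_factor: "divdiff ([:- x, 1:] * q) x x = poly q x"
  unfolding divdiff_mult by (simp add: divdiff_def)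

text \<open>Exactly the m - 1 - x factors with n > x are negative.\<close>

lemma vandermonde_sign:
  assumes "x < m"
  shows "(-1) ^ (m - 1 - x) * (\<Prod>n\<in>{..<m} - {x}. real x - real n) > 0"
proof -
  have "{..<m} - {x} = {..<x} \<union> {x<..<m}" using assms by auto
  then have "(\<Prod>n\<in>{..<m} - {x}. real x - real n) = (\<Prod>n\<in>{..<x}. real x - real n) * (\<Prod>n\<in>{x<..<m}. real x - real n)"
    by (simp add: prod.union_disjoint[symmetric] Int_commute disjoint_iff)
  also have "(\<Prod>n\<in>{x<..<m}. real x - real n) = (-1) ^ (m - 1 - x) * (\<Prod>n\<in>{x<..<m}. real n - real x)"
  proof -
    have "(\<Prod>n\<in>{x<..<m}. real x - real n) = (\<Prod>n\<in>{x<..<m}. (-1) * (real n - real x))"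
      by (rule prod.cong) auto
    then show ?thesis by (simp only: prod.distrib prod_constant card_greaterThanLessThan) simp
  qed
  finally have e: "(\<Prod>n\<in>{..<m} - {x}. real x - real n) =
     (\<Prod>n\<in>{..<x}. real x - real n) * ((-1) ^ (m - 1 - x) * (\<Prod>n\<in>{x<..<m}. real n - real x))" .
  have p: "(\<Prod>n\<in>{..<x}. real x - real n) > 0" "(\<Prod>n\<in>{x<..<m}. real n - real x) > 0"
    by (auto intro!: prod_pos)
  then show ?thesis unfolding e by (cases "even (m - 1 - x)") auto
qed

text \<open>Write A for \<open>F1\<close>, B for the reflected \<open>F2\<close> and R for
  {0,...,m-1}. Positivity of the indices as natural numbers gives A \<inter> B \<subseteq> R, and
  the covering gives R \<subseteq> A \<union> B. The products over A and B multiply to those over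
  the union and the intersection, and splitting R off the union leaves exactly
  \<open>Hset\<close>.\<close>

lemma rootpoly_Hset:
  assumes fin: "finite F1" "finite F2" and cover: "\<And>n. n < m \<Longrightarrow> n \<in> F1 \<or> m - 1 - n \<in> F2"
  shows "rootpoly (ev m) (F1 <+> F2) = rootpoly real_of_int (Hset (1 - int m) F1 F2) * rootpoly real {..<m}"
proof -
  let ?g = "\<lambda>z :: int. [:- real_of_int z, 1:]"
  define A B R where "A = int ` F1" and "B = (\<lambda>f. int m - 1 - int f) ` F2" and "R = int ` {..<m}"
  have fAB: "finite A" "finite B" "finite R" using fin by (auto simp: A_def B_def R_def)
  have RI: "R = {0..int m - 1}"
    unfolding R_def using image_int_atLeastLessThan[of 0 m] by (auto simp: lessThan_atLeast0)
  have H: "Hset (1 - int m) F1 F2 = (A \<union> B - R) \<union> (A \<inter> B)"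
    unfolding Hset_def A_def B_def RI by simp
  have RAB: "R \<subseteq> A \<union> B"
  proof
    fix z assume "z \<in> R"
    then obtain n where n: "n < m" "z = int n" by (auto simp: R_def)
    show "z \<in> A \<union> B"
    proof (cases "n \<in> F1")
      case True
      then show ?thesis by (simp add: A_def n)
    next
      case False
      then have "m - 1 - n \<in> F2" using cover[OF n(1)] by simp
      moreover have "int n = int m - 1 - int (m - 1 - n)" using n(1) by (simp add: of_nat_diff)
      ultimately show ?thesis unfolding B_def n(2) by blast
    qed
  qed
  have AB: "A \<inter> B \<subseteq> R" unfolding A_def B_def RI by auto
  have "rootpoly (ev m) (F1 <+> F2) = (\<Prod>f\<in>F1. [:- real f, 1:]) * (\<Prod>f\<in>F2. [:- (real m - 1 - real f), 1:])"
    unfolding rootpoly_def by (simp add: prod.Plus[OF fin])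
  also have "(\<Prod>f\<in>F1. [:- real f, 1:]) = prod ?g A" unfolding A_def by (subst prod.reindex) auto
  also have "(\<Prod>f\<in>F2. [:- (real m - 1 - real f), 1:]) = prod ?g B"
    unfolding B_def by (subst prod.reindex) (auto simp: inj_on_def)
  also have "prod ?g A * prod ?g B = prod ?g (A \<union> B) * prod ?g (A \<inter> B)"
    by (rule prod.union_inter[OF fAB(1,2), symmetric])
  also have "prod ?g (A \<union> B) = prod ?g (A \<union> B - R) * prod ?g R"
    using prod.subset_diff[OF RAB] fAB by simp
  also have "prod ?g (A \<union> B - R) * prod ?g R * prod ?g (A \<inter> B) = prod ?g (A \<union> B - R) * prod ?g (A \<inter> B) * prod ?g R"
    by (simp only: mult_ac)
  also have "prod ?g (A \<union> B - R) * prod ?g (A \<inter> B) = prod ?g (Hset (1 - int m) F1 F2)"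
    unfolding H by (rule prod.union_disjoint[symmetric]) (use fAB AB in auto)
  also have "prod ?g R = rootpoly real {..<m}" unfolding rootpoly_def R_def by (subst prod.reindex) auto
  finally show ?thesis by (simp add: rootpoly_def)
qed

text \<open>For x >= m the extra factor is positive. For x < m it has a simple zero at x, so P'(x)
  is the value of the \<open>Hset\<close> product times a number of sign (-1)^(m-1-x).\<close>

lemma admissible_at_iff:
  assumes fin: "finite F1" "finite F2" and cover: "\<And>n. n < m \<Longrightarrow> n \<in> F1 \<or> m - 1 - n \<in> F2"
  defines "P \<equiv> rootpoly (ev m) (F1 <+> F2)"
  shows "(\<Prod>h\<in>Hset (1 - int m) F1 F2. int x - h) \<ge> 0 \<longleftrightarrow>
    (if m \<le> x then poly P (real x) \<ge> 0 else (-1) ^ (m - 1 - x) * divdiff P (real x) (real x) \<ge> 0)"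
proof -
  let ?H = "rootpoly real_of_int (Hset (1 - int m) F1 F2)" and ?R = "rootpoly real {..<m}"
  have P: "P = ?H * ?R" unfolding P_def by (rule rootpoly_Hset[OF fin cover])
  have "poly ?H (real x) = real_of_int (\<Prod>h\<in>Hset (1 - int m) F1 F2. int x - h)"
    by (simp add: poly_rootpoly)
  then have 1: "(\<Prod>h\<in>Hset (1 - int m) F1 F2. int x - h) \<ge> 0 \<longleftrightarrow> poly ?H (real x) \<ge> 0"
    by (simp only: of_int_0_le_iff)
  show ?thesis
  proof (cases "m \<le> x")
    case True
    then have "poly ?R (real x) > 0" by (auto simp: poly_rootpoly intro!: prod_pos)
    then show ?thesis using 1 True by (simp add: P zero_le_mult_iff)
  next
    case False
    then have x: "x < m" by simp
    have R: "?R = [:- real x, 1:] * rootpoly real ({..<m} - {x})"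
      unfolding rootpoly_def by (rule prod.remove) (use x in auto)
    have "poly ?R (real x) = 0" by (rule rootpoly_root) (use x in auto)
    then have "divdiff P (real x) (real x) = poly ?H (real x) * divdiff ?R (real x) (real x)"
      unfolding P divdiff_mult by simp
    also have "divdiff ?R (real x) (real x) = (\<Prod>n\<in>{..<m} - {x}. real x - real n)"
      unfolding R divdiff_linear_factor by (simp add: poly_rootpoly)
    finally have "(-1) ^ (m - 1 - x) * divdiff P (real x) (real x) =
        poly ?H (real x) * ((-1) ^ (m - 1 - x) * (\<Prod>n\<in>{..<m} - {x}. real x - real n))"
      by simp
    moreover have "b > 0 \<Longrightarrow> 0 \<le> a * b \<longleftrightarrow> 0 \<le> a" for a b :: real by (simp add: zero_le_mult_iff)
    ultimately show ?thesis using 1 False vandermonde_sign[OF x] by (simp only: if_False)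
  qed
qed

lemma (in laguerre_pair) admissible_iff_Omega:
  "admissible (1 - int m) F1 F2 \<longleftrightarrow> (\<forall>x\<ge>0. Omega (- real m) F1 F2 x \<noteq> 0)"
  unfolding Omega_nonzero_iff admissible_def P_def S_def
  by (simp only: admissible_at_iff[OF fin cover])

section \<open>Changing the parity of the size\<close>

lemma pderiv_laguerre_poly_Suc: "pderiv (laguerre_poly (Suc n) a) = - laguerre_poly n (a + 1)"
proof (rule poly_eqI)
  fix j
  have q: "real (Suc j) * ((-1) ^ Suc j / fact (Suc j) * X) = - ((-1) ^ j / fact j * X)" for X :: real
  proof -
    have "real (Suc j) * ((-1) ^ Suc j / fact (Suc j)) = - ((-1) ^ j / fact j :: real)"
      by (simp add: field_simps del: of_nat_Suc)
    then show ?thesis by (metis mult.assoc mult_minus_left)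
  qed
  have e: "real (Suc n) + a = real n + (a + 1)" by simp
  show "coeff (pderiv (laguerre_poly (Suc n) a)) j = coeff (- laguerre_poly n (a + 1)) j"
    unfolding coeff_pderiv coeff_minus coeff_laguerre_poly e
    by (cases "j \<le> n") (simp_all only: q Suc_le_mono if_True diff_Suc_Suc, simp_all)
qed

lemma polyjet_Suc: "polyjet (Suc m) (Suc f) (Suc j) x = - polyjet m f j x"
proof -
  have "(pderiv ^^ Suc j) (laguerre_poly (Suc f) (- real (Suc m))) = (pderiv ^^ j) (- laguerre_poly f (- real m))"
    unfolding funpow_Suc_right comp_def pderiv_laguerre_poly_Suc by simp
  then show ?thesis unfolding polyjet_def by (simp only: higher_pderiv_minus poly_minus)
qed

lemma polyjet_zero: "polyjet m 0 j x = (if j = 0 then 1 else 0)"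
proof -
  have l: "laguerre_poly 0 (- real m) = 1" by (rule poly_eqI) (auto simp: coeff_laguerre_poly)
  show ?thesis
  proof (cases j)
    case (Suc i)
    have "(pderiv ^^ Suc i) (1 :: real poly) = 0"
      unfolding funpow_Suc_right comp_def by (simp add: higher_pderiv_zero)
    then show ?thesis unfolding polyjet_def l Suc by simp
  qed (simp add: polyjet_def l)
qed

lemma expjet_Suc: "expjet (Suc m) f (Suc j) x = expjet m f j x"
  by (simp add: expjet_def)

text \<open>Adjoining the constant function lowers the parameter by one and raises the size by one,
  so the parity of the size can be chosen freely.\<close>

lemma Omega_shift:
  assumes fin: "finite F1" "finite F2"
  shows "Omega (- real (Suc m)) (insert 0 (Suc ` F1)) F2 x = 0 \<longleftrightarrow> Omega (- real m) F1 F2 x = 0"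
proof -
  let ?G = "insert 0 (Suc ` F1)" and ?k = "card F1 + card F2"
  have finG: "finite ?G" using fin by simp
  have card: "card ?G + card F2 = Suc ?k" using fin by (simp add: card_image)
  have sG: "(\<Sum>s\<in>?G <+> F2. h s) = h (Inl 0) + (\<Sum>f\<in>F1. h (Inl (Suc f))) + (\<Sum>f\<in>F2. h (Inr f))" for h :: "_ \<Rightarrow> real"
    using fin by (simp add: sum.Plus[OF finG fin(2)] sum.reindex comp_def)
  have sF: "(\<Sum>s\<in>F1 <+> F2. h s) = (\<Sum>f\<in>F1. h (Inl f)) + (\<Sum>f\<in>F2. h (Inr f))" for h :: "_ \<Rightarrow> real"
    by (simp add: sum.Plus[OF fin] comp_def)
  have rel: "(\<Sum>s\<in>?G <+> F2. d s * seed (Suc m) s (Suc j) x) = (\<Sum>s\<in>F1 <+> F2. c s * seed m s j x)"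
    if "\<And>f. f \<in> F1 \<Longrightarrow> c (Inl f) = - d (Inl (Suc f))" "\<And>f. f \<in> F2 \<Longrightarrow> c (Inr f) = d (Inr f)" for c d j
    unfolding sG sF using that by (simp add: polyjet_Suc polyjet_zero expjet_Suc)
  show ?thesis
  proof
    assume "Omega (- real (Suc m)) ?G F2 x = 0"
    then obtain d s where s: "s \<in> ?G <+> F2" "d s \<noteq> 0"
      and z: "\<And>j. j < Suc ?k \<Longrightarrow> (\<Sum>s\<in>?G <+> F2. d s * seed (Suc m) s j x) = 0"
      unfolding Omega_eq_0_iff[OF finG fin(2)] card by blast
    define c where "c s = (case s of Inl f \<Rightarrow> - d (Inl (Suc f)) | Inr f \<Rightarrow> d (Inr f))" for s
    have z': "(\<Sum>s\<in>F1 <+> F2. c s * seed m s j x) = 0" if "j < ?k" for j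
      using rel[of c d j] z[of "Suc j"] that by (simp add: c_def)
    have "\<exists>s\<in>F1 <+> F2. c s \<noteq> 0"
    proof (rule ccontr)
      assume "\<not> ?thesis"
      then have c0: "c (Inl f) = 0" if "f \<in> F1" for f using that by blast
      have c1: "c (Inr f) = 0" if "f \<in> F2" for f using \<open>\<not> (\<exists>s\<in>F1 <+> F2. c s \<noteq> 0)\<close> that by blast
      have dz: "d (Inl (Suc f)) = 0" if "f \<in> F1" for f using c0[OF that] by (simp add: c_def)
      have dz': "d (Inr f) = 0" if "f \<in> F2" for f using c1[OF that] by (simp add: c_def)
      have "d (Inl 0) = 0" using z[of 0] unfolding sG using dz dz' by (simp add: polyjet_zero)
      then show False using s dz dz' by auto
    qed
    then show "Omega (- real m) F1 F2 x = 0" unfolding Omega_eq_0_iff[OF fin] using z' by blast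
  next
    assume "Omega (- real m) F1 F2 x = 0"
    then obtain c s where s: "s \<in> F1 <+> F2" "c s \<noteq> 0"
      and z: "\<And>j. j < ?k \<Longrightarrow> (\<Sum>s\<in>F1 <+> F2. c s * seed m s j x) = 0"
      unfolding Omega_eq_0_iff[OF fin] by blast
    define e where "e s = (case s of Inl f \<Rightarrow> (case f of 0 \<Rightarrow> 0 | Suc f \<Rightarrow> - c (Inl f)) | Inr f \<Rightarrow> c (Inr f))" for s
    \<comment> \<open>The coefficient of the constant function cancels the value at x; it does not
      affect the derivatives, which are those of the given combination.\<close>
    define d where "d = e(Inl 0 := - (\<Sum>s\<in>?G <+> F2. e s * seed (Suc m) s 0 x))"
    have "(\<Sum>s\<in>?G <+> F2. d s * seed (Suc m) s j x) = 0" if "j < Suc ?k" for j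
    proof (cases j)
      case 0
      then show ?thesis unfolding sG by (simp add: d_def sG) (simp add: e_def polyjet_zero)
    next
      case (Suc i)
      then show ?thesis using rel[of c d i] z[of i] that by (simp add: d_def e_def)
    qed
    moreover have "\<exists>s\<in>?G <+> F2. d s \<noteq> 0"
    proof (cases s)
      case (Inl f)
      then have "Inl (Suc f) \<in> ?G <+> F2" "d (Inl (Suc f)) \<noteq> 0" using s by (auto simp: d_def e_def)
      then show ?thesis by blast
    next
      case (Inr f)
      then have "Inr f \<in> ?G <+> F2" "d (Inr f) \<noteq> 0" using s by (auto simp: d_def e_def)
      then show ?thesis by blast
    qed
    ultimately show "Omega (- real (Suc m)) ?G F2 x = 0" unfolding Omega_eq_0_iff[OF finG fin(2)] card by blast
  qed
qed

text \<open>The bound on c puts the new element 0 inside the removed interval, so it can survive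
  only through the intersection. That happens exactly when -1 lies in the original reflected
  \<open>F2\<close>, and then -1 is in the original set because it lies outside the
  interval.\<close>

lemma Hset_shift:
  assumes "c \<le> 1"
  shows "Hset (c - 1) (insert 0 (Suc ` F1)) F2 = (\<lambda>h. h + 1) ` Hset c F1 F2"
proof -
  have a: "h \<in> int ` insert 0 (Suc ` F1) \<longleftrightarrow> h = 0 \<or> h - 1 \<in> int ` F1" for h
  proof -
    have "h \<in> int ` Suc ` F1 \<longleftrightarrow> h - 1 \<in> int ` F1"
      by (force simp: image_iff)
    then show ?thesis by auto
  qed
  have b: "h \<in> (\<lambda>f. - (c - 1) - int f) ` F2 \<longleftrightarrow> h - 1 \<in> (\<lambda>f. - c - int f) ` F2" for h
    by (force simp: image_iff)
  have i: "h \<in> (\<lambda>h. h + 1) ` X \<longleftrightarrow> h - 1 \<in> X" for h and X :: "int set"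
    by (force simp: image_iff)
  have n: "h - 1 \<in> int ` F1 \<Longrightarrow> h \<ge> 1" for h by auto
  show ?thesis
  proof (rule Set.set_eqI)
    fix h
    show "h \<in> Hset (c - 1) (insert 0 (Suc ` F1)) F2 \<longleftrightarrow> h \<in> (\<lambda>h. h + 1) ` Hset c F1 F2"
      unfolding i unfolding Hset_def Un_iff Diff_iff Int_iff a b atLeastAtMost_iff using n[of h] assms by auto
  qed
qed

text \<open>The new point 0 is exempt because it belongs to the enlarged \<open>F1\<close>; every
  other point is a successor, where the two products coincide.\<close>

lemma admissible_shift:
  assumes "c \<le> 1"
  shows "admissible (c - 1) (insert 0 (Suc ` F1)) F2 \<longleftrightarrow> admissible c F1 F2"
proof -
  have p: "(\<Prod>h\<in>Hset (c - 1) (insert 0 (Suc ` F1)) F2. int (Suc x) - h) = (\<Prod>h\<in>Hset c F1 F2. int x - h)" for x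
    unfolding Hset_shift[OF assms] by (subst prod.reindex) (auto simp: inj_on_def)
  show ?thesis
  proof
    assume L: "admissible (c - 1) (insert 0 (Suc ` F1)) F2"
    show "admissible c F1 F2"
      unfolding admissible_def
    proof (intro allI impI)
      fix x assume "x \<notin> F1"
      then have "Suc x \<notin> insert 0 (Suc ` F1)" by auto
      then show "0 \<le> (\<Prod>h\<in>Hset c F1 F2. int x - h)" using L p[of x] unfolding admissible_def by metis
    qed
  next
    assume R: "admissible c F1 F2"
    show "admissible (c - 1) (insert 0 (Suc ` F1)) F2"
      unfolding admissible_def
    proof (intro allI impI)
      fix x assume x: "x \<notin> insert 0 (Suc ` F1)"
      then obtain y where y: "x = Suc y" "y \<notin> F1" by (cases x) auto
      then show "0 \<le> (\<Prod>h\<in>Hset (c - 1) (insert 0 (Suc ` F1)) F2. int x - h)"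
        using R p[of y] unfolding admissible_def by metis
    qed
  qed
qed

theorem mainTheorem14:
  fixes a :: int and F1 F2 :: "nat set"
  assumes "a \<le> -2"
    and "finite F1" and "finite F2"
    and "\<forall>f\<in>F1. f > 0" and "\<forall>f\<in>F2. f > 0"
    and "{0..-a-1} \<subseteq> int ` F1 \<union> (\<lambda>f. - a - 1 - int f) ` F2"
  shows "admissible (a + 1) F1 F2 \<longleftrightarrow>
         (\<forall>x::real. x \<ge> 0 \<longrightarrow> Omega (real_of_int a) F1 F2 x \<noteq> 0)"
proof -
  define m where "m = nat (- a)"
  have m: "0 < m" "a = - int m" using assms(1) by (auto simp: m_def)
  have ra: "real_of_int a = - real m" and ca: "a + 1 = 1 - int m" using m(2) by simp_all
  have cover: "n \<in> F1 \<or> m - 1 - n \<in> F2" if n: "n < m" for n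
  proof -
    have "int n \<in> {0..-a-1}" using n m(2) by auto
    then have "int n \<in> int ` F1 \<union> (\<lambda>f. - a - 1 - int f) ` F2" using assms(6) by blast
    then show ?thesis
    proof
      assume "int n \<in> (\<lambda>f. - a - 1 - int f) ` F2"
      then obtain f where "f \<in> F2" "int n = int m - 1 - int f" using m(2) by auto
      then have "m - 1 - n = f" by linarith
      then show ?thesis using \<open>f \<in> F2\<close> by simp
    qed auto
  qed
  show ?thesis
  proof (cases "even (card F1 + card F2)")
    case True
    interpret laguerre_pair m F1 F2
      by (rule laguerre_pair.intro[OF m(1) assms(2,3) cover True])
    show ?thesis unfolding ra ca by (rule admissible_iff_Omega)
  next
    case False
    interpret laguerre_pair "Suc m" "insert 0 (Suc ` F1)" F2
    proof
      show "n \<in> insert 0 (Suc ` F1) \<or> Suc m - 1 - n \<in> F2" if "n < Suc m" for n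
        using that cover[of "n - 1"] by (cases n) auto
      show "even (card (insert 0 (Suc ` F1)) + card F2)" using False assms(2) by (simp add: card_image)
    qed (use assms(2,3) in auto)
    have "1 - int (Suc m) = (1 - int m) - 1" by simp
    moreover have "1 - int m \<le> 1" by simp
    ultimately show ?thesis
      using admissible_iff_Omega admissible_shift[of "1 - int m" F1 F2]
      unfolding ra ca Omega_shift[OF assms(2,3)] by simp
  qed
qed

end
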